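(* Let $\Bbbk$ be a field, $\mathsf C$ a small category and $\mathcal A:\mathsf C\to\mathsf{Alg}_\Bbbk$ a diagram of (associative, not necessarily unital) algebras. The solutions of the Maurer–Cartan equation $$0=\delta F+\sum_{n=2}^\infty\widehat{P_n}(F,\dots,F)$$ in the reduced asimplicial subcomplex $\bar C_{\mathrm a}^{\bullet,\bullet}(\mathcal A,\mathcal A)$ (with $F$ of shifted total degree $1$) are precisely the deformations of $\mathcal A$ as a diagram of algebras.
   Context: Write $\langle n\rangle=\{1,\dots,n\}$, $[p]=\{0,\dots,p\}$. TREES. A tree $T$ consists of a finite set $V_T$ (vertices), a set $E_T\subset V_T\times V_T$ (edges) and a partial order $\trianglelefteq_T$ on $V_T$ (strict part $\vartriangleleft_T$) such that: $(u,u)\notin E_T$; $E_T$ generates a partial order $\le_T$ with $(u,v)\in E_T\Rightarrow u<_Tv$; there is a unique $\le_T$-minimal vertex (the root); if $(u,v)\in E_T$ there is no $t$ with $u<_Tt<_Tv$; for all $u,v$ exactly one of $u=v$, $u<_Tv$, $u>_Tv$, $u\vartriangleleft_Tv$, $u\vartriangleright_Tv$ holds; if $u\vartriangleleft_Tv$, $u\le_Tu'$, $v\le_Tv'$ then $u'\vartriangleleft_Tv'$. If $(u,v)\in E_T$, $v$ is a child of $u$. $\mathsf{Tree}(n)$ is the set of trees with vertex set $\langle n\rangle$. WORDS. $\mathsf{F_2S}(n)$ is the set of words (finite sequences) $W$ over $\langle n\rangle$ such that every element of $\langle n\rangle$ appears, no element appears twice consecutively, and for $u\ne v$ there is no subsequence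 $u,v,u,v$. $|W|$ is the length and $\deg W=|W|-n$. Elements of $\langle n\rangle$ are called vertices. QUILTS. $\mathsf{Quilt}(n)$ is the set of pairs $Q=(W_Q,T_Q)\in\mathsf{F_2S}(n)\times\mathsf{Tree}(n)$ such that (1) if some occurrence of $u$ precedes some occurrence of $v$ in $W_Q$ then not $u>_{T_Q}v$; (2) if some occurrence of $v$ lies between two occurrences of $u$ in $W_Q$ then $v\trianglelefteq_{T_Q}u$. $\deg Q=\deg W_Q$, arity $\#Q=n$. OCCURRENCES. $\underline a$ denotes an occurrence (position) of $a$ in $W$. The $\downarrow$ order is the order of first occurrences in $W$. If $W=\dots uv\dots u\dots$ ($v$ immediately after an occurrence of $u$, and $u$ occurs again later), $v$ is interposed; there are $\deg W$ interposed vertices. COCHAINS. $B_p\mathsf C$ is the set of strings $\boldsymbol\phi=(\phi_1,\dots,\phi_p)$, $x_0\xleftarrow{\phi_1}x_1\leftarrow\dots\xleftarrow{\phi_p}x_p$ in $\mathsf C$ (objects if $p=0$). $\phi_{k,l}=\phi_{k+1}\circ\dots\circ\phi_l:x_l\to x_k$ (identity if $k=l$). For strictly increasing $\zeta:[p]\to[p']$ and $\boldsymbol\phi\in B_{p'}\mathsf C$, $\zeta^*\boldsymbol\phi=(\phi_{\zeta(0),\zeta(1)},\dots,\phi_{\zeta(p-1),\zeta(p)})\in B_p\mathsf C$ (the object $x_{\zeta(0)}$ if $p=0$). $C^{p,q}(\mathcal A,\mathcal A)=\prod_{(x_0\leftarrow\dots\leftarrow x_p)\in B_p\mathsf C}\operatorname{Hom}_\Bbbk(\mathcal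 A(x_p)^{\otimes q},\mathcal A(x_0))$; the component of $f$ at $\boldsymbol\phi$ is $f[\boldsymbol\phi]$. For $f\in C^{p,q}$ the shifted total degree is $|f|=p+q-1$. $\delta^{\mathrm S}:C^{p,q}\to C^{p+1,q}$ is $\delta^{\mathrm S}=\sum_{i=0}^{p+1}(-1)^i\delta^{\mathrm S}_i$, $(\delta^{\mathrm S}_if)[\boldsymbol\phi]=\mathcal A[\phi_{0,\varepsilon_i(0)}]\circ f[\varepsilon_i^*\boldsymbol\phi]\circ\mathcal A[\phi_{\varepsilon_i(p),p+1}]^{\otimes q}$, where $\varepsilon_i:[p]\to[p+1]$ is the strictly increasing map whose image omits $i$. $\hat{\mathsf m}\in C^{0,2}(\mathcal A,\mathcal A)$ is multiplication: $\hat{\mathsf m}[x](a,b)=ab$. $\delta^{\mathrm H}f=\widehat B(\hat{\mathsf m},f)-\widehat{B'}(\hat{\mathsf m},f)$, where $B=(12,T)$ with $T$ having root $1$ and single child $2$, and $B'=(21,T')$ with $T'$ having root $2$ and single child $1$ (operations $\widehat Q$ below). $\delta=\delta^{\mathrm S}+\delta^{\mathrm H}$. $\bar C_{\mathrm a}^{\bullet,\bullet}$ is spanned by those $f\in C^{p,q}$, $p\ge0$, $q\ge1$, with $f[\boldsymbol\phi]=0$ whenever some component of $\boldsymbol\phi$ is an identity morphism. COLORINGS. Let $T\in\mathsf{Tree}(n)$, $W\in\mathsf{F_2S}(n)$, $\mathbf p,\mathbf q\in\mathbb N^n$ ($\mathbb N\ni0$), $q'=1+\sum_a(q_a-1)$,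 $p'=\sum_ap_a-\deg W$. $\mathrm{Clr}(T;\mathbf q)$ is the set of $I:E_T\to\mathbb N$ with $1\le I_{(u,v)}\le q_u$ for every edge, and $I_{(t,u)}<I_{(t,v)}$ whenever $u\vartriangleleft_Tv$ are children of $t$. $\mathrm{Clr}(W;\mathbf p)$ is the set of tuples $\boldsymbol\zeta=(\zeta_1,\dots,\zeta_n)$ of strictly increasing maps $\zeta_a:[p_a]\to[p']$ with $\bigcup_a\operatorname{Im}\zeta_a=[p']$ for which there exist (necessarily unique) functions $\pi_a:[p_a]\to W$ such that the image of $\pi_a$ is the set of occurrences of $a$ in $W$; $\zeta_a(\pi_a^{-1}\underline a)$ is a set of consecutive integers for every occurrence $\underline a$; and whenever $\underline b$ immediately follows $\underline a$ in $W$, $\max\zeta_a(\pi_a^{-1}\underline a)=\min\zeta_b(\pi_b^{-1}\underline b)$. (Empty if $p'<0$.) For a quilt $Q$, $\boldsymbol\zeta\in\mathrm{Clr}(W_Q;\mathbf p)$, $I\in\mathrm{Clr}(T_Q;\mathbf q)$, one has $\max\zeta_a\le\min\zeta_b$ for each edge $(a,b)$. ACTION OF A COLORING. For $f_a\in C^{p_a,q_a}(\mathcal A,\mathcal A)$ and $\boldsymbol\phi\in B_{p'}\mathsf C$, $\mathcal L(\boldsymbol\zeta,I;f_1,\dots,f_n)[\boldsymbol\phi]:\mathcal A(x_{p'})^{\otimes q'}\to\mathcal A(x_0)$ is the composite of the multilinear maps $f_a[\zeta_a^*\boldsymbol\phi]:\mathcal A(x_{\zeta_a(p_a)})^{\otimes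 q_a}\to\mathcal A(x_{\zeta_a(0)})$ along the tree: for each edge $(a,b)$ the output of $f_b[\zeta_b^*\boldsymbol\phi]$, after applying $\mathcal A[\phi_{\zeta_a(p_a),\zeta_b(0)}]$, is inserted in the $I_{(a,b)}$-th input of $f_a[\zeta_a^*\boldsymbol\phi]$; each input of $f_a[\zeta_a^*\boldsymbol\phi]$ not used by an edge is precomposed with $\mathcal A[\phi_{\zeta_a(p_a),p'}]$ (remaining inputs in planar order); the output at the root $u$ is followed by $\mathcal A[\phi_{0,\zeta_u(0)}]$. SIGNS. Use letters $0_{\mathrm va},\dots,(p_a-1)_{\mathrm va}$ and $1_{\mathrm ha},\dots,(q_a-1)_{\mathrm ha}$ for each vertex $a$. Initial word: the concatenation over $a=1,\dots,\#Q$ (in this order) of $0_{\mathrm va}\dots(p_a-1)_{\mathrm va}1_{\mathrm ha}\dots(q_a-1)_{\mathrm ha}$. Shuffled word: the concatenation of three words: (i) $0_{\mathrm va}$ for each interposed vertex $a$ of $W_Q$, in reverse $\downarrow$ order; (ii) the word having $i_{\mathrm va}$ in position $\zeta_a(i)$ (positions counted from $0$), for $0\le i\le p_a-1$ if $a$ is not interposed and $1\le i\le p_a-1$ if $a$ is interposed; (iii) the word obtained from the corner word of $T_Q$ (the word $C(\mathrm{root})$, where $C(v)=v\,C(c_1)\,v\,C(c_2)\,v\dots C(c_r)\,v$ for a vertex with children $c_1\vartriangleleft\dots\vartriangleleft c_r$) by replacing, in order, each non-last occurrence of $a$ immediately followed by $b$ with the next unused horizontal letters of $a$ up to $(I_{(a,b)}-1)_{\mathrm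 ha}$, and the last occurrence of $a$ with the remaining horizontal letters of $a$. If $p_a\ge1$ for all interposed $a$ and $q_a\ge1$ for all $a$, $\operatorname{sgn}_Q(\boldsymbol\zeta,I)$ is the sign of the permutation taking the initial word to the shuffled word. Otherwise it is defined by replacing each $q_a=0$ by $2$, and, for each interposed $a$ with $p_a=0$ (so $a$ occurs only once, at $\underline a$), replacing $\boldsymbol\zeta$ by $E_{\underline a}E_{\underline a}\boldsymbol\zeta$, where $E_{\underline a}\boldsymbol\zeta$ is the coloring with $p_a$ increased by $1$ such that $j\in\operatorname{Im}(E_{\underline a}\boldsymbol\zeta)_b$ iff $j=\zeta_b(i)$ with $\pi_b(i)$ before or equal to $\underline a$, or $j=1+\zeta_b(i)$ with $\pi_b(i)$ after or equal to $\underline a$. OPERATIONS. For $Q\in\mathsf{Quilt}(n)$ and $f_a\in C^{p_a,q_a}(\mathcal A,\mathcal A)$, $\widehat Q(f_1,\dots,f_n)=\sum_{\boldsymbol\zeta\in\mathrm{Clr}(W_Q;\mathbf p)}\sum_{I\in\mathrm{Clr}(T_Q;\mathbf q)}\operatorname{sgn}_Q(\boldsymbol\zeta,I)\,\mathcal L(\boldsymbol\zeta,I;f_1,\dots,f_n)$, extended multilinearly and linearly in $Q$. $P^0_n$ is $(-1)^{1+n(n-1)/2}$ times the sum of all quilts $Q\in\mathsf{Quilt}(n)$ with $\deg Q=n-2$ whose $\downarrow$ order is $1,2,\dots,n$. $\widehat{P_n}(f_1,\dots,f_n)=\widehat{P^0_n}(f_1,\dots,f_n)+\widehat{P^0_{n+1}}(\hat{\mathsf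 m},f_1,\dots,f_n)$. For $F$ of shifted total degree $1$ only finitely many $\widehat{P_n}(F,\dots,F)$ are nonzero. DEFORMATION. A deformation of $\mathcal A$ is a cochain $f+g$ with $f\in C^{0,2}(\mathcal A,\mathcal A)$, $g\in C^{1,1}(\mathcal A,\mathcal A)$ such that $\hat{\mathsf m}+f$ and $\mathcal A+g$ define a diagram of algebras: for each object $x$, $\hat{\mathsf m}[x]+f[x]$ is an associative product on $\mathcal A(x)$; for each morphism $\phi$, $\mathcal A[\phi]+g[\phi]$ is a homomorphism of the resulting algebras; and this defines a functor (preserving compositions and identities). *)

theory Defs
  imports
    "HOL-Library.FuncSet"
    "HOL-Library.Sublist"
    "HOL-Combinatorics.Permutations"
    "HOL-Algebra.Module"
begin

section \<open>Planar rooted trees\<close>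

record ptree =
  edges :: "(nat \<times> nat) set"
  planar :: "(nat \<times> nat) set"

abbreviation tle :: "ptree \<Rightarrow> nat \<Rightarrow> nat \<Rightarrow> bool" where
  "tle T u v \<equiv> (u, v) \<in> (edges T)\<^sup>*"

abbreviation tless :: "ptree \<Rightarrow> nat \<Rightarrow> nat \<Rightarrow> bool" where
  "tless T u v \<equiv> tle T u v \<and> u \<noteq> v"

abbreviation left_of :: "ptree \<Rightarrow> nat \<Rightarrow> nat \<Rightarrow> bool" where
  "left_of T u v \<equiv> (u, v) \<in> planar T \<and> u \<noteq> v"

definition is_root :: "nat set \<Rightarrow> ptree \<Rightarrow> nat \<Rightarrow> bool" where
  "is_root V T r \<longleftrightarrow> r \<in> V \<and> (\<forall>u\<in>V. \<not> tless T u r)"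

definition is_tree :: "nat set \<Rightarrow> ptree \<Rightarrow> bool" where
  "is_tree V T \<longleftrightarrow>
     finite V \<and> edges T \<subseteq> V \<times> V \<and>
     planar T \<subseteq> V \<times> V \<and> partial_order_on V (planar T) \<and>
     (\<forall>u\<in>V. (u, u) \<notin> edges T) \<and>
     antisym ((edges T)\<^sup>*) \<and>
     (\<exists>!r. is_root V T r) \<and>
     (\<forall>(u, v)\<in>edges T. \<not> (\<exists>t\<in>V. tless T u t \<and> tless T t v)) \<and>
     (\<forall>u\<in>V. \<forall>v\<in>V.
        length (filter (\<lambda>b. b)
          [u = v, tless T u v, tless T v u, left_of T u v, left_of T v u]) = 1) \<and>
     (\<forall>u\<in>V. \<forall>v\<in>V. \<forall>u'\<in>V. \<forall>v'\<in>V.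
        left_of T u v \<and> tle T u u' \<and> tle T v v' \<longrightarrow> left_of T u' v')"

definition Trees :: "nat \<Rightarrow> ptree set" where
  "Trees n = {T. is_tree {1..n} T}"

definition root :: "nat \<Rightarrow> ptree \<Rightarrow> nat" where
  "root n T = (THE r. is_root {1..n} T r)"

definition children :: "ptree \<Rightarrow> nat \<Rightarrow> nat list" where
  "children T v = (THE cs. distinct cs \<and> set cs = {c. (v, c) \<in> edges T} \<and> sorted_wrt (left_of T) cs)"

text \<open>The first argument bounds the depth of the recursion; a tree on \<open>n\<close> vertices has height
  at most \<open>n\<close>.\<close>

primrec corner_word :: "nat \<Rightarrow> ptree \<Rightarrow> nat \<Rightarrow> nat list" where
  "corner_word 0 T v = []"
| "corner_word (Suc k) T v = v # concat (map (\<lambda>c. corner_word k T c @ [v]) (children T v))"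


section \<open>Words and quilts\<close>

definition F2S :: "nat \<Rightarrow> nat list set" where
  "F2S n = {W. set W = {1..n} \<and> distinct_adj W \<and> (\<forall>u v. u \<noteq> v \<longrightarrow> \<not> subseq [u, v, u, v] W)}"

definition word_deg :: "nat list \<Rightarrow> nat" where
  "word_deg W = length W - card (set W)"

text \<open>The letters of \<open>W\<close> in the order of their first occurrences.\<close>

definition down_order :: "nat list \<Rightarrow> nat list" where
  "down_order W = rev (remdups (rev W))"

definition interposed :: "nat list \<Rightarrow> nat \<Rightarrow> bool" where
  "interposed W v \<longleftrightarrow> (\<exists>j k. Suc j < k \<and> k < length W \<and> W ! Suc j = v \<and> W ! k = W ! j)"

type_synonym quilt = "nat list \<times> ptree"

definition Quilts :: "nat \<Rightarrow> quilt set" where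
  "Quilts n = {(W, T). W \<in> F2S n \<and> T \<in> Trees n \<and>
     (\<forall>i j. i < j \<and> j < length W \<longrightarrow> \<not> tless T (W ! j) (W ! i)) \<and>
     (\<forall>i j k. i < j \<and> j < k \<and> k < length W \<and> W ! i = W ! k \<longrightarrow> (W ! j, W ! i) \<in> planar T)}"


section \<open>Colorings\<close>

definition tree_colorings :: "ptree \<Rightarrow> (nat \<Rightarrow> nat) \<Rightarrow> (nat \<times> nat \<Rightarrow> nat) set" where
  "tree_colorings T q = {I \<in> (\<Pi>\<^sub>E e\<in>edges T. {1..q (fst e)}).
     \<forall>t u v. (t, u) \<in> edges T \<and> (t, v) \<in> edges T \<and> left_of T u v \<longrightarrow> I (t, u) < I (t, v)}"

text \<open>An occurrence is a position in \<open>W\<close>. The set \<open>block W p \<zeta> \<pi> j\<close> consists of the values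
  of \<open>\<zeta>\<^sub>a\<close> on the fibre of \<open>\<pi>\<^sub>a\<close> over position \<open>j\<close>, where \<open>a = W ! j\<close>.\<close>

definition block ::
  "nat list \<Rightarrow> (nat \<Rightarrow> nat) \<Rightarrow> (nat \<Rightarrow> nat \<Rightarrow> nat) \<Rightarrow> (nat \<Rightarrow> nat \<Rightarrow> nat) \<Rightarrow> nat \<Rightarrow> nat set" where
  "block W p \<zeta> \<pi> j = \<zeta> (W ! j) ` {i. i \<le> p (W ! j) \<and> \<pi> (W ! j) i = j}"

definition is_projection ::
  "nat \<Rightarrow> nat list \<Rightarrow> (nat \<Rightarrow> nat) \<Rightarrow> (nat \<Rightarrow> nat \<Rightarrow> nat) \<Rightarrow> (nat \<Rightarrow> nat \<Rightarrow> nat) \<Rightarrow> bool" where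
  "is_projection n W p \<zeta> \<pi> \<longleftrightarrow>
     \<pi> \<in> (\<Pi>\<^sub>E a\<in>{1..n}. {..p a} \<rightarrow>\<^sub>E {..<length W}) \<and>
     (\<forall>a\<in>{1..n}. \<pi> a ` {..p a} = {j. j < length W \<and> W ! j = a}) \<and>
     (\<forall>j<length W. \<exists>l u. block W p \<zeta> \<pi> j = {l..u}) \<and>
     (\<forall>j. Suc j < length W \<longrightarrow> Max (block W p \<zeta> \<pi> j) = Min (block W p \<zeta> \<pi> (Suc j)))"

definition word_colorings ::
  "nat \<Rightarrow> nat list \<Rightarrow> (nat \<Rightarrow> nat) \<Rightarrow> (nat \<Rightarrow> nat \<Rightarrow> nat) set" where
  "word_colorings n W p =
     (if (\<Sum>a=1..n. p a) < word_deg W then {}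
      else let p' = (\<Sum>a=1..n. p a) - word_deg W in
        {\<zeta> \<in> (\<Pi>\<^sub>E a\<in>{1..n}. {..p a} \<rightarrow>\<^sub>E {..p'}).
           (\<forall>a\<in>{1..n}. strict_mono_on {..p a} (\<zeta> a)) \<and>
           (\<Union>a\<in>{1..n}. \<zeta> a ` {..p a}) = {..p'} \<and>
           (\<exists>\<pi>. is_projection n W p \<zeta> \<pi>)})"


section \<open>Signs\<close>

text \<open>\<open>VLetter i a\<close> and \<open>HLetter i a\<close> are the letters \<open>i\<^sub>v\<^sub>a\<close> and \<open>i\<^sub>h\<^sub>a\<close>.\<close>

datatype letter = VLetter nat nat | HLetter nat nat

definition permutation_sign :: "'x list \<Rightarrow> 'x list \<Rightarrow> int" where
  "permutation_sign xs ys =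
     sign (THE \<sigma>. \<sigma> permutes {..<length xs} \<and> permute_list \<sigma> xs = ys)"

definition initial_word :: "nat \<Rightarrow> (nat \<Rightarrow> nat) \<Rightarrow> (nat \<Rightarrow> nat) \<Rightarrow> letter list" where
  "initial_word n p q =
     concat (map (\<lambda>a. map (\<lambda>i. VLetter i a) [0..<p a] @ map (\<lambda>i. HLetter i a) [1..<q a]) [1..<Suc n])"

definition vertical_word ::
  "nat \<Rightarrow> nat list \<Rightarrow> (nat \<Rightarrow> nat) \<Rightarrow> (nat \<Rightarrow> nat \<Rightarrow> nat) \<Rightarrow> letter list" where
  "vertical_word n W p \<zeta> =
     map (\<lambda>t. THE l. \<exists>a i. l = VLetter i a \<and> a \<in> {1..n} \<and> i < p a \<and>
                 (interposed W a \<longrightarrow> 1 \<le> i) \<and> \<zeta> a i = t)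
       [0..<(\<Sum>a=1..n. p a) - word_deg W]"

text \<open>At position \<open>k\<close> of the corner word \<open>w\<close>, with \<open>a = w ! k\<close>, the horizontal letters of \<open>a\<close>
  used at earlier positions are those below \<open>I (a, b)\<close> for each \<open>b\<close> that immediately follows an
  earlier occurrence of \<open>a\<close>.\<close>

definition horizontal_word ::
  "nat \<Rightarrow> ptree \<Rightarrow> (nat \<Rightarrow> nat) \<Rightarrow> (nat \<times> nat \<Rightarrow> nat) \<Rightarrow> letter list" where
  "horizontal_word n T q I =
     (let w = corner_word n T (root n T) in
      concat (map (\<lambda>k. let a = w ! k in
          map (\<lambda>i. HLetter i a)
            [Max (insert 1 {I (a, w ! Suc j) | j. j < k \<and> w ! j = a}) ..<
             (if \<exists>j. k < j \<and> j < length w \<and> w ! j = a then I (a, w ! Suc k) else q a)])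
        [0..<length w]))"

definition shuffled_word ::
  "nat \<Rightarrow> quilt \<Rightarrow> (nat \<Rightarrow> nat) \<Rightarrow> (nat \<Rightarrow> nat) \<Rightarrow> (nat \<Rightarrow> nat \<Rightarrow> nat) \<Rightarrow> (nat \<times> nat \<Rightarrow> nat) \<Rightarrow> letter list"
where
  "shuffled_word n Q p q \<zeta> I =
     map (VLetter 0) (filter (interposed (fst Q)) (rev (down_order (fst Q)))) @
     vertical_word n (fst Q) p \<zeta> @
     horizontal_word n (snd Q) q I"

text \<open>The extension \<open>E\<close> at position \<open>r\<close> of \<open>W\<close>, acting on the pair \<open>(p, \<zeta>)\<close>.\<close>

definition extend_coloring ::
  "nat \<Rightarrow> nat list \<Rightarrow> nat \<Rightarrow> (nat \<Rightarrow> nat) \<times> (nat \<Rightarrow> nat \<Rightarrow> nat) \<Rightarrow> (nat \<Rightarrow> nat) \<times> (nat \<Rightarrow> nat \<Rightarrow> nat)" where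
  "extend_coloring n W r = (\<lambda>(p, \<zeta>).
     let \<pi> = (THE \<pi>. is_projection n W p \<zeta> \<pi>);
         p' = p(W ! r := Suc (p (W ! r)))
     in (p', \<lambda>b\<in>{1..n}. \<lambda>i\<in>{..p' b}.
           sorted_list_of_set
             ({\<zeta> b i | i. i \<le> p b \<and> \<pi> b i \<le> r} \<union> {1 + \<zeta> b i | i. i \<le> p b \<and> r \<le> \<pi> b i}) ! i))"

text \<open>When \<open>p a \<ge> 1\<close> for all interposed \<open>a\<close> and all \<open>q a \<ge> 1\<close>, the modifications below are
  void. The order in which the interposed vertices are treated is immaterial.\<close>

definition quilt_sign ::
  "nat \<Rightarrow> quilt \<Rightarrow> (nat \<Rightarrow> nat) \<Rightarrow> (nat \<Rightarrow> nat) \<Rightarrow> (nat \<Rightarrow> nat \<Rightarrow> nat) \<Rightarrow> (nat \<times> nat \<Rightarrow> nat) \<Rightarrow> int" where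
  "quilt_sign n Q p q \<zeta> I =
     (let W = fst Q;
          q' = (\<lambda>a. if q a = 0 then 2 else q a);
          E = (\<lambda>a. extend_coloring n W (THE r. r < length W \<and> W ! r = a));
          (p', \<zeta>') = fold (\<lambda>a. E a \<circ> E a) (filter (\<lambda>a. interposed W a \<and> p a = 0) [1..<Suc n]) (p, \<zeta>)
      in permutation_sign (initial_word n p' q') (shuffled_word n Q p' q' \<zeta>' I))"


section \<open>Categories and diagrams of algebras\<close>

record ('o, 'm) category =
  Obj :: "'o set"
  Mor :: "'m set"
  Src :: "'m \<Rightarrow> 'o"
  Tgt :: "'m \<Rightarrow> 'o"
  Ident :: "'o \<Rightarrow> 'm"
  Comp :: "'m \<Rightarrow> 'm \<Rightarrow> 'm"

locale small_category =
  fixes C :: "('o, 'm) category"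
  assumes src_obj: "f \<in> Mor C \<Longrightarrow> Src C f \<in> Obj C"
    and tgt_obj: "f \<in> Mor C \<Longrightarrow> Tgt C f \<in> Obj C"
    and ident_mor: "x \<in> Obj C \<Longrightarrow> Ident C x \<in> Mor C"
    and ident_src: "x \<in> Obj C \<Longrightarrow> Src C (Ident C x) = x"
    and ident_tgt: "x \<in> Obj C \<Longrightarrow> Tgt C (Ident C x) = x"
    and comp_mor: "\<lbrakk>f \<in> Mor C; g \<in> Mor C; Src C f = Tgt C g\<rbrakk> \<Longrightarrow> Comp C f g \<in> Mor C"
    and comp_src: "\<lbrakk>f \<in> Mor C; g \<in> Mor C; Src C f = Tgt C g\<rbrakk> \<Longrightarrow> Src C (Comp C f g) = Src C g"
    and comp_tgt: "\<lbrakk>f \<in> Mor C; g \<in> Mor C; Src C f = Tgt C g\<rbrakk> \<Longrightarrow> Tgt C (Comp C f g) = Tgt C f"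
    and ident_left: "f \<in> Mor C \<Longrightarrow> Comp C (Ident C (Tgt C f)) f = f"
    and ident_right: "f \<in> Mor C \<Longrightarrow> Comp C f (Ident C (Src C f)) = f"
    and comp_assoc: "\<lbrakk>f \<in> Mor C; g \<in> Mor C; h \<in> Mor C; Src C f = Tgt C g; Src C g = Tgt C h\<rbrakk>
          \<Longrightarrow> Comp C (Comp C f g) h = Comp C f (Comp C g h)"

text \<open>An associative, not necessarily unital algebra is carried by the library's module record;
  its product is the field \<open>mult\<close>, and the field \<open>one\<close> is not used.\<close>

locale assoc_algebra = module R M for R (structure) and M (structure) +
  assumes mult_closed: "\<lbrakk>a \<in> carrier M; b \<in> carrier M\<rbrakk> \<Longrightarrow> a \<otimes>\<^bsub>M\<^esub> b \<in> carrier M"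
    and mult_assoc: "\<lbrakk>a \<in> carrier M; b \<in> carrier M; c \<in> carrier M\<rbrakk>
          \<Longrightarrow> (a \<otimes>\<^bsub>M\<^esub> b) \<otimes>\<^bsub>M\<^esub> c = a \<otimes>\<^bsub>M\<^esub> (b \<otimes>\<^bsub>M\<^esub> c)"
    and mult_add_left: "\<lbrakk>a \<in> carrier M; b \<in> carrier M; c \<in> carrier M\<rbrakk>
          \<Longrightarrow> (a \<oplus>\<^bsub>M\<^esub> b) \<otimes>\<^bsub>M\<^esub> c = (a \<otimes>\<^bsub>M\<^esub> c) \<oplus>\<^bsub>M\<^esub> (b \<otimes>\<^bsub>M\<^esub> c)"
    and mult_add_right: "\<lbrakk>a \<in> carrier M; b \<in> carrier M; c \<in> carrier M\<rbrakk>
          \<Longrightarrow> a \<otimes>\<^bsub>M\<^esub> (b \<oplus>\<^bsub>M\<^esub> c) = (a \<otimes>\<^bsub>M\<^esub> b) \<oplus>\<^bsub>M\<^esub> (a \<otimes>\<^bsub>M\<^esub> c)"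
    and mult_smult_left: "\<lbrakk>r \<in> carrier R; a \<in> carrier M; b \<in> carrier M\<rbrakk>
          \<Longrightarrow> (r \<odot>\<^bsub>M\<^esub> a) \<otimes>\<^bsub>M\<^esub> b = r \<odot>\<^bsub>M\<^esub> (a \<otimes>\<^bsub>M\<^esub> b)"
    and mult_smult_right: "\<lbrakk>r \<in> carrier R; a \<in> carrier M; b \<in> carrier M\<rbrakk>
          \<Longrightarrow> a \<otimes>\<^bsub>M\<^esub> (r \<odot>\<^bsub>M\<^esub> b) = r \<odot>\<^bsub>M\<^esub> (a \<otimes>\<^bsub>M\<^esub> b)"

definition algebra_hom ::
  "('k, 'r) ring_scheme \<Rightarrow> ('k, 'a) module \<Rightarrow> ('k, 'a) module \<Rightarrow> ('a \<Rightarrow> 'a) set" where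
  "algebra_hom R M N = {h \<in> carrier M \<rightarrow> carrier N.
     (\<forall>a\<in>carrier M. \<forall>b\<in>carrier M. h (a \<oplus>\<^bsub>M\<^esub> b) = h a \<oplus>\<^bsub>N\<^esub> h b) \<and>
     (\<forall>r\<in>carrier R. \<forall>a\<in>carrier M. h (r \<odot>\<^bsub>M\<^esub> a) = r \<odot>\<^bsub>N\<^esub> h a) \<and>
     (\<forall>a\<in>carrier M. \<forall>b\<in>carrier M. h (a \<otimes>\<^bsub>M\<^esub> b) = h a \<otimes>\<^bsub>N\<^esub> h b)}"

record ('o, 'm, 'k, 'a) diagram =
  alg :: "'o \<Rightarrow> ('k, 'a) module"
  act :: "'m \<Rightarrow> 'a \<Rightarrow> 'a"

locale diagram_of_algebras =
  fixes R :: "('k, 'r) ring_scheme" and C :: "('o, 'm) category" and A :: "('o, 'm, 'k, 'a) diagram"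
  assumes alg_algebra: "x \<in> Obj C \<Longrightarrow> assoc_algebra R (alg A x)"
    and act_hom: "f \<in> Mor C \<Longrightarrow> act A f \<in> algebra_hom R (alg A (Src C f)) (alg A (Tgt C f))"
    and act_ident: "\<lbrakk>x \<in> Obj C; a \<in> carrier (alg A x)\<rbrakk> \<Longrightarrow> act A (Ident C x) a = a"
    and act_comp: "\<lbrakk>f \<in> Mor C; g \<in> Mor C; Src C f = Tgt C g; a \<in> carrier (alg A (Src C g))\<rbrakk>
          \<Longrightarrow> act A (Comp C f g) a = act A f (act A g a)"


section \<open>Cochains\<close>

text \<open>A string \<open>x\<^sub>0 \<leftarrow> x\<^sub>1 \<leftarrow> \<dots> \<leftarrow> x\<^sub>p\<close> is the pair of \<open>x\<^sub>0\<close> and the list of its morphisms, so that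
  \<open>snd \<phi> ! i\<close> is \<open>\<phi>\<^sub>i\<^sub>+\<^sub>1\<close>.\<close>

type_synonym ('o, 'm) string = "'o \<times> 'm list"

definition vtx :: "('o, 'm) category \<Rightarrow> ('o, 'm) string \<Rightarrow> nat \<Rightarrow> 'o" where
  "vtx C \<phi> k = (case k of 0 \<Rightarrow> fst \<phi> | Suc j \<Rightarrow> Src C (snd \<phi> ! j))"

definition strings :: "('o, 'm) category \<Rightarrow> nat \<Rightarrow> ('o, 'm) string set" where
  "strings C p = {\<phi>. fst \<phi> \<in> Obj C \<and> length (snd \<phi>) = p \<and> set (snd \<phi>) \<subseteq> Mor C \<and>
     (\<forall>i<p. Tgt C (snd \<phi> ! i) = vtx C \<phi> i)}"

text \<open>The composite \<open>\<phi>\<^sub>k\<^sub>,\<^sub>l\<close> from \<open>x\<^sub>l\<close> to \<open>x\<^sub>k\<close>, and the pullback of a string along \<open>\<zeta>\<close> on \<open>{0..p}\<close>.\<close>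

definition seg :: "('o, 'm) category \<Rightarrow> ('o, 'm) string \<Rightarrow> nat \<Rightarrow> nat \<Rightarrow> 'm" where
  "seg C \<phi> k l = foldr (\<lambda>i \<psi>. Comp C (snd \<phi> ! i) \<psi>) [k..<l] (Ident C (vtx C \<phi> l))"

definition pull :: "('o, 'm) category \<Rightarrow> nat \<Rightarrow> (nat \<Rightarrow> nat) \<Rightarrow> ('o, 'm) string \<Rightarrow> ('o, 'm) string" where
  "pull C p \<zeta> \<phi> = (vtx C \<phi> (\<zeta> 0), map (\<lambda>i. seg C \<phi> (\<zeta> i) (\<zeta> (Suc i))) [0..<p])"

definition tuples :: "('k, 'a) module \<Rightarrow> nat \<Rightarrow> 'a list set" where
  "tuples M q = {as. length as = q \<and> set as \<subseteq> carrier M}"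

text \<open>Linear maps from the \<open>q\<close>-th tensor power of \<open>M\<close> to \<open>N\<close>, as multilinear maps on tuples.\<close>

definition multilinear ::
  "('k, 'r) ring_scheme \<Rightarrow> nat \<Rightarrow> ('k, 'a) module \<Rightarrow> ('k, 'a) module \<Rightarrow> ('a list \<Rightarrow> 'a) set" where
  "multilinear R q M N = {h \<in> tuples M q \<rightarrow> carrier N.
     (\<forall>as\<in>tuples M q. \<forall>i<q. \<forall>a\<in>carrier M. \<forall>b\<in>carrier M.
        h (as[i := a \<oplus>\<^bsub>M\<^esub> b]) = h (as[i := a]) \<oplus>\<^bsub>N\<^esub> h (as[i := b])) \<and>
     (\<forall>as\<in>tuples M q. \<forall>i<q. \<forall>r\<in>carrier R. \<forall>a\<in>carrier M.
        h (as[i := r \<odot>\<^bsub>M\<^esub> a]) = r \<odot>\<^bsub>N\<^esub> h (as[i := a]))}"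

type_synonym ('o, 'm, 'a) cochain = "('o, 'm) string \<Rightarrow> 'a list \<Rightarrow> 'a"

definition cochains ::
  "('k, 'r) ring_scheme \<Rightarrow> ('o, 'm) category \<Rightarrow> ('o, 'm, 'k, 'a) diagram \<Rightarrow> nat \<Rightarrow> nat
     \<Rightarrow> ('o, 'm, 'a) cochain set" where
  "cochains R C A p q =
     {f. \<forall>\<phi>\<in>strings C p. f \<phi> \<in> multilinear R q (alg A (vtx C \<phi> p)) (alg A (vtx C \<phi> 0))}"

definition vanishes ::
  "('o, 'm) category \<Rightarrow> ('o, 'm, 'k, 'a) diagram \<Rightarrow> nat \<Rightarrow> nat \<Rightarrow> ('o, 'm, 'a) cochain \<Rightarrow> bool" where
  "vanishes C A p q f \<longleftrightarrow>
     (\<forall>\<phi>\<in>strings C p. \<forall>as\<in>tuples (alg A (vtx C \<phi> p)) q. f \<phi> as = \<zero>\<^bsub>alg A (vtx C \<phi> 0)\<^esub>)"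

text \<open>A family of cochains; \<open>F p q\<close> is the component of \<open>F\<close> in bidegree \<open>(p, q)\<close>.\<close>

type_synonym ('o, 'm, 'a) gcochain = "nat \<Rightarrow> nat \<Rightarrow> ('o, 'm, 'a) cochain"

definition shifted_degree ::
  "('o, 'm) category \<Rightarrow> ('o, 'm, 'k, 'a) diagram \<Rightarrow> int \<Rightarrow> ('o, 'm, 'a) gcochain \<Rightarrow> bool" where
  "shifted_degree C A d F \<longleftrightarrow>
     (\<forall>p q. int p + int q - 1 \<noteq> d \<longrightarrow> vanishes C A p q (F p q))"

definition reduced_asimplicial ::
  "('k, 'r) ring_scheme \<Rightarrow> ('o, 'm) category \<Rightarrow> ('o, 'm, 'k, 'a) diagram
     \<Rightarrow> ('o, 'm, 'a) gcochain set" where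
  "reduced_asimplicial R C A = {F.
     (\<forall>p q. F p q \<in> cochains R C A p q) \<and>
     finite {(p, q). \<not> vanishes C A p q (F p q)} \<and>
     (\<forall>p. vanishes C A p 0 (F p 0)) \<and>
     (\<forall>p q. \<forall>\<phi>\<in>strings C p. set (snd \<phi>) \<inter> Ident C ` Obj C \<noteq> {} \<longrightarrow>
        (\<forall>as\<in>tuples (alg A (vtx C \<phi> p)) q. F p q \<phi> as = \<zero>\<^bsub>alg A (vtx C \<phi> 0)\<^esub>))}"


section \<open>Operations of quilts on cochains\<close>

definition child_at :: "ptree \<Rightarrow> (nat \<times> nat \<Rightarrow> nat) \<Rightarrow> nat \<Rightarrow> nat \<Rightarrow> nat option" where
  "child_at T I v j =
     (if \<exists>b. (v, b) \<in> edges T \<and> I (v, b) = j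
      then Some (THE b. (v, b) \<in> edges T \<and> I (v, b) = j) else None)"

text \<open>The number of inputs of the whole composite that lie over the \<open>j\<close>-th input of vertex \<open>v\<close>. For
  a subtree with vertex set \<open>D\<close> this is \<open>1 + \<Sum>(q\<^sub>c - 1)\<close>.\<close>

definition input_width ::
  "ptree \<Rightarrow> (nat \<times> nat \<Rightarrow> nat) \<Rightarrow> (nat \<Rightarrow> nat) \<Rightarrow> nat \<Rightarrow> nat \<Rightarrow> nat" where
  "input_width T I q v j =
     (case child_at T I v j of
        None \<Rightarrow> 1
      | Some b \<Rightarrow> let D = {c. tle T b c} in (\<Sum>c\<in>D. q c) + 1 - card D)"

text \<open>The composite along the subtree at \<open>v\<close>, before the map to \<open>x\<^sub>0\<close> or to the parent of \<open>v\<close>. The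
  argument list is cut into consecutive segments, one for each input of \<open>v\<close>, in planar order.
  The first argument bounds the depth of the recursion, as for \<open>corner_word\<close>.\<close>

primrec subtree_action ::
  "nat \<Rightarrow> ('o, 'm) category \<Rightarrow> ('o, 'm, 'k, 'a) diagram \<Rightarrow> ptree \<Rightarrow> (nat \<times> nat \<Rightarrow> nat)
     \<Rightarrow> (nat \<Rightarrow> nat) \<Rightarrow> (nat \<Rightarrow> nat) \<Rightarrow> (nat \<Rightarrow> nat \<Rightarrow> nat) \<Rightarrow> (nat \<Rightarrow> ('o, 'm, 'a) cochain)
     \<Rightarrow> ('o, 'm) string \<Rightarrow> nat \<Rightarrow> 'a list \<Rightarrow> 'a" where
  "subtree_action 0 C A T I p q \<zeta> f \<phi> v as = undefined"
| "subtree_action (Suc k) C A T I p q \<zeta> f \<phi> v as =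
     f v (pull C (p v) (\<zeta> v) \<phi>)
       (map (\<lambda>j.
          let xs = take (input_width T I q v j) (drop (\<Sum>i=1..<j. input_width T I q v i) as)
          in case child_at T I v j of
               None \<Rightarrow> act A (seg C \<phi> (\<zeta> v (p v)) (length (snd \<phi>))) (hd xs)
             | Some b \<Rightarrow> act A (seg C \<phi> (\<zeta> v (p v)) (\<zeta> b 0))
                           (subtree_action k C A T I p q \<zeta> f \<phi> b xs))
        [1..<Suc (q v)])"

definition coloring_action ::
  "('o, 'm) category \<Rightarrow> ('o, 'm, 'k, 'a) diagram \<Rightarrow> nat \<Rightarrow> ptree \<Rightarrow> (nat \<times> nat \<Rightarrow> nat)
     \<Rightarrow> (nat \<Rightarrow> nat) \<Rightarrow> (nat \<Rightarrow> nat) \<Rightarrow> (nat \<Rightarrow> nat \<Rightarrow> nat) \<Rightarrow> (nat \<Rightarrow> ('o, 'm, 'a) cochain)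
     \<Rightarrow> ('o, 'm, 'a) cochain" where
  "coloring_action C A n T I p q \<zeta> f \<phi> as =
     (let u = root n T
      in act A (seg C \<phi> 0 (\<zeta> u 0)) (subtree_action n C A T I p q \<zeta> f \<phi> u as))"

text \<open>The operation of a quilt on cochains \<open>f a\<close> of bidegree \<open>(p a, q a)\<close>, \<open>1 \<le> a \<le> n\<close>.\<close>

definition quilt_op_hom ::
  "('o, 'm) category \<Rightarrow> ('o, 'm, 'k, 'a) diagram \<Rightarrow> nat \<Rightarrow> quilt \<Rightarrow> (nat \<Rightarrow> nat) \<Rightarrow> (nat \<Rightarrow> nat)
     \<Rightarrow> (nat \<Rightarrow> ('o, 'm, 'a) cochain) \<Rightarrow> ('o, 'm, 'a) cochain" where
  "quilt_op_hom C A n Q p q f \<phi> as =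
     (\<Oplus>\<^bsub>alg A (vtx C \<phi> 0)\<^esub>\<zeta>\<in>word_colorings n (fst Q) p.
        \<Oplus>\<^bsub>alg A (vtx C \<phi> 0)\<^esub>I\<in>tree_colorings (snd Q) q.
          [quilt_sign n Q p q \<zeta> I] \<cdot>\<^bsub>alg A (vtx C \<phi> 0)\<^esub>
             coloring_action C A n (snd Q) I p q \<zeta> f \<phi> as)"

text \<open>Multilinear extension: the component of the result in bidegree \<open>(p', q')\<close> collects the finitely
  many choices of bidegrees \<open>(p a, q a)\<close> with \<open>p' = \<Sum>p\<^sub>a - deg W\<close> and \<open>q' = 1 + \<Sum>(q\<^sub>a - 1)\<close>.\<close>

definition bidegrees :: "nat \<Rightarrow> nat list \<Rightarrow> nat \<Rightarrow> nat \<Rightarrow> ((nat \<Rightarrow> nat) \<times> (nat \<Rightarrow> nat)) set" where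
  "bidegrees n W p' q' =
     {(p, q). p \<in> ({1..n} \<rightarrow>\<^sub>E UNIV) \<and> q \<in> ({1..n} \<rightarrow>\<^sub>E UNIV) \<and>
        (\<Sum>a=1..n. p a) = p' + word_deg W \<and> (\<Sum>a=1..n. q a) + 1 = q' + n}"

definition quilt_op ::
  "('o, 'm) category \<Rightarrow> ('o, 'm, 'k, 'a) diagram \<Rightarrow> nat \<Rightarrow> quilt \<Rightarrow> (nat \<Rightarrow> ('o, 'm, 'a) gcochain)
     \<Rightarrow> ('o, 'm, 'a) gcochain" where
  "quilt_op C A n Q F p' q' \<phi> as =
     (\<Oplus>\<^bsub>alg A (vtx C \<phi> 0)\<^esub>pq\<in>bidegrees n (fst Q) p' q'.
        quilt_op_hom C A n Q (fst pq) (snd pq) (\<lambda>a. F a (fst pq a) (snd pq a)) \<phi> as)"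

definition mhat :: "('o, 'm, 'k, 'a) diagram \<Rightarrow> ('o, 'm, 'a) gcochain" where
  "mhat A p q \<phi> as =
     (if p = 0 \<and> q = 2 then as ! 0 \<otimes>\<^bsub>alg A (fst \<phi>)\<^esub> as ! 1 else \<zero>\<^bsub>alg A (fst \<phi>)\<^esub>)"


section \<open>The differential and the Maurer--Cartan equation\<close>

definition face :: "nat \<Rightarrow> nat \<Rightarrow> nat" where
  "face i j = (if j < i then j else Suc j)"

definition delta_S ::
  "('o, 'm) category \<Rightarrow> ('o, 'm, 'k, 'a) diagram \<Rightarrow> ('o, 'm, 'a) gcochain \<Rightarrow> ('o, 'm, 'a) gcochain" where
  "delta_S C A F p' q \<phi> as =
     (case p' of
        0 \<Rightarrow> \<zero>\<^bsub>alg A (vtx C \<phi> 0)\<^esub>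
      | Suc p \<Rightarrow>
          (\<Oplus>\<^bsub>alg A (vtx C \<phi> 0)\<^esub>i\<in>{0..Suc p}.
             [((- 1) ^ i :: int)] \<cdot>\<^bsub>alg A (vtx C \<phi> 0)\<^esub>
               act A (seg C \<phi> 0 (face i 0))
                 (F p q (pull C p (face i) \<phi>) (map (act A (seg C \<phi> (face i p) (Suc p))) as))))"

definition quilt_B :: quilt where
  "quilt_B = ([1, 2], \<lparr>edges = {(1, 2)}, planar = Id_on {1, 2}\<rparr>)"

definition quilt_B' :: quilt where
  "quilt_B' = ([2, 1], \<lparr>edges = {(2, 1)}, planar = Id_on {1, 2}\<rparr>)"

definition delta_H ::
  "('o, 'm) category \<Rightarrow> ('o, 'm, 'k, 'a) diagram \<Rightarrow> ('o, 'm, 'a) gcochain \<Rightarrow> ('o, 'm, 'a) gcochain" where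
  "delta_H C A F p q \<phi> as =
     quilt_op C A 2 quilt_B (\<lambda>a. if a = 1 then mhat A else F) p q \<phi> as
     \<ominus>\<^bsub>alg A (vtx C \<phi> 0)\<^esub>
     quilt_op C A 2 quilt_B' (\<lambda>a. if a = 1 then mhat A else F) p q \<phi> as"

definition delta ::
  "('o, 'm) category \<Rightarrow> ('o, 'm, 'k, 'a) diagram \<Rightarrow> ('o, 'm, 'a) gcochain \<Rightarrow> ('o, 'm, 'a) gcochain" where
  "delta C A F p q \<phi> as =
     delta_S C A F p q \<phi> as \<oplus>\<^bsub>alg A (vtx C \<phi> 0)\<^esub> delta_H C A F p q \<phi> as"

definition P0_quilts :: "nat \<Rightarrow> quilt set" where
  "P0_quilts n = {Q \<in> Quilts n. word_deg (fst Q) + 2 = n \<and> down_order (fst Q) = [1..<Suc n]}"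

definition P0_op ::
  "('o, 'm) category \<Rightarrow> ('o, 'm, 'k, 'a) diagram \<Rightarrow> nat \<Rightarrow> (nat \<Rightarrow> ('o, 'm, 'a) gcochain)
     \<Rightarrow> ('o, 'm, 'a) gcochain" where
  "P0_op C A n F p q \<phi> as =
     [((- 1) ^ (1 + n * (n - 1) div 2) :: int)] \<cdot>\<^bsub>alg A (vtx C \<phi> 0)\<^esub>
       (\<Oplus>\<^bsub>alg A (vtx C \<phi> 0)\<^esub>Q\<in>P0_quilts n. quilt_op C A n Q F p q \<phi> as)"

definition P_op ::
  "('o, 'm) category \<Rightarrow> ('o, 'm, 'k, 'a) diagram \<Rightarrow> nat \<Rightarrow> (nat \<Rightarrow> ('o, 'm, 'a) gcochain)
     \<Rightarrow> ('o, 'm, 'a) gcochain" where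
  "P_op C A n F p q \<phi> as =
     P0_op C A n F p q \<phi> as \<oplus>\<^bsub>alg A (vtx C \<phi> 0)\<^esub>
     P0_op C A (Suc n) (\<lambda>a. if a = 1 then mhat A else F (a - 1)) p q \<phi> as"

text \<open>The infinite sum is meaningful when only finitely many terms are nonzero.\<close>

definition maurer_cartan ::
  "('o, 'm) category \<Rightarrow> ('o, 'm, 'k, 'a) diagram \<Rightarrow> ('o, 'm, 'a) gcochain \<Rightarrow> bool" where
  "maurer_cartan C A F \<longleftrightarrow>
     (let S = {n. 2 \<le> n \<and> (\<exists>p q. \<not> vanishes C A p q (P_op C A n (\<lambda>_. F) p q))}
      in finite S \<and>
         (\<forall>p q. vanishes C A p q (\<lambda>\<phi> as.
            delta C A F p q \<phi> as \<oplus>\<^bsub>alg A (vtx C \<phi> 0)\<^esub>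
            (\<Oplus>\<^bsub>alg A (vtx C \<phi> 0)\<^esub>n\<in>S. P_op C A n (\<lambda>_. F) p q \<phi> as))))"


section \<open>Deformations\<close>

definition deformed_diagram ::
  "('o, 'm) category \<Rightarrow> ('o, 'm, 'k, 'a) diagram \<Rightarrow> ('o, 'm, 'a) cochain \<Rightarrow> ('o, 'm, 'a) cochain
     \<Rightarrow> ('o, 'm, 'k, 'a) diagram" where
  "deformed_diagram C A f g =
     \<lparr>alg = (\<lambda>x. (alg A x)\<lparr>mult := (\<lambda>a b. (a \<otimes>\<^bsub>alg A x\<^esub> b) \<oplus>\<^bsub>alg A x\<^esub> f (x, []) [a, b])\<rparr>),
      act = (\<lambda>\<psi> a. act A \<psi> a \<oplus>\<^bsub>alg A (Tgt C \<psi>)\<^esub> g (Tgt C \<psi>, [\<psi>]) [a])\<rparr>"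

definition deformation ::
  "('k, 'r) ring_scheme \<Rightarrow> ('o, 'm) category \<Rightarrow> ('o, 'm, 'k, 'a) diagram
     \<Rightarrow> ('o, 'm, 'a) gcochain \<Rightarrow> bool" where
  "deformation R C A F \<longleftrightarrow>
     (\<forall>p q. F p q \<in> cochains R C A p q) \<and>
     (\<forall>p q. (p, q) \<notin> {(0, 2), (1, 1)} \<longrightarrow> vanishes C A p q (F p q)) \<and>
     diagram_of_algebras R C (deformed_diagram C A (F 0 2) (F 1 1))"

end

theory Submission
  imports Defs
begin

text \<open>
  A cochain \<open>F\<close> of shifted degree 1 in the reduced asimplicial complex has two components, \<open>f\<close> in
  bidegree \<open>(0, 2)\<close> and \<open>g\<close> in bidegree \<open>(1, 1)\<close>, and the Maurer--Cartan expression lives in bidegrees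
  \<open>(p', q')\<close> with \<open>p' + q' = 3\<close>. Along a colored tree whose vertices all have \<open>q\<^sub>a \<ge> 1\<close>, induction from
  the leaves gives \<open>\<Sum>p\<^sub>a \<le> q' p'\<close>; as \<open>\<Sum>p\<^sub>a = p' + n - 2\<close> for the quilts in \<open>P\<^sup>0\<^sub>n\<close>, only arities
  \<open>n \<le> 3\<close> contribute. A quilt starts with its root, which occurs only once, so the only quilts left are
  \<open>12\<close> with root 1 and child 2, and \<open>1232\<close> with root 1 and children \<open>3\<close>, \<open>2\<close> from left to right.
  Evaluating them with their signs, the components of the equation in bidegrees \<open>(0, 3)\<close>, \<open>(1, 2)\<close> and
  \<open>(2, 1)\<close> say that \<open>m + f\<close> is associative, that \<open>A + g\<close> is multiplicative and that \<open>A + g\<close> preserves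
  compositions, while vanishing of \<open>g\<close> on identities says that \<open>A + g\<close> preserves identities.
\<close>

section \<open>Planar trees\<close>

text \<open>A cochain is a total function about which only its values on \<open>strings\<close> and
  \<open>tuples\<close> are known, and \<open>vanishes\<close> is a pointwise condition there. A
  vanishing component therefore cannot be replaced by the zero function: every summand that is
  dropped needs the argument that a zero at one vertex passes through multilinear maps and diagram
  homomorphisms up to the root, with all intermediate values in the right carriers. The
  multiplication \<open>mhat A\<close> sits in bidegree \<open>(0, 2)\<close> and so obeys the same
  degree condition as \<open>F\<close>. For this reason the operations are studied on families of
  cochains, and the same lemmas cover the terms with \<open>mhat A\<close> in the first slot. Each
  of the three surviving components comes out as the difference of the two sides of a deformed
  identity; the part that involves neither \<open>f\<close> nor \<open>g\<close> cancels because
  \<open>A\<close> itself satisfies the identity.\<close>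

abbreviation kids :: "ptree \<Rightarrow> nat \<Rightarrow> nat set" where
  "kids T v \<equiv> {b. (v, b) \<in> edges T}"

abbreviation subtree :: "ptree \<Rightarrow> nat \<Rightarrow> nat set" where
  "subtree T v \<equiv> {c. tle T v c}"

locale planar_tree =
  fixes V :: "nat set" and T :: ptree
  assumes tree: "is_tree V T"
begin

lemma finite_V: "finite V" and edges_V: "edges T \<subseteq> V \<times> V"
  and edge_irrefl: "(u, u) \<notin> edges T"
  and tle_antisym: "antisym ((edges T)\<^sup>*)"
  using tree unfolding is_tree_def by auto

lemma edge_cover: "\<lbrakk>(u, v) \<in> edges T; t \<in> V; tless T u t; tless T t v\<rbrakk> \<Longrightarrow> False"
  using tree unfolding is_tree_def by blast

lemma exactly_one:
  "\<lbrakk>u \<in> V; v \<in> V\<rbrakk> \<Longrightarrow> length (filter (\<lambda>b. b)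
     [u = v, tless T u v, tless T v u, left_of T u v, left_of T v u]) = 1"
  using tree unfolding is_tree_def by blast

lemma left_of_subtree:
  "\<lbrakk>left_of T u v; tle T u u'; tle T v v'; u \<in> V; v \<in> V; u' \<in> V; v' \<in> V\<rbrakk> \<Longrightarrow> left_of T u' v'"
  using tree unfolding is_tree_def by blast

lemma tle_V: "tle T u v \<Longrightarrow> u \<in> V \<Longrightarrow> v \<in> V"
  by (induction rule: rtrancl_induct) (use edges_V in auto)

lemma subtree_V: "v \<in> V \<Longrightarrow> subtree T v \<subseteq> V"
  using tle_V by blast

lemma finite_subtree: "v \<in> V \<Longrightarrow> finite (subtree T v)"
  using finite_V subtree_V finite_subset by blast

lemma kids_V: "kids T v \<subseteq> V"
  using edges_V by auto

lemma finite_kids: "finite (kids T v)"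
  using finite_V kids_V finite_subset by blast

lemma kid_not_below:
  assumes "(v, b) \<in> edges T" shows "\<not> tle T b v"
proof
  assume "tle T b v"
  with assms tle_antisym have "b = v" by (auto dest: antisymD)
  with assms edge_irrefl show False by simp
qed

text \<open>Edges are covering relations, so neither of two siblings lies below the other;
  \<open>exactly_one\<close> then leaves only the planar order.\<close>

lemma siblings_left_of:
  assumes "(v, b) \<in> edges T" "(v, c) \<in> edges T" "b \<noteq> c"
  shows "left_of T b c \<or> left_of T c b"
proof -
  have V: "b \<in> V" "c \<in> V" "v \<in> V" using assms edges_V by auto
  have nb: "\<not> tless T b c" if "(v, b) \<in> edges T" "(v, c) \<in> edges T" "b \<in> V" for b c
  proof
    assume bc: "tless T b c"
    have "v \<noteq> b" using that(1) edge_irrefl by blast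
    with that(1) have "tless T v b" by blast
    from edge_cover[OF that(2,3) this bc] show False .
  qed
  show ?thesis
    using exactly_one[OF V(1,2)] nb[OF assms(1,2) V(1)] nb[OF assms(2,1) V(2)] assms(3)
    by (simp split: if_splits)
qed

text \<open>A common descendant \<open>x\<close> would inherit \<open>left_of T x x\<close> from its
  two ancestors, but \<open>left_of\<close> is irreflexive.\<close>

lemma subtree_siblings_disjoint:
  assumes "(v, b) \<in> edges T" "(v, c) \<in> edges T" "b \<noteq> c"
  shows "subtree T b \<inter> subtree T c = {}"
proof -
  have V: "b \<in> V" "c \<in> V" using assms edges_V by auto
  have False if "tle T b x" "tle T c x" for x
  proof -
    have x: "x \<in> V" using tle_V[OF that(1) V(1)] .
    from siblings_left_of[OF assms] show False
    proof
      assume "left_of T b c"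
      from left_of_subtree[OF this that V x x] show False by simp
    next
      assume "left_of T c b"
      from left_of_subtree[OF this that(2,1) V(2,1) x x] show False by simp
    qed
  qed
  then show ?thesis by auto
qed

lemma subtree_unfold: "subtree T v = insert v (\<Union>b\<in>kids T v. subtree T b)"
  by (blast elim: converse_rtranclE intro: converse_rtrancl_into_rtrancl)

text \<open>Used with \<open>h\<close> equal to \<open>q\<close>, to \<open>p\<close> and to the
  constant 1; the last turns it into a recursion for the size of a subtree.\<close>

lemma sum_subtree:
  fixes h :: "nat \<Rightarrow> 'b::comm_monoid_add"
  assumes "v \<in> V"
  shows "sum h (subtree T v) = h v + (\<Sum>b\<in>kids T v. sum h (subtree T b))"
proof -
  have "v \<notin> (\<Union>b\<in>kids T v. subtree T b)"
    using kid_not_below by simp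
  moreover have "finite (\<Union>b\<in>kids T v. subtree T b)"
    using finite_kids finite_subtree kids_V by (intro finite_UN_I) blast+
  moreover have "sum h (\<Union>b\<in>kids T v. subtree T b) = (\<Sum>b\<in>kids T v. sum h (subtree T b))"
    by (rule sum.UNION_disjoint) (use finite_kids finite_subtree kids_V subtree_siblings_disjoint in \<open>blast+\<close>)
  ultimately show ?thesis
    by (subst subtree_unfold) simp
qed

lemma card_subtree_kid_less:
  assumes "(v, b) \<in> edges T" shows "card (subtree T b) < card (subtree T v)"
proof (rule psubset_card_mono)
  show "finite (subtree T v)" using assms edges_V finite_subtree by auto
  have "subtree T b \<subseteq> subtree T v"
    using assms by (blast intro: converse_rtrancl_into_rtrancl)
  moreover have "v \<notin> subtree T b" using kid_not_below[OF assms] by simp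
  ultimately show "subtree T b \<subset> subtree T v" by blast
qed

lemma card_subtree_pos: "v \<in> V \<Longrightarrow> 0 < card (subtree T v)"
  using finite_subtree by (auto simp: card_gt_0_iff)

lemma tree_induct [consumes 1, case_names node]:
  assumes "v \<in> V" and "\<And>v. \<lbrakk>v \<in> V; \<And>b. (v, b) \<in> edges T \<Longrightarrow> P b\<rbrakk> \<Longrightarrow> P v"
  shows "P v"
  using assms(1)
proof (induction "card (subtree T v)" arbitrary: v rule: less_induct)
  case less
  show ?case
  proof (rule assms(2))
    fix b assume b: "(v, b) \<in> edges T"
    then have "b \<in> V" using edges_V by blast
    then show "P b" using less card_subtree_kid_less[OF b] by simp
  qed fact
qed

text \<open>A root is only required to be minimal, and uniqueness of the minimal vertex must be
  turned into comparability with every vertex. Among the vertices from which \<open>v\<close> is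
  reachable, one with the largest subtree is minimal, hence is the root.\<close>

lemma is_root_subtree:
  assumes "is_root V T r" shows "subtree T r = V"
proof -
  have r: "r \<in> V" using assms unfolding is_root_def by simp
  have "tle T r v" if "v \<in> V" for v
  proof -
    let ?S = "{u\<in>V. tle T u v}"
    have "v \<in> ?S" using that by simp
    have "\<forall>u. u \<in> ?S \<longrightarrow> card (subtree T u) < Suc (card V)"
      using subtree_V card_mono[OF finite_V] by (simp add: less_Suc_eq_le)
    from ex_has_greatest_nat[of "\<lambda>u. u \<in> ?S", OF \<open>v \<in> ?S\<close> this]
    obtain m where m: "m \<in> ?S" "\<And>u. u \<in> ?S \<Longrightarrow> card (subtree T u) \<le> card (subtree T m)"
      by blast
    have "is_root V T m"
      unfolding is_root_def
    proof (intro conjI ballI notI)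
      show "m \<in> V" using m by simp
      fix u assume u: "u \<in> V" "tless T u m"
      then have uS: "u \<in> ?S" using m(1) rtrancl_trans[of u m "edges T" v] by simp
      have "subtree T m \<subset> subtree T u"
      proof -
        have "subtree T m \<subseteq> subtree T u" using u by (blast intro: rtrancl_trans)
        moreover have "u \<notin> subtree T m" using u antisymD[OF tle_antisym, of u m] by blast
        moreover have "u \<in> subtree T u" by simp
        ultimately show ?thesis by blast
      qed
      then have "card (subtree T m) < card (subtree T u)"
        using finite_subtree u by (simp add: psubset_card_mono)
      then show False using m(2)[OF uS] by simp
    qed
    moreover have "\<exists>!r. is_root V T r" using tree unfolding is_tree_def by blast
    ultimately have "m = r" using assms by blast
    then show ?thesis using m by simp
  qed
  then show ?thesis using subtree_V[OF r] by auto
qed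

end

lemma root_is_root:
  assumes "is_tree {1..n} T" shows "is_root {1..n} T (root n T)"
proof -
  have "\<exists>!r. is_root {1..n} T r" using assms unfolding is_tree_def by blast
  then show ?thesis unfolding root_def by (rule theI')
qed

locale tree_coloring = planar_tree V T for V T +
  fixes q :: "nat \<Rightarrow> nat" and I :: "nat \<times> nat \<Rightarrow> nat"
  assumes coloring: "I \<in> tree_colorings T q"
begin

lemma I_range: "(v, b) \<in> edges T \<Longrightarrow> I (v, b) \<in> {1..q v}"
  using coloring unfolding tree_colorings_def by (auto dest!: PiE_mem)

lemma I_left_of: "\<lbrakk>(t, u) \<in> edges T; (t, v) \<in> edges T; left_of T u v\<rbrakk> \<Longrightarrow> I (t, u) < I (t, v)"
  using coloring unfolding tree_colorings_def by blast

lemma I_inj: "\<lbrakk>(t, u) \<in> edges T; (t, v) \<in> edges T; I (t, u) = I (t, v)\<rbrakk> \<Longrightarrow> u = v"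
  using siblings_left_of I_left_of by (metis less_irrefl)

lemma child_at_Some: "child_at T I v j = Some b \<longleftrightarrow> (v, b) \<in> edges T \<and> I (v, b) = j"
proof (cases "\<exists>b. (v, b) \<in> edges T \<and> I (v, b) = j")
  case True
  then obtain c where c: "(v, c) \<in> edges T" "I (v, c) = j" by blast
  then have "(THE b. (v, b) \<in> edges T \<and> I (v, b) = j) = c"
    using I_inj by (intro the_equality) auto
  with True have "child_at T I v j = Some c" unfolding child_at_def by simp
  then show ?thesis using c I_inj by auto
qed (auto simp: child_at_def)

lemma child_at_None: "child_at T I v j = None \<longleftrightarrow> (\<nexists>b. (v, b) \<in> edges T \<and> I (v, b) = j)"
  unfolding child_at_def by simp

text \<open>The children sit at distinct inputs, by \<open>I_inj\<close>, and every other input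
  counts 1. The number of children is added on the left to avoid truncated subtraction.\<close>

lemma sum_inputs:
  fixes h :: "nat \<Rightarrow> nat"
  shows "(\<Sum>j=1..q v. case child_at T I v j of None \<Rightarrow> 1 | Some b \<Rightarrow> h b) + card (kids T v)
       = q v + (\<Sum>b\<in>kids T v. h b)"
proof -
  let ?g = "\<lambda>j. case child_at T I v j of None \<Rightarrow> 1 | Some b \<Rightarrow> h b"
  let ?J = "(\<lambda>b. I (v, b)) ` kids T v"
  have inj: "inj_on (\<lambda>b. I (v, b)) (kids T v)" by (rule inj_onI) (simp add: I_inj)
  have sub: "?J \<subseteq> {1..q v}" using I_range by blast
  have "sum ?g {1..q v} = sum ?g ({1..q v} - ?J) + sum ?g ?J"
    using sub by (intro sum.subset_diff) auto
  also have "sum ?g ({1..q v} - ?J) = (\<Sum>j\<in>{1..q v} - ?J. 1)"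
  proof (rule sum.cong)
    fix j assume "j \<in> {1..q v} - ?J"
    then have "child_at T I v j = None" unfolding child_at_None by blast
    then show "?g j = 1" by simp
  qed simp
  also have "\<dots> = q v - card (kids T v)"
    using sub inj finite_kids by (simp add: card_Diff_subset card_image)
  also have "sum ?g ?J = (\<Sum>b\<in>kids T v. ?g (I (v, b)))"
    using inj by (simp add: sum.reindex)
  also have "\<dots> = (\<Sum>b\<in>kids T v. h b)"
    by (rule sum.cong) (simp_all add: child_at_Some[THEN iffD2])
  finally show ?thesis
    using card_mono[OF _ sub] inj by (simp add: card_image)
qed

text \<open>The number of arguments consumed by the composite along the subtree at \<open>v\<close>,
  that is, the length of the lists on which \<open>subtree_action\<close> is meaningful.\<close>

definition width :: "nat \<Rightarrow> nat" where
  "width v = (\<Sum>j=1..q v. input_width T I q v j)"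

text \<open>Each vertex \<open>c\<close> replaces one input by \<open>q c\<close> inputs, so the
  total is 1 plus the sum of \<open>q c - 1\<close>. This confirms the closed formula in
  \<open>input_width\<close> and shows that its natural subtraction never truncates, even when some
  \<open>q c\<close> is 0.\<close>

lemma width_subtree:
  assumes "v \<in> V" shows "width v + card (subtree T v) = sum q (subtree T v) + 1"
  using assms
proof (induction rule: tree_induct)
  case (node v)
  have *: "input_width T I q v j = (case child_at T I v j of None \<Rightarrow> 1 | Some b \<Rightarrow> width b)" for j
  proof (cases "child_at T I v j")
    case (Some b)
    then have "(v, b) \<in> edges T" unfolding child_at_Some by simp
    from node(2)[OF this] have "sum q (subtree T b) + 1 - card (subtree T b) = width b" by simp
    with Some show ?thesis by (simp add: input_width_def Let_def)
  qed (simp add: input_width_def)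
  have "width v + card (kids T v) = q v + (\<Sum>b\<in>kids T v. width b)"
    unfolding width_def using sum_inputs[where v=v and h=width] by (simp add: * width_def)
  moreover have "(\<Sum>b\<in>kids T v. width b) + (\<Sum>b\<in>kids T v. card (subtree T b))
    = (\<Sum>b\<in>kids T v. sum q (subtree T b)) + card (kids T v)"
    using node(2) by (simp add: sum.distrib[symmetric] sum_Suc)
  moreover have "card (subtree T v) = 1 + (\<Sum>b\<in>kids T v. card (subtree T b))"
    using sum_subtree[OF node(1), of "\<lambda>_. 1::nat"] by simp
  ultimately show ?case
    using sum_subtree[OF node(1), of q] by simp
qed

lemma input_width_alt:
  "input_width T I q v j = (case child_at T I v j of None \<Rightarrow> 1 | Some b \<Rightarrow> width b)"
proof (cases "child_at T I v j")
  case (Some b)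
  then have "b \<in> V" unfolding child_at_Some using edges_V by blast
  from width_subtree[OF this] have "sum q (subtree T b) + 1 - card (subtree T b) = width b" by simp
  with Some show ?thesis by (simp add: input_width_def Let_def)
qed (simp add: input_width_def)

end

section \<open>Colorings of words\<close>

text \<open>Consecutive blocks share an endpoint, so values never decrease from left to right along
  the word. Since \<open>b\<close> lies above \<open>a\<close> in the tree, condition (1) of a quilt
  forbids an occurrence of \<open>b\<close> before one of \<open>a\<close>.\<close>

lemma word_coloring_edge:
  assumes Q: "(W, T) \<in> Quilts n" and z: "\<zeta> \<in> word_colorings n W p" and e: "(a, b) \<in> edges T"
  shows "\<zeta> a (p a) \<le> \<zeta> b 0"
proof -
  from z obtain \<pi> where \<pi>: "is_projection n W p \<zeta> \<pi>"
    unfolding word_colorings_def by (auto simp: Let_def split: if_splits)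
  have W: "set W = {1..n}" and T: "is_tree {1..n} T"
    using Q unfolding Quilts_def F2S_def Trees_def by auto
  interpret planar_tree "{1..n}" T using T by unfold_locales
  have proj: "\<pi> c ` {..p c} = {j. j < length W \<and> W ! j = c}" if "c \<in> {1..n}" for c
    using \<pi> that unfolding is_projection_def by blast
  let ?B = "block W p \<zeta> \<pi>"
  have ab: "a \<in> {1..n}" "b \<in> {1..n}" "a \<noteq> b" using e edges_V edge_irrefl by auto
  have B: "finite (?B j)" "?B j \<noteq> {}" if "j < length W" for j
  proof -
    show "finite (?B j)" unfolding block_def by simp
    have "W ! j \<in> {1..n}" using that W by (metis nth_mem)
    from proj[OF this] that have "j \<in> \<pi> (W ! j) ` {..p (W ! j)}" by simp
    then show "?B j \<noteq> {}" unfolding block_def by auto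
  qed
  have step: "Max (?B j) = Min (?B (Suc j))" if "Suc j < length W" for j
    using \<pi> that unfolding is_projection_def by blast
  have mono: "Max (?B i) \<le> Min (?B j)" if "Suc i \<le> j" "j < length W" for i j
    using that
  proof (induction j rule: dec_induct)
    case base
    then show ?case using step by simp
  next
    case (step j)
    then have "Max (?B i) \<le> Min (?B j)" by simp
    also have "\<dots> \<le> Max (?B j)" using B[of j] step by simp
    also have "\<dots> = Min (?B (Suc j))" using step \<open>Suc j < length W\<close>
        \<open>\<And>j. Suc j < length W \<Longrightarrow> Max (?B j) = Min (?B (Suc j))\<close> by blast
    finally show ?case .
  qed
  \<comment> \<open>\<open>i\<close> is the occurrence of \<open>a\<close> carrying its last value,
    \<open>j\<close> the occurrence of \<open>b\<close> carrying its first; it suffices to place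
    \<open>i\<close> before \<open>j\<close>.\<close>
  define i where "i = \<pi> a (p a)"
  define j where "j = \<pi> b 0"
  have i: "i < length W" "W ! i = a" using proj[OF ab(1)] unfolding i_def by auto
  have j: "j < length W" "W ! j = b" using proj[OF ab(2)] unfolding j_def by auto
  have "\<not> j < i"
  proof
    assume "j < i"
    with Q i(1) have "\<not> tless T (W ! i) (W ! j)" unfolding Quilts_def by blast
    with e ab(3) show False unfolding i j by blast
  qed
  moreover have "i \<noteq> j" using i j ab by auto
  ultimately have "i < j" by simp
  have "\<zeta> a (p a) \<in> ?B i" unfolding block_def using i i_def by auto
  then have "\<zeta> a (p a) \<le> Max (?B i)" using B[OF i(1)] by simp
  also have "\<dots> \<le> Min (?B j)" using mono \<open>i < j\<close> j by simp
  also have "\<zeta> b 0 \<in> ?B j" unfolding block_def using j j_def by auto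
  then have "Min (?B j) \<le> \<zeta> b 0" using B[OF j(1)] by simp
  finally show ?thesis .
qed

text \<open>Keeps from a word coloring only what composition along the tree uses: strict
  monotonicity, the bound \<open>P\<close> and the inequality along edges. Inside this locale the
  word itself is forgotten.\<close>

locale colored_tree = tree_coloring V T q I for V T q I +
  fixes p :: "nat \<Rightarrow> nat" and \<zeta> :: "nat \<Rightarrow> nat \<Rightarrow> nat" and P :: nat
  assumes \<zeta>_mono: "a \<in> V \<Longrightarrow> strict_mono_on {..p a} (\<zeta> a)"
    and \<zeta>_range: "\<lbrakk>a \<in> V; i \<le> p a\<rbrakk> \<Longrightarrow> \<zeta> a i \<le> P"
    and \<zeta>_edge: "(a, b) \<in> edges T \<Longrightarrow> \<zeta> a (p a) \<le> \<zeta> b 0"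
begin

lemma \<zeta>_growth: "a \<in> V \<Longrightarrow> i \<le> p a \<Longrightarrow> \<zeta> a 0 + i \<le> \<zeta> a i"
proof (induction i)
  case (Suc i)
  then have "\<zeta> a i < \<zeta> a (Suc i)" using strict_mono_onD[OF \<zeta>_mono, of a i "Suc i"] by simp
  with Suc show ?case by simp
qed simp

text \<open>Along a path away from \<open>v\<close> the intervals spanned by the
  \<open>\<zeta> a\<close> follow each other between \<open>\<zeta> v 0\<close> and
  \<open>P\<close>, so the \<open>p a\<close> on one path add up to at most
  \<open>P - \<zeta> v 0\<close>. Every vertex lies on a path to a free input because
  \<open>q a \<ge> 1\<close>, and there are \<open>width v\<close> free inputs.\<close>

lemma degree_bound:
  assumes q: "\<And>a. a \<in> V \<Longrightarrow> 1 \<le> q a" and v: "v \<in> V"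
  shows "sum p (subtree T v) \<le> width v * (P - \<zeta> v 0)"
  using v
proof (induction rule: tree_induct)
  case (node v)
  let ?w = "\<Sum>b\<in>kids T v. width b"
  have gr: "\<zeta> v 0 + p v \<le> \<zeta> v (p v)" "\<zeta> v (p v) \<le> P"
    using \<zeta>_growth[of v "p v"] \<zeta>_range[of v "p v"] node(1) by auto
  \<comment> \<open>The room that \<open>v\<close> leaves to its children: each of them starts at or
    after \<open>\<zeta> v (p v)\<close>.\<close>
  define d where "d = P - \<zeta> v 0 - p v"
  have d: "P - \<zeta> v 0 = p v + d" unfolding d_def using gr by simp
  have "sum p (subtree T b) \<le> width b * d" if "(v, b) \<in> edges T" for b
  proof -
    have "P - \<zeta> b 0 \<le> d" using \<zeta>_edge[OF that] gr d by simp
    then show ?thesis using node(2)[OF that] by (meson le_trans mult_le_mono2)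
  qed
  then have "(\<Sum>b\<in>kids T v. sum p (subtree T b)) \<le> (\<Sum>b\<in>kids T v. width b * d)"
    by (intro sum_mono) simp
  also have "\<dots> = ?w * d" by (simp add: sum_distrib_right)
  also have "\<dots> \<le> width v * d"
  proof -
    have "width v + card (kids T v) = q v + ?w"
      using sum_inputs[where v=v and h=width] by (simp add: width_def input_width_alt)
    moreover have "card (kids T v) \<le> card {1..q v}"
      by (rule card_inj_on_le[of "\<lambda>b. I (v, b)"]) (use I_inj I_range in \<open>auto intro!: inj_onI\<close>)
    ultimately show ?thesis by (intro mult_le_mono1) simp
  qed
  finally have le: "sum p (subtree T v) \<le> p v + width v * d"
    using sum_subtree[OF node(1), of p] by simp
  \<comment> \<open>Here \<open>q a \<ge> 1\<close> enters. With at least one free input,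
    \<open>p v\<close> too is bounded by \<open>width v * p v\<close>.\<close>
  have "1 \<le> width v"
  proof -
    have "(\<Sum>c\<in>subtree T v. 1) \<le> sum q (subtree T v)"
      by (rule sum_mono) (use q subtree_V[OF node(1)] in blast)
    with width_subtree[OF node(1)] show ?thesis by simp
  qed
  then obtain e where e: "width v = Suc e" by (cases "width v") auto
  have "sum p (subtree T v) \<le> p v + (d + e * d)" using le e by simp
  also have "\<dots> \<le> width v * (P - \<zeta> v 0)" unfolding e d by (simp add: add_mult_distrib2)
  finally show ?case .
qed

end

lemma colored_tree_quilt:
  assumes Q: "(W, T) \<in> Quilts n" and z: "\<zeta> \<in> word_colorings n W p" and I: "I \<in> tree_colorings T q"
  shows "colored_tree {1..n} T q I p \<zeta> ((\<Sum>a=1..n. p a) - word_deg W)"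
proof
  show "is_tree {1..n} T" using Q unfolding Quilts_def Trees_def by simp
  show "I \<in> tree_colorings T q" by fact
  show "\<zeta> a (p a) \<le> \<zeta> b 0" if "(a, b) \<in> edges T" for a b
    using word_coloring_edge[OF Q z that] .
  have *: "\<zeta> \<in> (\<Pi>\<^sub>E a\<in>{1..n}. {..p a} \<rightarrow>\<^sub>E {..(\<Sum>a=1..n. p a) - word_deg W})"
    "\<forall>a\<in>{1..n}. strict_mono_on {..p a} (\<zeta> a)"
    using z unfolding word_colorings_def by (auto simp: Let_def split: if_splits)
  show "strict_mono_on {..p a} (\<zeta> a)" if "a \<in> {1..n}" for a using * that by blast
  show "\<zeta> a i \<le> (\<Sum>a=1..n. p a) - word_deg W" if "a \<in> {1..n}" "i \<le> p a" for a i
    using PiE_mem[OF PiE_mem[OF *(1) that(1)], of i] that(2) by simp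
qed

lemma root_in:
  assumes "(W, T) \<in> Quilts n" shows "root n T \<in> {1..n}" and "subtree T (root n T) = {1..n}"
proof -
  have T: "is_tree {1..n} T" using assms unfolding Quilts_def Trees_def by simp
  show "root n T \<in> {1..n}" using root_is_root[OF T] unfolding is_root_def by blast
  interpret planar_tree "{1..n}" T using T by unfold_locales
  show "subtree T (root n T) = {1..n}" using is_root_subtree[OF root_is_root[OF T]] .
qed

lemma root_width:
  assumes Q: "(W, T) \<in> Quilts n" and I: "I \<in> tree_colorings T q"
    and s: "(\<Sum>a=1..n. q a) + 1 = q' + n"
  shows "tree_coloring.width T q I (root n T) = q'"
proof -
  interpret tree_coloring "{1..n}" T q I
    using Q I unfolding Quilts_def Trees_def by unfold_locales auto
  show ?thesis using width_subtree[OF root_in(1)[OF Q]] s unfolding root_in(2)[OF Q] by simp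
qed

text \<open>With \<open>p' + q' = 3\<close> and \<open>word_deg W + 2 = n\<close> the degree bound
  reads \<open>p' + (n - 2) \<le> (3 - p') * p'\<close>. For \<open>p'\<close> equal to 0, 1, 2 this
  gives \<open>n\<close> at most 2, 3, 2, and for \<open>p' = 3\<close> it is impossible.\<close>

lemma quilt_arity_le_3:
  assumes Q: "(W, T) \<in> Quilts n" and z: "\<zeta> \<in> word_colorings n W p" and I: "I \<in> tree_colorings T q"
    and pq: "(p, q) \<in> bidegrees n W p' q'"
    and deg: "\<And>a. a \<in> {1..n} \<Longrightarrow> 1 \<le> q a" "p' + q' = 3" "word_deg W + 2 = n"
  shows "n \<le> 3"
proof -
  have s: "(\<Sum>a=1..n. p a) = p' + word_deg W" "(\<Sum>a=1..n. q a) + 1 = q' + n"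
    using pq unfolding bidegrees_def by auto
  interpret colored_tree "{1..n}" T q I p \<zeta> p'
    using colored_tree_quilt[OF Q z I] s by simp
  have "sum p {1..n} \<le> q' * (p' - \<zeta> (root n T) 0)"
    using degree_bound[OF deg(1) root_in(1)[OF Q]]
    unfolding root_in(2)[OF Q] root_width[OF Q I s(2)] by simp
  also have "\<dots> \<le> q' * p'" by simp
  finally have "p' + (n - 2) \<le> q' * p'" using s deg by simp
  moreover have "p' = 0 \<or> p' = 1 \<or> p' = 2 \<or> p' = 3" using deg by linarith
  ultimately show ?thesis using deg by (auto simp: numeral_eq_Suc)
qed

section \<open>Composition of cochains along a tree\<close>

text \<open>Writing the zero in slot \<open>i\<close> as a sum of two zeros, additivity makes
  \<open>h as\<close> equal to twice itself.\<close>

lemma multilinear_zero: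
  assumes h: "h \<in> multilinear R q M N" and M: "abelian_group M" and N: "abelian_group N"
    and as: "as \<in> tuples M q" and i: "i < q" "as ! i = \<zero>\<^bsub>M\<^esub>"
  shows "h as = \<zero>\<^bsub>N\<^esub>"
proof -
  interpret M: abelian_group M by fact
  interpret N: abelian_group N by fact
  have eq: "as[i := \<zero>\<^bsub>M\<^esub>] = as" using i(2) by (metis list_update_id)
  have "h (as[i := \<zero>\<^bsub>M\<^esub> \<oplus>\<^bsub>M\<^esub> \<zero>\<^bsub>M\<^esub>]) = h (as[i := \<zero>\<^bsub>M\<^esub>]) \<oplus>\<^bsub>N\<^esub> h (as[i := \<zero>\<^bsub>M\<^esub>])"
    using h as i(1) unfolding multilinear_def by blast
  then have "h as = h as \<oplus>\<^bsub>N\<^esub> h as" by (simp add: eq)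
  moreover have "h as \<in> carrier N" using h as unfolding multilinear_def by blast
  ultimately show ?thesis by (metis N.add.l_cancel_one')
qed

lemma multilinear_closed: "h \<in> multilinear R q M N \<Longrightarrow> as \<in> tuples M q \<Longrightarrow> h as \<in> carrier N"
  unfolding multilinear_def by blast

locale algebra_diagram = small_category C + diagram_of_algebras R C A
  for R :: "('k, 'r) ring_scheme" and C :: "('o, 'm) category" and A :: "('o, 'm, 'k, 'a) diagram"
begin

lemma M_module: "x \<in> Obj C \<Longrightarrow> module R (alg A x)"
  using alg_algebra assoc_algebra.axioms(1) by blast

lemma M_abelian: "x \<in> Obj C \<Longrightarrow> abelian_group (alg A x)"
  using M_module module.axioms(2) by blast

lemma act_closed:
  "\<lbrakk>f \<in> Mor C; a \<in> carrier (alg A (Src C f))\<rbrakk> \<Longrightarrow> act A f a \<in> carrier (alg A (Tgt C f))"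
  using act_hom unfolding algebra_hom_def by blast

lemma act_add:
  "\<lbrakk>f \<in> Mor C; a \<in> carrier (alg A (Src C f)); b \<in> carrier (alg A (Src C f))\<rbrakk>
    \<Longrightarrow> act A f (a \<oplus>\<^bsub>alg A (Src C f)\<^esub> b) = act A f a \<oplus>\<^bsub>alg A (Tgt C f)\<^esub> act A f b"
  using act_hom unfolding algebra_hom_def by blast

lemma act_mult:
  "\<lbrakk>f \<in> Mor C; a \<in> carrier (alg A (Src C f)); b \<in> carrier (alg A (Src C f))\<rbrakk>
    \<Longrightarrow> act A f (a \<otimes>\<^bsub>alg A (Src C f)\<^esub> b) = act A f a \<otimes>\<^bsub>alg A (Tgt C f)\<^esub> act A f b"
  using act_hom unfolding algebra_hom_def by blast

lemma act_zero:
  assumes f: "f \<in> Mor C" shows "act A f \<zero>\<^bsub>alg A (Src C f)\<^esub> = \<zero>\<^bsub>alg A (Tgt C f)\<^esub>"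
proof -
  interpret M: abelian_group "alg A (Src C f)" using M_abelian f src_obj by blast
  interpret N: abelian_group "alg A (Tgt C f)" using M_abelian f tgt_obj by blast
  show ?thesis
    using act_add[OF f M.zero_closed M.zero_closed] act_closed[OF f M.zero_closed]
    by (metis M.l_zero M.zero_closed N.add.l_cancel_one')
qed

lemma vtx_obj: "\<phi> \<in> strings C p \<Longrightarrow> k \<le> p \<Longrightarrow> vtx C \<phi> k \<in> Obj C"
  unfolding strings_def vtx_def by (cases k) (auto intro!: src_obj nth_mem)

lemma strings_mor: "\<phi> \<in> strings C p \<Longrightarrow> k < p \<Longrightarrow> snd \<phi> ! k \<in> Mor C"
  unfolding strings_def by (auto intro!: subsetD[OF _ nth_mem])

lemma seg_Suc: "k < l \<Longrightarrow> seg C \<phi> k l = Comp C (snd \<phi> ! k) (seg C \<phi> (Suc k) l)"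
  unfolding seg_def by (simp add: upt_conv_Cons)

lemma seg_refl: "seg C \<phi> k k = Ident C (vtx C \<phi> k)"
  unfolding seg_def by simp

lemma seg_hom:
  assumes \<phi>: "\<phi> \<in> strings C p" and "k \<le> l" "l \<le> p"
  shows "seg C \<phi> k l \<in> Mor C \<and> Src C (seg C \<phi> k l) = vtx C \<phi> l \<and> Tgt C (seg C \<phi> k l) = vtx C \<phi> k"
  using assms(2)
proof (induction k rule: inc_induct)
  case base
  show ?case using vtx_obj[OF \<phi> assms(3)] by (simp add: seg_refl ident_mor ident_src ident_tgt)
next
  case (step k)
  have m: "snd \<phi> ! k \<in> Mor C" using strings_mor[OF \<phi>] step assms(3) by simp
  have s: "Src C (snd \<phi> ! k) = vtx C \<phi> (Suc k)" by (simp add: vtx_def)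
  have t: "Tgt C (snd \<phi> ! k) = vtx C \<phi> k"
    using \<phi> step assms(3) unfolding strings_def by simp
  from m s t step show ?case by (simp add: seg_Suc comp_mor comp_src comp_tgt)
qed

lemma seg_act_closed:
  "\<lbrakk>\<phi> \<in> strings C p; k \<le> l; l \<le> p; a \<in> carrier (alg A (vtx C \<phi> l))\<rbrakk>
    \<Longrightarrow> act A (seg C \<phi> k l) a \<in> carrier (alg A (vtx C \<phi> k))"
  using seg_hom[of \<phi> p k l] act_closed[of "seg C \<phi> k l" a] by simp

lemma seg_act_zero:
  "\<lbrakk>\<phi> \<in> strings C p; k \<le> l; l \<le> p\<rbrakk>
    \<Longrightarrow> act A (seg C \<phi> k l) \<zero>\<^bsub>alg A (vtx C \<phi> l)\<^esub> = \<zero>\<^bsub>alg A (vtx C \<phi> k)\<^esub>"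
  using seg_hom[of \<phi> p k l] act_zero[of "seg C \<phi> k l"] by simp

lemma vtx_pull: "\<phi> \<in> strings C P \<Longrightarrow> i \<le> p \<Longrightarrow> (\<And>i. i < p \<Longrightarrow> \<zeta> i \<le> \<zeta> (Suc i)) \<Longrightarrow>
    (\<And>i. i \<le> p \<Longrightarrow> \<zeta> i \<le> P) \<Longrightarrow> vtx C (pull C p \<zeta> \<phi>) i = vtx C \<phi> (\<zeta> i)"
  using seg_hom[of \<phi> P] by (cases i) (auto simp: vtx_def pull_def)

lemma pull_strings:
  assumes \<phi>: "\<phi> \<in> strings C P" and m: "\<And>i. i < p \<Longrightarrow> \<zeta> i \<le> \<zeta> (Suc i)" "\<And>i. i \<le> p \<Longrightarrow> \<zeta> i \<le> P"
  shows "pull C p \<zeta> \<phi> \<in> strings C p"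
proof -
  have "vtx C \<phi> (\<zeta> 0) \<in> Obj C" using vtx_obj[OF \<phi>] m(2) by simp
  moreover have "seg C \<phi> (\<zeta> i) (\<zeta> (Suc i)) \<in> Mor C \<and>
      Tgt C (seg C \<phi> (\<zeta> i) (\<zeta> (Suc i))) = vtx C (pull C p \<zeta> \<phi>) i" if "i < p" for i
    using seg_hom[OF \<phi> m(1)[OF that] m(2)] vtx_pull[OF \<phi>, of i p \<zeta>] m that by simp
  ultimately show ?thesis unfolding strings_def by (auto simp: pull_def)
qed

text \<open>Closure and propagation of zero are proved together, because multilinearity and
  \<open>vanishes\<close> only speak about arguments in the carrier. The depth bound
  \<open>k\<close> may be any number that is at least the size of the subtree.\<close>

lemma subtree_action:
  assumes ct: "colored_tree V T q I p \<zeta> P" and \<phi>: "\<phi> \<in> strings C P"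
    and f: "\<And>c. c \<in> V \<Longrightarrow> f c \<in> cochains R C A (p c) (q c)"
    and "v \<in> V" "card (subtree T v) \<le> k"
    and "as \<in> tuples (alg A (vtx C \<phi> P)) (tree_coloring.width T q I v)"
  shows "subtree_action k C A T I p q \<zeta> f \<phi> v as \<in> carrier (alg A (vtx C \<phi> (\<zeta> v 0))) \<and>
    ((\<exists>c\<in>subtree T v. vanishes C A (p c) (q c) (f c)) \<longrightarrow>
       subtree_action k C A T I p q \<zeta> f \<phi> v as = \<zero>\<^bsub>alg A (vtx C \<phi> (\<zeta> v 0))\<^esub>)"
  using assms(4-)
proof (induction k arbitrary: v as)
  case 0
  interpret colored_tree V T q I p \<zeta> P by fact
  from 0 card_subtree_pos[of v] show ?case by simp
next
  case (Suc k v as)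
  interpret colored_tree V T q I p \<zeta> P by fact
  have zm: "\<zeta> a i \<le> \<zeta> a (Suc i)" if "a \<in> V" "i < p a" for a i
    using strict_mono_onD[OF \<zeta>_mono[OF that(1)], of i "Suc i"] that by simp
  note zm = zm[OF \<open>v \<in> V\<close>] and zr = \<zeta>_range[OF \<open>v \<in> V\<close>]
  let ?w = "input_width T I q v"
  define xs where "xs j = take (?w j) (drop (\<Sum>i=1..<j. ?w i) as)" for j
  let ?x = "vtx C \<phi> (\<zeta> v (p v))"
  define y where "y j = (case child_at T I v j of
      None \<Rightarrow> act A (seg C \<phi> (\<zeta> v (p v)) P) (hd (xs j))
    | Some b \<Rightarrow> act A (seg C \<phi> (\<zeta> v (p v)) (\<zeta> b 0)) (subtree_action k C A T I p q \<zeta> f \<phi> b (xs j)))" for j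
  have len: "length (snd \<phi>) = P" using \<phi> unfolding strings_def by simp
  have eq: "subtree_action (Suc k) C A T I p q \<zeta> f \<phi> v as
      = f v (pull C (p v) (\<zeta> v) \<phi>) (map y [1..<Suc (q v)])"
    by (simp only: subtree_action.simps y_def[abs_def] xs_def Let_def len)
  have xs: "xs j \<in> tuples (alg A (vtx C \<phi> P)) (?w j)" if j: "j \<in> {1..q v}" for j
  proof -
    \<comment> \<open>The cut ends inside \<open>as\<close>, so \<open>drop\<close> and
      \<open>take\<close> yield a segment of full width.\<close>
    have "(\<Sum>i=1..<j. ?w i) + ?w j = (\<Sum>i=1..<Suc j. ?w i)" using j by simp
    also have "\<dots> \<le> (\<Sum>i=1..q v. ?w i)" by (rule sum_mono2) (use j in auto)
    also have "\<dots> = length as" using Suc.prems(3) unfolding tuples_def width_def by simp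
    finally have "length (xs j) = ?w j" unfolding xs_def by simp
    moreover have "set (xs j) \<subseteq> set as" unfolding xs_def by (meson order_trans set_drop_subset set_take_subset)
    ultimately show ?thesis using Suc.prems(3) unfolding tuples_def by auto
  qed
  have kid: "subtree_action k C A T I p q \<zeta> f \<phi> b (xs j) \<in> carrier (alg A (vtx C \<phi> (\<zeta> b 0))) \<and>
    ((\<exists>c\<in>subtree T b. vanishes C A (p c) (q c) (f c)) \<longrightarrow>
       subtree_action k C A T I p q \<zeta> f \<phi> b (xs j) = \<zero>\<^bsub>alg A (vtx C \<phi> (\<zeta> b 0))\<^esub>)"
    if j: "j \<in> {1..q v}" and b: "child_at T I v j = Some b" for j b
  proof (rule Suc.IH)
    have e: "(v, b) \<in> edges T" using b unfolding child_at_Some by simp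
    show "b \<in> V" using e edges_V by blast
    show "card (subtree T b) \<le> k" using card_subtree_kid_less[OF e] Suc.prems(2) by simp
    show "xs j \<in> tuples (alg A (vtx C \<phi> P)) (width b)"
      using xs[OF j] b by (simp add: input_width_alt)
  qed
  have y: "y j \<in> carrier (alg A ?x)" if j: "j \<in> {1..q v}" for j
  proof (cases "child_at T I v j")
    case None
    then have "xs j \<in> tuples (alg A (vtx C \<phi> P)) 1" using xs[OF j] by (simp add: input_width_alt)
    then have "hd (xs j) \<in> carrier (alg A (vtx C \<phi> P))" unfolding tuples_def by (cases "xs j") auto
    then show ?thesis using None seg_act_closed[OF \<phi>] zr by (simp add: y_def)
  next
    case (Some b)
    then have e: "(v, b) \<in> edges T" unfolding child_at_Some by simp
    have "b \<in> V" using e edges_V by blast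
    with Some seg_act_closed[OF \<phi> \<zeta>_edge[OF e] \<zeta>_range[of b 0]] kid[OF j Some]
    show ?thesis by (simp add: y_def)
  qed
  let ?ys = "map y [1..<Suc (q v)]"
  have ys: "?ys \<in> tuples (alg A ?x) (q v)" using y unfolding tuples_def by auto
  have pl: "pull C (p v) (\<zeta> v) \<phi> \<in> strings C (p v)" using pull_strings[OF \<phi>] zm zr by blast
  have v0: "vtx C (pull C (p v) (\<zeta> v) \<phi>) 0 = vtx C \<phi> (\<zeta> v 0)"
    and vp: "vtx C (pull C (p v) (\<zeta> v) \<phi>) (p v) = ?x"
    using vtx_pull[OF \<phi>, of 0 "p v" "\<zeta> v"] vtx_pull[OF \<phi>, of "p v" "p v" "\<zeta> v"] zm zr by blast+
  have h: "f v (pull C (p v) (\<zeta> v) \<phi>) \<in> multilinear R (q v) (alg A ?x) (alg A (vtx C \<phi> (\<zeta> v 0)))"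
    using f[OF Suc.prems(1)] pl unfolding cochains_def v0[symmetric] vp[symmetric] by blast
  have "f v (pull C (p v) (\<zeta> v) \<phi>) ?ys = \<zero>\<^bsub>alg A (vtx C \<phi> (\<zeta> v 0))\<^esub>"
    if c: "c \<in> subtree T v" and van: "vanishes C A (p c) (q c) (f c)" for c
  proof (cases "c = v")
    case True
    then show ?thesis using van pl ys unfolding vanishes_def v0[symmetric] vp[symmetric] by blast
  next
    case False
    then obtain b where e: "(v, b) \<in> edges T" and cb: "c \<in> subtree T b"
      using c unfolding subtree_unfold[of v] by blast
    define j where "j = I (v, b)"
    have j: "j \<in> {1..q v}" using I_range[OF e] unfolding j_def .
    have Some: "child_at T I v j = Some b" unfolding child_at_Some using e j_def by simp
    have "b \<in> V" using e edges_V by blast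
    have "y j = \<zero>\<^bsub>alg A ?x\<^esub>"
      using kid[OF j Some] cb van Some seg_act_zero[OF \<phi> \<zeta>_edge[OF e] \<zeta>_range[OF \<open>b \<in> V\<close>]]
      by (auto simp: y_def)
    \<comment> \<open>Inputs are numbered from 1, list positions from 0.\<close>
    moreover have "?ys ! (j - 1) = y j" using j by (subst nth_map) (auto simp del: upt_Suc)
    ultimately show ?thesis
      using multilinear_zero[OF h _ _ ys, of "j - 1"] j M_abelian vtx_obj[OF \<phi>] zr by force
  qed
  with multilinear_closed[OF h ys] show ?case unfolding eq by blast
qed

lemma coloring_action:
  assumes Q: "(W, T) \<in> Quilts n" and z: "\<zeta> \<in> word_colorings n W p" and I: "I \<in> tree_colorings T q"
    and pq: "(p, q) \<in> bidegrees n W p' q'"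
    and f: "\<And>c. c \<in> {1..n} \<Longrightarrow> f c \<in> cochains R C A (p c) (q c)"
    and \<phi>: "\<phi> \<in> strings C p'" and as: "as \<in> tuples (alg A (vtx C \<phi> p')) q'"
  shows "coloring_action C A n T I p q \<zeta> f \<phi> as \<in> carrier (alg A (vtx C \<phi> 0))"
    and "c \<in> {1..n} \<Longrightarrow> vanishes C A (p c) (q c) (f c) \<Longrightarrow>
       coloring_action C A n T I p q \<zeta> f \<phi> as = \<zero>\<^bsub>alg A (vtx C \<phi> 0)\<^esub>"
proof -
  have s: "(\<Sum>a=1..n. p a) = p' + word_deg W" "(\<Sum>a=1..n. q a) + 1 = q' + n"
    using pq unfolding bidegrees_def by auto
  have ct: "colored_tree {1..n} T q I p \<zeta> p'"
    using colored_tree_quilt[OF Q z I] s by simp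
  interpret colored_tree "{1..n}" T q I p \<zeta> p' by fact
  let ?u = "root n T"
  note u = root_in[OF Q]
  have z0: "\<zeta> ?u 0 \<le> p'" using \<zeta>_range[OF u(1)] by simp
  have c: "card (subtree T ?u) \<le> n" unfolding u(2) by simp
  have sub: "subtree_action n C A T I p q \<zeta> f \<phi> ?u as \<in> carrier (alg A (vtx C \<phi> (\<zeta> ?u 0))) \<and>
    ((\<exists>c\<in>subtree T ?u. vanishes C A (p c) (q c) (f c)) \<longrightarrow>
       subtree_action n C A T I p q \<zeta> f \<phi> ?u as = \<zero>\<^bsub>alg A (vtx C \<phi> (\<zeta> ?u 0))\<^esub>)"
    by (rule subtree_action[OF ct \<phi> f u(1) c]) (simp_all add: root_width[OF Q I s(2)] as)
  show "coloring_action C A n T I p q \<zeta> f \<phi> as \<in> carrier (alg A (vtx C \<phi> 0))"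
    unfolding coloring_action_def Let_def using sub seg_act_closed[OF \<phi> _ z0] by simp
  show "coloring_action C A n T I p q \<zeta> f \<phi> as = \<zero>\<^bsub>alg A (vtx C \<phi> 0)\<^esub>"
    if "c \<in> {1..n}" "vanishes C A (p c) (q c) (f c)"
  proof -
    have "subtree_action n C A T I p q \<zeta> f \<phi> ?u as = \<zero>\<^bsub>alg A (vtx C \<phi> (\<zeta> ?u 0))\<^esub>"
      using sub that unfolding u(2) by blast
    then show ?thesis
      unfolding coloring_action_def Let_def using seg_act_zero[OF \<phi> _ z0] by simp
  qed
qed

end

section \<open>Operations on cochains of degree one\<close>

text \<open>What shifted degree 1 leaves in the complex, where bidegree \<open>(2, 0)\<close> is
  excluded by \<open>q \<ge> 1\<close>; \<open>mhat A\<close> satisfies it too. The condition on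
  identity morphisms is kept apart and treated in
  \<open>reduced_iff_preserves_identities\<close>.\<close>

definition degree_one ::
  "('k, 'r) ring_scheme \<Rightarrow> ('o, 'm) category \<Rightarrow> ('o, 'm, 'k, 'a) diagram \<Rightarrow> ('o, 'm, 'a) gcochain \<Rightarrow> bool"
where
  "degree_one R C A F \<longleftrightarrow> (\<forall>p q. F p q \<in> cochains R C A p q) \<and>
     (\<forall>p q. (p, q) \<notin> {(0, 2), (1, 1)} \<longrightarrow> vanishes C A p q (F p q))"

definition good_bidegrees :: "nat \<Rightarrow> nat list \<Rightarrow> nat \<Rightarrow> nat \<Rightarrow> ((nat \<Rightarrow> nat) \<times> (nat \<Rightarrow> nat)) set" where
  "good_bidegrees n W p' q' =
     {(p, q) \<in> bidegrees n W p' q'. \<forall>a\<in>{1..n}. (p a, q a) = (0, 2) \<or> (p a, q a) = (1, 1)}"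

lemma finite_bidegrees: "finite (bidegrees n W p' q')"
proof (rule finite_subset)
  show "bidegrees n W p' q' \<subseteq>
      (\<Pi>\<^sub>E a\<in>{1..n}. {..p' + word_deg W}) \<times> (\<Pi>\<^sub>E a\<in>{1..n}. {..q' + n})"
  proof (clarify, intro conjI)
    fix p q assume pq: "(p, q) \<in> bidegrees n W p' q'"
    have "p a \<le> p' + word_deg W" "q a \<le> q' + n" if "a \<in> {1..n}" for a
      using member_le_sum[OF that, of p] member_le_sum[OF that, of q] pq
      unfolding bidegrees_def by auto
    then show "p \<in> (\<Pi>\<^sub>E a\<in>{1..n}. {..p' + word_deg W})" "q \<in> (\<Pi>\<^sub>E a\<in>{1..n}. {..q' + n})"
      using pq unfolding bidegrees_def by (auto simp: PiE_iff)
  qed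
qed (auto intro!: finite_SigmaI finite_PiE)

text \<open>Each vertex has \<open>p a + q a = 2\<close>, so both totals together are
  \<open>2 * n\<close>. Subtracting the degree \<open>n - 2\<close> and the \<open>n - 1\<close>
  inputs used by edges leaves 3.\<close>

lemma good_bidegrees_total:
  assumes "(p, q) \<in> good_bidegrees n W p' q'" and "word_deg W + 2 = n"
  shows "p' + q' = 3" and "\<And>a. a \<in> {1..n} \<Longrightarrow> 1 \<le> q a"
proof -
  have g: "(p a, q a) = (0, 2) \<or> (p a, q a) = (1, 1)" if "a \<in> {1..n}" for a
    using assms(1) that unfolding good_bidegrees_def by auto
  then show "\<And>a. a \<in> {1..n} \<Longrightarrow> 1 \<le> q a" by fastforce
  have "(\<Sum>a=1..n. p a) + (\<Sum>a=1..n. q a) = (\<Sum>a=1..n. 2)"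
    unfolding sum.distrib[symmetric] by (rule sum.cong) (use g in fastforce)+
  then show "p' + q' = 3"
    using assms unfolding good_bidegrees_def bidegrees_def by auto
qed

context algebra_diagram
begin

lemma quilt_op_hom:
  assumes Q: "Q \<in> Quilts n" and pq: "(p, q) \<in> bidegrees n (fst Q) p' q'"
    and f: "\<And>c. c \<in> {1..n} \<Longrightarrow> f c \<in> cochains R C A (p c) (q c)"
    and \<phi>: "\<phi> \<in> strings C p'" and as: "as \<in> tuples (alg A (vtx C \<phi> p')) q'"
  shows "quilt_op_hom C A n Q p q f \<phi> as \<in> carrier (alg A (vtx C \<phi> 0))"
    and "c \<in> {1..n} \<Longrightarrow> vanishes C A (p c) (q c) (f c) \<Longrightarrow>
       quilt_op_hom C A n Q p q f \<phi> as = \<zero>\<^bsub>alg A (vtx C \<phi> 0)\<^esub>"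
proof -
  interpret M: abelian_group "alg A (vtx C \<phi> 0)" using M_abelian vtx_obj[OF \<phi>] by blast
  obtain W T where WT: "Q = (W, T)" by (cases Q)
  note ca = coloring_action[OF Q[unfolded WT] _ _ pq[unfolded WT, simplified] f \<phi> as]
  show "quilt_op_hom C A n Q p q f \<phi> as \<in> carrier (alg A (vtx C \<phi> 0))"
    unfolding quilt_op_hom_def WT using ca(1)
    by (auto intro!: M.finsum_closed M.add.int_pow_closed)
  show "quilt_op_hom C A n Q p q f \<phi> as = \<zero>\<^bsub>alg A (vtx C \<phi> 0)\<^esub>"
    if c: "c \<in> {1..n}" "vanishes C A (p c) (q c) (f c)"
    unfolding quilt_op_hom_def WT using ca(2)[OF _ _ _ c]
    by (auto intro!: M.add.finprod_one_eqI simp: M.add.int_pow_one)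
qed

context
  fixes n Q F p' q' \<phi> as
  assumes Q: "Q \<in> Quilts n" and F: "\<And>a. a \<in> {1..n} \<Longrightarrow> degree_one R C A (F a)"
    and \<phi>: "\<phi> \<in> strings C p'" and as: "as \<in> tuples (alg A (vtx C \<phi> p')) q'"
begin

interpretation M: abelian_group "alg A (vtx C \<phi> 0)" using M_abelian vtx_obj[OF \<phi>] by blast

lemma quilt_op_hom_family:
  assumes "(p, q) \<in> bidegrees n (fst Q) p' q'"
  shows "quilt_op_hom C A n Q p q (\<lambda>a. F a (p a) (q a)) \<phi> as \<in> carrier (alg A (vtx C \<phi> 0))"
  by (rule quilt_op_hom[OF Q assms _ \<phi> as]) (use F in \<open>auto simp: degree_one_def\<close>)

text \<open>Any other choice of bidegrees gives some vertex a vanishing component, which annihilates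
  every colored composite.\<close>

lemma quilt_op_good:
  "quilt_op C A n Q F p' q' \<phi> as = (\<Oplus>\<^bsub>alg A (vtx C \<phi> 0)\<^esub>pq\<in>good_bidegrees n (fst Q) p' q'.
        quilt_op_hom C A n Q (fst pq) (snd pq) (\<lambda>a. F a (fst pq a) (snd pq a)) \<phi> as)"
  unfolding quilt_op_def
proof (rule M.add.finprod_mono_neutral_cong_left[symmetric])
  show "finite (bidegrees n (fst Q) p' q')" by (rule finite_bidegrees)
  show "good_bidegrees n (fst Q) p' q' \<subseteq> bidegrees n (fst Q) p' q'"
    unfolding good_bidegrees_def by auto
  show "(\<lambda>pq. quilt_op_hom C A n Q (fst pq) (snd pq) (\<lambda>a. F a (fst pq a) (snd pq a)) \<phi> as)
      \<in> bidegrees n (fst Q) p' q' \<rightarrow> carrier (alg A (vtx C \<phi> 0))"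
    using quilt_op_hom_family by auto
  fix pq assume pq: "pq \<in> bidegrees n (fst Q) p' q' - good_bidegrees n (fst Q) p' q'"
  obtain p q where [simp]: "pq = (p, q)" by (cases pq)
  obtain c where c: "c \<in> {1..n}" "(p c, q c) \<notin> {(0, 2), (1, 1)}"
    using pq unfolding good_bidegrees_def by auto
  then have "vanishes C A (p c) (q c) (F c (p c) (q c))"
    using F[OF c(1)] unfolding degree_one_def by blast
  then show "quilt_op_hom C A n Q (fst pq) (snd pq) (\<lambda>a. F a (fst pq a) (snd pq a)) \<phi> as
      = \<zero>\<^bsub>alg A (vtx C \<phi> 0)\<^esub>"
    using quilt_op_hom(2)[OF Q _ _ \<phi> as c(1), of p q] pq F by (auto simp: degree_one_def)
qed simp

lemma quilt_op_closed: "quilt_op C A n Q F p' q' \<phi> as \<in> carrier (alg A (vtx C \<phi> 0))"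
  unfolding quilt_op_def using quilt_op_hom_family by (auto intro!: M.finsum_closed)

lemma quilt_op_arity_ge_4:
  assumes "word_deg (fst Q) + 2 = n" and n: "4 \<le> n"
  shows "quilt_op C A n Q F p' q' \<phi> as = \<zero>\<^bsub>alg A (vtx C \<phi> 0)\<^esub>"
  unfolding quilt_op_good
proof (rule M.add.finprod_one_eqI)
  fix pq assume pq: "pq \<in> good_bidegrees n (fst Q) p' q'"
  obtain p q where pq': "pq = (p, q)" by (cases pq)
  \<comment> \<open>No pair of colorings exists at all, so there is no term left in the double sum
    over \<open>\<zeta>\<close> and \<open>I\<close>.\<close>
  have "False" if "\<zeta> \<in> word_colorings n (fst Q) p" "I \<in> tree_colorings (snd Q) q" for \<zeta> I
  proof -
    have "(p, q) \<in> bidegrees n (fst Q) p' q'"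
      using pq unfolding pq' good_bidegrees_def by auto
    moreover have "(fst Q, snd Q) \<in> Quilts n" using Q by simp
    moreover note good = good_bidegrees_total[OF pq[unfolded pq'] assms(1)]
    ultimately have "n \<le> 3"
      using quilt_arity_le_3[OF _ that _ good(2) good(1) assms(1)] by blast
    with n show False by simp
  qed
  then show "quilt_op_hom C A n Q (fst pq) (snd pq) (\<lambda>a. F a (fst pq a) (snd pq a)) \<phi> as
      = \<zero>\<^bsub>alg A (vtx C \<phi> 0)\<^esub>"
    unfolding quilt_op_hom_def pq' by (intro M.add.finprod_one_eqI) auto
qed

end

lemma P0_op_arity_ge_4:
  assumes "4 \<le> n" and "\<And>a. a \<in> {1..n} \<Longrightarrow> degree_one R C A (F a)"
    and "\<phi> \<in> strings C p'" and "as \<in> tuples (alg A (vtx C \<phi> p')) q'"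
  shows "P0_op C A n F p' q' \<phi> as = \<zero>\<^bsub>alg A (vtx C \<phi> 0)\<^esub>"
proof -
  interpret M: abelian_group "alg A (vtx C \<phi> 0)" using M_abelian vtx_obj[OF assms(3)] by blast
  have "(\<Oplus>\<^bsub>alg A (vtx C \<phi> 0)\<^esub>Q\<in>P0_quilts n. quilt_op C A n Q F p' q' \<phi> as) = \<zero>\<^bsub>alg A (vtx C \<phi> 0)\<^esub>"
    using quilt_op_arity_ge_4[OF _ assms(2-4) _ assms(1)]
    by (intro M.add.finprod_one_eqI) (auto simp: P0_quilts_def)
  then show ?thesis unfolding P0_op_def by (simp add: M.add.int_pow_one)
qed

end

section \<open>The quilts of small arity\<close>

lemma rtrancl_no_chain:
  assumes "\<And>x y z. (x, y) \<in> E \<Longrightarrow> (y, z) \<notin> E" shows "E\<^sup>* = Id \<union> E"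
proof -
  have "y = x \<or> (x, y) \<in> E" if "(x, y) \<in> E\<^sup>*" for x y
    using that by (induction rule: rtrancl_induct) (use assms in blast)+
  then show ?thesis by auto
qed

text \<open>Meant for \<open>{a, b} = {1, 2}\<close>: the tree of \<open>B\<close> is \<open>edge_tree 1 2\<close>, that of \<open>B'\<close> is \<open>edge_tree 2 1\<close>.\<close>

definition edge_tree :: "nat \<Rightarrow> nat \<Rightarrow> ptree" where
  "edge_tree a b = \<lparr>edges = {(a, b)}, planar = Id_on {1, 2}\<rparr>"

text \<open>In the word \<open>1232\<close> the letter 3 lies between two occurrences of 2, so
  condition (2) of a quilt puts 3 to the left of 2.\<close>

definition cherry_tree :: ptree where
  "cherry_tree = \<lparr>edges = {(1, 2), (1, 3)}, planar = insert (3, 2) (Id_on {1, 2, 3})\<rparr>"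

definition cherry_quilt :: quilt where
  "cherry_quilt = ([1, 2, 3, 2], cherry_tree)"

lemma tle_edge_tree: "a \<noteq> b \<Longrightarrow> (edges (edge_tree a b))\<^sup>* = insert (a, b) Id"
  by (subst rtrancl_no_chain) (auto simp: edge_tree_def)

lemma tle_cherry_tree: "(edges cherry_tree)\<^sup>* = {(1, 2), (1, 3)} \<union> Id"
  by (subst rtrancl_no_chain) (auto simp: cherry_tree_def)

lemma atLeastAtMost_1_2: "{1..2::nat} = {1, 2}" "{Suc 0..2} = {1, 2}"
  and atLeastAtMost_1_3: "{1..3::nat} = {1, 2, 3}" "{Suc 0..3} = {1, 2, 3}"
  by auto

lemma edge_tree_is_tree:
  assumes "(a, b) = (1, 2) \<or> (a, b) = (2, 1)"
  shows "is_tree {1..2} (edge_tree a b)"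
proof -
  have ab: "a \<noteq> b" using assms by auto
  have pl: "partial_order_on {1, 2} (Id_on {1, 2::nat})"
    by (auto simp: partial_order_on_def preorder_on_def refl_on_def trans_def antisym_def)
  have r: "is_root {1, 2} (edge_tree a b) r \<longleftrightarrow> r = a" for r
    using assms unfolding is_root_def tle_edge_tree[OF ab] by auto
  have left: "left_of (edge_tree a b) u v \<longleftrightarrow> False" for u v
    by (auto simp: edge_tree_def)
  show ?thesis
    unfolding is_tree_def atLeastAtMost_1_2
  proof (intro conjI)
    show "partial_order_on {1, 2} (planar (edge_tree a b))" using pl by (simp add: edge_tree_def)
    show "antisym ((edges (edge_tree a b))\<^sup>*)"
      unfolding tle_edge_tree[OF ab] using ab by (auto intro: antisymI)
    show "\<exists>!r. is_root {1, 2} (edge_tree a b) r" unfolding r by simp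
    show "\<forall>(u, v)\<in>edges (edge_tree a b).
        \<not> (\<exists>t\<in>{1, 2}. tless (edge_tree a b) u t \<and> tless (edge_tree a b) t v)"
      unfolding tle_edge_tree[OF ab] by (auto simp: edge_tree_def)
    show "\<forall>u\<in>{1, 2}. \<forall>v\<in>{1, 2}. length (filter (\<lambda>b. b) [u = v, tless (edge_tree a b) u v,
        tless (edge_tree a b) v u, left_of (edge_tree a b) u v, left_of (edge_tree a b) v u]) = 1"
      unfolding left unfolding tle_edge_tree[OF ab] using assms by (elim disjE) simp_all
    show "\<forall>u\<in>{1, 2}. \<forall>v\<in>{1, 2}. \<forall>u'\<in>{1, 2}. \<forall>v'\<in>{1, 2}. left_of (edge_tree a b) u v \<and>
        tle (edge_tree a b) u u' \<and> tle (edge_tree a b) v v' \<longrightarrow> left_of (edge_tree a b) u' v'"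
      unfolding left by simp
  qed (use assms in \<open>auto simp: edge_tree_def\<close>)
qed

lemma cherry_tree_is_tree: "is_tree {1..3} cherry_tree"
proof -
  have pl: "partial_order_on {1, 2, 3} (insert (3, 2) (Id_on {1, 2, 3::nat}))"
    by (auto simp: partial_order_on_def preorder_on_def refl_on_def trans_def antisym_def)
  have r: "is_root {1, 2, 3} cherry_tree r \<longleftrightarrow> r = 1" for r
    unfolding is_root_def tle_cherry_tree by auto
  have left: "left_of cherry_tree u v \<longleftrightarrow> u = 3 \<and> v = 2" for u v
    by (auto simp: cherry_tree_def)
  show ?thesis
    unfolding is_tree_def atLeastAtMost_1_3
  proof (intro conjI)
    show "partial_order_on {1, 2, 3} (planar cherry_tree)" using pl by (simp add: cherry_tree_def)
    show "antisym ((edges cherry_tree)\<^sup>*)"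
      unfolding tle_cherry_tree by (auto intro: antisymI)
    show "\<exists>!r. is_root {1, 2, 3} cherry_tree r" unfolding r by simp
    show "\<forall>(u, v)\<in>edges cherry_tree.
        \<not> (\<exists>t\<in>{1, 2, 3}. tless cherry_tree u t \<and> tless cherry_tree t v)"
      unfolding tle_cherry_tree by (auto simp: cherry_tree_def)
    show "\<forall>u\<in>{1, 2, 3}. \<forall>v\<in>{1, 2, 3}. length (filter (\<lambda>b. b) [u = v, tless cherry_tree u v,
        tless cherry_tree v u, left_of cherry_tree u v, left_of cherry_tree v u]) = 1"
      unfolding left unfolding tle_cherry_tree by simp
    show "\<forall>u\<in>{1, 2, 3}. \<forall>v\<in>{1, 2, 3}. \<forall>u'\<in>{1, 2, 3}. \<forall>v'\<in>{1, 2, 3}. left_of cherry_tree u v \<and>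
        tle cherry_tree u u' \<and> tle cherry_tree v v' \<longrightarrow> left_of cherry_tree u' v'"
      unfolding left unfolding tle_cherry_tree by simp
  qed (auto simp: cherry_tree_def)
qed

lemma edge_quilt:
  assumes "(a, b) = (1, 2) \<or> (a, b) = (2, 1)"
  shows "([a, b], edge_tree a b) \<in> Quilts 2"
proof -
  have ab: "a \<noteq> b" using assms by auto
  have ns: "\<not> subseq [u, v, u, v] [a, b]" for u v :: nat
    using list_emb_length[of "(=)" "[u, v, u, v]" "[a, b]"] by auto
  have "[a, b] \<in> F2S 2"
    unfolding F2S_def using assms ns by (auto simp: atLeastAtMost_1_2)
  moreover have "\<not> tless (edge_tree a b) ([a, b] ! j) ([a, b] ! i)"
    if "i < j" "j < length [a, b]" for i j
    using that ab unfolding tle_edge_tree[OF ab] by (auto simp: less_Suc_eq)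
  moreover have False if "i < j" "j < k" "k < length [a, b]" for i j k
    using that by auto
  ultimately show ?thesis
    unfolding Quilts_def Trees_def using edge_tree_is_tree[OF assms] by blast
qed

lemma cherry_quilt_quilt: "cherry_quilt \<in> Quilts 3"
proof -
  let ?W = "[1, 2, 3, 2::nat]"
  have ns: "\<not> subseq [u, v, u, v] ?W" for u v :: nat
  proof
    assume "subseq [u, v, u, v] ?W"
    then have "[u, v, u, v] = ?W" by (rule subseq_same_length) simp
    then show False by auto
  qed
  have "?W \<in> F2S 3"
    unfolding F2S_def atLeastAtMost_1_3 using ns by simp blast
  moreover have "\<not> tless cherry_tree (?W ! j) (?W ! i)" if "i < j" "j < length ?W" for i j
  proof -
    have "j = 1 \<or> j = 2 \<or> j = 3" using that by auto
    then have "?W ! j \<noteq> 1" by (elim disjE) simp_all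
    then show ?thesis unfolding tle_cherry_tree by auto
  qed
  moreover have "(?W ! j, ?W ! i) \<in> planar cherry_tree"
    if "i < j" "j < k" "k < length ?W" "?W ! i = ?W ! k" for i j k
  proof -
    have "k = 2 \<or> k = 3" using that by auto
    moreover have "i = 0 \<or> i = 1" "j = 1 \<or> j = 2" using that by auto
    ultimately have "i = 1 \<and> j = 2" using that by (elim disjE) simp_all
    then show ?thesis by (simp add: cherry_tree_def)
  qed
  ultimately show ?thesis
    unfolding Quilts_def Trees_def cherry_quilt_def using cherry_tree_is_tree by blast
qed

text \<open>A quilt begins with its root, and everything between two occurrences of a vertex lies to the
  left of it, which the root forbids.\<close>

lemma quilt_head:
  assumes Q: "(W, T) \<in> Quilts n" and n: "1 \<le> n"
  shows "W \<noteq> []" and "tle T (hd W) v \<longleftrightarrow> v \<in> {1..n}" and "hd W \<notin> set (tl W)"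
proof -
  have W: "set W = {1..n}" "distinct_adj W" and T: "is_tree {1..n} T"
    using Q unfolding Quilts_def F2S_def Trees_def by auto
  interpret planar_tree "{1..n}" T using T by unfold_locales
  let ?r = "root n T"
  show ne: "W \<noteq> []" using W n by auto
  then have hd: "hd W = W ! 0" "hd W \<in> {1..n}" using W by (auto simp: hd_conv_nth)
  have r: "hd W = ?r"
  proof (rule ccontr)
    assume neq: "hd W \<noteq> ?r"
    obtain k where k: "k < length W" "W ! k = ?r"
      using root_in(1)[OF Q] W(1) by (metis in_set_conv_nth)
    with neq hd have "0 < k" by (cases k) auto
    then have "\<not> tless T (W ! k) (W ! 0)" using Q k unfolding Quilts_def by blast
    moreover have "tle T ?r (hd W)" using root_in(2)[OF Q] hd by blast
    ultimately show False using neq k hd by simp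
  qed
  have tle: "tle T (hd W) v \<longleftrightarrow> v \<in> {1..n}" for v
  proof -
    have "v \<in> subtree T ?r \<longleftrightarrow> v \<in> {1..n}" unfolding root_in(2)[OF Q] ..
    then show ?thesis unfolding r by simp
  qed
  then show "tle T (hd W) v \<longleftrightarrow> v \<in> {1..n}" .
  show "hd W \<notin> set (tl W)"
  proof
    assume "hd W \<in> set (tl W)"
    then obtain k where k: "k < length (tl W)" "tl W ! k = hd W" by (metis in_set_conv_nth)
    then have k': "Suc k < length W" "W ! Suc k = W ! 0" using hd by (auto simp: nth_tl)
    have "W ! 0 \<noteq> W ! 1"
      using W(2) k' by (cases W rule: list.exhaust; cases "tl W") (auto simp: distinct_adj_Cons_Cons)
    then have "0 < k" using k' by (cases k) auto
    then have "(W ! 1, W ! 0) \<in> planar T" using Q k' unfolding Quilts_def by fastforce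
    moreover have "tle T (W ! 0) (W ! 1)"
      using tle[of "W ! 1"] hd W(1) k' nth_mem[of 1 W] by simp
    moreover have "W ! 1 \<in> {1..n}" using W(1) k' nth_mem[of 1 W] by simp
    ultimately show False
      using exactly_one[of "W ! 0" "W ! 1"] \<open>W ! 0 \<noteq> W ! 1\<close> hd by (simp split: if_splits)
  qed
qed

lemma tle_first_edge:
  assumes "(u, v) \<in> E\<^sup>*" "u \<noteq> v" obtains w where "(u, w) \<in> E" "(w, v) \<in> E\<^sup>*"
  using assms by (meson converse_rtranclE)

text \<open>Degree 0 makes the word free of repetitions, hence equal to its own order of first
  occurrences. Its head is the root, and two vertices leave only one tree with root 1.\<close>

lemma P0_quilts_2: "P0_quilts 2 = {quilt_B}"
proof -
  have B: "quilt_B = ([1, 2], edge_tree 1 2)" by (simp add: quilt_B_def edge_tree_def)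
  have "Q = quilt_B" if Q: "Q \<in> P0_quilts 2" for Q
  proof -
    obtain W T where WT: "Q = (W, T)" by (cases Q)
    have q: "(W, T) \<in> Quilts 2" and d: "word_deg W = 0" "down_order W = [1..<Suc 2]"
      using Q unfolding WT P0_quilts_def by auto
    have W: "set W = {1..2}" and T: "is_tree {1..2} T"
      using q unfolding Quilts_def F2S_def Trees_def by auto
    have "length W = card (set W)" using d(1) card_length[of W] unfolding word_deg_def by simp
    then have "distinct W" by (simp add: card_distinct)
    then have "down_order W = W" unfolding down_order_def by (simp add: distinct_remdups_id)
    with d(2) have W12: "W = [1, 2]" by (simp add: upt_rec numeral_2_eq_2)
    interpret planar_tree "{1..2}" T using T by unfold_locales
    have t: "tle T 1 2" using quilt_head(2)[OF q, of 2] W12 by simp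
    then obtain w where w: "(1, w) \<in> edges T" "tle T w 2" by (rule tle_first_edge) simp
    then have "w = 2" using edges_V edge_irrefl[of 1] by (auto simp: atLeastAtMost_1_2)
    have n21: "\<not> tle T 2 1" using t antisymD[OF tle_antisym, of 1 2] by auto
    then have "(2, 1) \<notin> edges T" by blast
    then have e: "edges T = {(1, 2)}"
      using w \<open>w = 2\<close> edges_V edge_irrefl by (auto simp: atLeastAtMost_1_2)
    have po: "planar T \<subseteq> {1..2} \<times> {1..2}" "refl_on {1..2} (planar T)"
      using T unfolding is_tree_def partial_order_on_def preorder_on_def by auto
    have "\<not> left_of T 1 2" "\<not> left_of T 2 1"
      using exactly_one[of 1 2] t n21 by (auto split: if_splits)
    then have p: "planar T = Id_on {1, 2}"
      using po by (auto simp: atLeastAtMost_1_2 refl_on_def)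
    show ?thesis unfolding WT B W12 edge_tree_def using e p by (cases T) simp
  qed
  moreover have "quilt_B \<in> P0_quilts 2"
    unfolding P0_quilts_def B using edge_quilt[of 1 2]
    by (auto simp: word_deg_def down_order_def upt_rec)
  ultimately show ?thesis by blast
qed

text \<open>Degree 1 gives four letters, of which the head occurs once, so 2 and 3 alternate in the
  last three places and the order of first occurrences selects \<open>1232\<close>. Condition (2)
  makes 2 and 3 incomparable in the tree order, so both are children of the root.\<close>

lemma P0_quilts_3: "P0_quilts 3 = {cherry_quilt}"
proof -
  have "Q = cherry_quilt" if Q: "Q \<in> P0_quilts 3" for Q
  proof -
    obtain W T where WT: "Q = (W, T)" by (cases Q)
    have q: "(W, T) \<in> Quilts 3" and d: "word_deg W = 1" "down_order W = [1..<Suc 3]"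
      using Q unfolding WT P0_quilts_def by auto
    have W: "set W = {1..3}" "distinct_adj W" and T: "is_tree {1..3} T"
      using q unfolding Quilts_def F2S_def Trees_def by auto
    have "length W = 4" using d(1) card_length[of W] unfolding word_deg_def W by simp
    then obtain w0 w1 w2 w3 where w: "W = [w0, w1, w2, w3]"
      by (auto simp: numeral_eq_Suc length_Suc_conv)
    have w': "w0 \<notin> {w1, w2, w3}" using quilt_head(3)[OF q] unfolding w by simp
    have dw: "rev (remdups (rev W)) = [1, 2, 3]" using d(2) unfolding down_order_def by (simp add: upt_rec)
    have "x \<in> {1, 2, 3}" if "x \<in> set W" for x
      using that unfolding W(1) atLeastAtMost_1_3 .
    then have ws: "w1 \<in> {1, 2, 3}" "w2 \<in> {1, 2, 3}" "w3 \<in> {1, 2, 3}"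
      unfolding w by simp_all
    have w0: "w0 = 1" using dw w' unfolding w by (simp split: if_splits)
    then have ws': "w1 = 2 \<or> w1 = 3" "w2 = 2 \<or> w2 = 3" "w3 = 2 \<or> w3 = 3"
      using ws w' by auto
    moreover have "w1 \<noteq> w2" "w2 \<noteq> w3" using W(2) unfolding w by simp_all
    ultimately have "(w1, w2, w3) = (2, 3, 2) \<or> (w1, w2, w3) = (3, 2, 3)" by auto
    then have W1232: "W = [1, 2, 3, 2]"
      using dw unfolding w w0 by (elim disjE) simp_all
    interpret planar_tree "{1..3}" T using T by unfold_locales
    have t: "tle T 1 2" "tle T 1 3"
      using quilt_head(2)[OF q, of 2] quilt_head(2)[OF q, of 3] W1232 by simp_all
    have "1 < (2::nat) \<and> 2 < (3::nat) \<and> 3 < length W \<and> W ! 1 = W ! 3"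
      by (simp add: W1232)
    then have "(W ! 2, W ! 1) \<in> planar T"
      using q unfolding Quilts_def by blast
    then have p32: "left_of T 3 2" by (simp add: W1232)
    have inc: "\<not> tle T 3 2" "\<not> tle T 2 3" "\<not> left_of T 2 3"
      using exactly_one[of 2 3] p32 by (auto split: if_splits)
    have n1: "\<not> tle T 2 1" "\<not> tle T 3 1"
      using t antisymD[OF tle_antisym, of 1 2] antisymD[OF tle_antisym, of 1 3] by auto
    have nl: "\<not> left_of T 1 2" "\<not> left_of T 2 1" "\<not> left_of T 1 3" "\<not> left_of T 3 1"
      using exactly_one[of 1 2] exactly_one[of 1 3] t n1 by (auto split: if_splits)
    have e12: "(1, 2) \<in> edges T"
    proof -
      obtain w where "(1, w) \<in> edges T" "tle T w 2" using tle_first_edge[OF t(1)] by auto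
      then show ?thesis using edges_V edge_irrefl[of 1] inc by (auto simp: atLeastAtMost_1_3)
    qed
    have e13: "(1, 3) \<in> edges T"
    proof -
      obtain w where "(1, w) \<in> edges T" "tle T w 3" using tle_first_edge[OF t(2)] by auto
      then show ?thesis using edges_V edge_irrefl[of 1] inc by (auto simp: atLeastAtMost_1_3)
    qed
    have "(x, y) \<notin> edges T" if "\<not> tle T x y" for x y using that by blast
    then have e: "edges T = {(1, 2), (1, 3)}"
      using e12 e13 edges_V edge_irrefl n1 inc by (auto simp: atLeastAtMost_1_3)
    have po: "planar T \<subseteq> {1..3} \<times> {1..3}" "refl_on {1..3} (planar T)"
      using T unfolding is_tree_def partial_order_on_def preorder_on_def by auto
    have p: "planar T = insert (3, 2) (Id_on {1, 2, 3})"
      using po nl inc p32 by (auto simp: atLeastAtMost_1_3 refl_on_def)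
    show ?thesis unfolding WT cherry_quilt_def W1232 cherry_tree_def using e p by (cases T) simp
  qed
  moreover have "cherry_quilt \<in> P0_quilts 3"
    using cherry_quilt_quilt unfolding P0_quilts_def
    by (auto simp: word_deg_def down_order_def upt_rec cherry_quilt_def card_insert_if)
  ultimately show ?thesis by blast
qed

section \<open>Signs and colorings of the small quilts\<close>

text \<open>Distinct letters make the permutation unique, so exhibiting one evaluates the definite
  description.\<close>

lemma permutation_sign_eqI:
  assumes "distinct xs" "\<sigma> permutes {..<length xs}" "permute_list \<sigma> xs = ys"
  shows "permutation_sign xs ys = sign \<sigma>"
proof -
  have "(THE \<sigma>. \<sigma> permutes {..<length xs} \<and> permute_list \<sigma> xs = ys) = \<sigma>"
  proof (rule the_equality)
    fix \<tau> assume \<tau>: "\<tau> permutes {..<length xs} \<and> permute_list \<tau> xs = ys"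
    have "\<tau> i = \<sigma> i" for i
    proof (cases "i < length xs")
      case True
      then have "\<tau> i < length xs" "\<sigma> i < length xs"
        using \<tau> assms(2) permutes_in_image by fastforce+
      moreover have "xs ! \<tau> i = xs ! \<sigma> i"
        using \<tau> assms(2,3) True permute_list_nth by metis
      ultimately show ?thesis using assms(1) by (simp add: nth_eq_iff_index_eq)
    next
      case False
      then show ?thesis using \<tau> assms(2) unfolding permutes_def by simp
    qed
    then show "\<tau> = \<sigma>" by blast
  qed (use assms in auto)
  then show ?thesis unfolding permutation_sign_def by simp
qed

lemma permutation_sign_refl: "distinct xs \<Longrightarrow> permutation_sign xs xs = 1"
  using permutation_sign_eqI[of xs id xs] by (simp add: permutes_id sign_id)

lemma permutation_sign_swap_2:
  assumes "x \<noteq> y" shows "permutation_sign [x, y] [y, x] = - 1"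
proof -
  have "permutation_sign [x, y] [y, x] = sign (transpose 0 (1::nat))"
    by (rule permutation_sign_eqI)
       (use assms in \<open>auto intro!: permutes_swap_id simp: permute_list_def upt_rec\<close>)
  then show ?thesis by (simp add: sign_swap_id)
qed

text \<open>The permutation in the sign of the cherry quilt. Reversing three letters only exchanges
  the outer two, so it is a transposition.\<close>

lemma permutation_sign_swap_3:
  assumes "distinct [x, y, z]" shows "permutation_sign [x, y, z] [z, y, x] = - 1"
proof -
  have "permutation_sign [x, y, z] [z, y, x] = sign (transpose 0 (2::nat))"
    by (rule permutation_sign_eqI)
       (use assms in \<open>auto intro!: permutes_swap_id simp: permute_list_def upt_rec numeral_2_eq_2 transpose_def\<close>)
  then show ?thesis by (simp add: sign_swap_id)
qed

lemma root_eqI: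
  assumes "is_tree {1..n} T" "is_root {1..n} T r" shows "root n T = r"
proof -
  have "\<exists>!r. is_root {1..n} T r" using assms(1) unfolding is_tree_def by blast
  with root_is_root[OF assms(1)] assms(2) show ?thesis by blast
qed

text \<open>Evaluates the definite description in \<open>children\<close>. Two duplicate-free lists
  on the same set, sorted by an asymmetric relation, have the same head: otherwise each head would
  precede the other.\<close>

lemma children_eqI:
  assumes "distinct cs" "set cs = kids T v" "sorted_wrt (left_of T) cs"
    and anti: "\<And>u w. left_of T u w \<Longrightarrow> \<not> left_of T w u"
  shows "children T v = cs"
  unfolding children_def
proof (rule the_equality)
  fix ds assume ds: "distinct ds \<and> set ds = kids T v \<and> sorted_wrt (left_of T) ds"
  have uniq: "cs = ds" if "distinct cs" "distinct ds" "set cs = set ds" "sorted_wrt (left_of T) cs"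
    "sorted_wrt (left_of T) ds" for cs ds
    using that
  proof (induction cs arbitrary: ds)
    case (Cons c cs)
    then obtain d ds' where ds: "ds = d # ds'" by (cases ds) auto
    have "c = d"
    proof (rule ccontr)
      assume "c \<noteq> d"
      then have "d \<in> set cs" "c \<in> set ds'" using Cons.prems ds by auto
      then show False using Cons.prems ds anti by auto
    qed
    moreover have "set cs = set ds'" using Cons.prems ds \<open>c = d\<close> by (auto simp: insert_ident)
    ultimately show ?case using Cons.IH[of ds'] Cons.prems ds by simp
  qed simp
  show "ds = cs" by (rule uniq) (use ds assms(1-3) in simp_all)
qed (use assms in simp)

text \<open>Bidegree vectors given by their list of values. The restriction makes them extensional,
  as required of the elements of \<open>bidegrees\<close>.\<close>

definition vec :: "nat list \<Rightarrow> nat \<Rightarrow> nat" where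
  "vec xs = (\<lambda>a\<in>{1..length xs}. xs ! (a - 1))"

lemma vec_simps [simp]:
  "vec [x, y] (Suc 0) = x" "vec [x, y] 2 = y"
  "vec [x, y, z] (Suc 0) = x" "vec [x, y, z] 2 = y" "vec [x, y, z] 3 = z"
  by (simp_all add: vec_def)

lemma vec_PiE: "vec [x, y] \<in> {1..2} \<rightarrow>\<^sub>E UNIV" "vec [x, y, z] \<in> {1..3} \<rightarrow>\<^sub>E UNIV"
  by (auto simp: vec_def)

lemma PiE_vec_2: "p \<in> {1..2} \<rightarrow>\<^sub>E UNIV \<Longrightarrow> p = vec [p 1, p 2]"
proof (rule ext)
  fix a :: nat assume p: "p \<in> {1..2} \<rightarrow>\<^sub>E UNIV"
  have "a = 1 \<or> a = 2 \<or> a \<notin> {1..2}" by auto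
  then show "p a = vec [p 1, p 2] a"
    using PiE_arb[OF p, of a] by (auto simp: vec_def)
qed

lemma PiE_vec_3: "p \<in> {1..3} \<rightarrow>\<^sub>E UNIV \<Longrightarrow> p = vec [p 1, p 2, p 3]"
proof (rule ext)
  fix a :: nat assume p: "p \<in> {1..3} \<rightarrow>\<^sub>E UNIV"
  have "a = 1 \<or> a = 2 \<or> a = 3 \<or> a \<notin> {1..3}" by auto
  then show "p a = vec [p 1, p 2, p 3] a"
    using PiE_arb[OF p, of a] by (auto simp: vec_def)
qed

lemma sum_1_2: "sum f {1..2::nat} = f 1 + f 2" "sum f {Suc 0..2::nat} = f 1 + f 2"
  and sum_1_3: "sum f {1..3::nat} = f 1 + (f 2 + f 3)" "sum f {Suc 0..3::nat} = f 1 + (f 2 + f 3)"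
  for f :: "nat \<Rightarrow> 'b::comm_monoid_add"
  by (simp_all add: numeral_eq_Suc ac_simps)

text \<open>Both allowed bidegrees satisfy \<open>q a = 2 - p a\<close>, so \<open>q\<close> is
  determined by \<open>p\<close>, a vector of zeros and ones.\<close>

lemma good_bidegrees_2:
  "(p, q) \<in> good_bidegrees 2 W p' q' \<longleftrightarrow>
     (\<exists>x y. x \<le> 1 \<and> y \<le> 1 \<and> p = vec [x, y] \<and> q = vec [2 - x, 2 - y] \<and>
        x + y = p' + word_deg W \<and> q' + (x + y) = 3)"
  (is "?L \<longleftrightarrow> ?R")
proof
  assume L: ?L
  then have p: "p = vec [p 1, p 2]" "q = vec [q 1, q 2]"
    using PiE_vec_2 unfolding good_bidegrees_def bidegrees_def by auto
  have a: "(p a, q a) = (0, 2) \<or> (p a, q a) = (1, 1)" if "a \<in> {1..2}" for a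
    using L that unfolding good_bidegrees_def by auto
  have s: "p 1 + p 2 = p' + word_deg W" "q 1 + q 2 + 1 = q' + 2"
    using L unfolding good_bidegrees_def bidegrees_def by (auto simp: sum_1_2)
  have le: "p 1 \<le> 1" "p 2 \<le> 1" and q: "q 1 = 2 - p 1" "q 2 = 2 - p 2"
    using a[of 1] a[of 2] by auto
  have "q = vec [2 - p 1, 2 - p 2]" using p(2) unfolding q .
  moreover have "q' + (p 1 + p 2) = 3" using s le q by linarith
  ultimately show ?R using p(1) le s(1) by blast
next
  assume ?R
  then obtain x y where *: "x \<le> 1" "y \<le> 1" "p = vec [x, y]" "q = vec [2 - x, 2 - y]"
    "x + y = p' + word_deg W" "q' + (x + y) = 3" by blast
  have "(2 - x) + (2 - y) + 1 = q' + 2" using *(1,2,6) by linarith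
  then have "(p, q) \<in> bidegrees 2 W p' q'"
    unfolding bidegrees_def *(3,4) mem_Collect_eq case_prod_conv sum_1_2
    using vec_PiE(1)[of x y] vec_PiE(1)[of "2 - x" "2 - y"] *(5) by simp
  moreover have "x = 0 \<or> x = 1" "y = 0 \<or> y = 1" using *(1,2) by auto
  ultimately show ?L
    unfolding good_bidegrees_def atLeastAtMost_1_2 *(3,4) by auto
qed

text \<open>The only coloring of the word \<open>a b\<close>: the image of \<open>\<zeta>\<^sub>b\<close> starts where that of \<open>\<zeta>\<^sub>a\<close> ends.\<close>

definition stack :: "nat \<Rightarrow> (nat \<Rightarrow> nat) \<Rightarrow> nat \<Rightarrow> nat \<Rightarrow> nat" where
  "stack a p = (\<lambda>c\<in>{1..2}. \<lambda>i\<in>{..p c}. if c = a then i else p a + i)"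

lemma strict_mono_on_atMost_growth:
  fixes h :: "nat \<Rightarrow> nat"
  assumes "strict_mono_on {..m} h" "i \<le> j" "j \<le> m" shows "h i + (j - i) \<le> h j"
  using assms(2,3)
proof (induction j rule: dec_induct)
  case (step j)
  then have "h j < h (Suc j)" using strict_mono_onD[OF assms(1), of j "Suc j"] by simp
  with step show ?case by simp
qed simp

lemma word_deg_pair: "a \<noteq> b \<Longrightarrow> word_deg [a, b] = 0"
  by (simp add: word_deg_def)

text \<open>Uniqueness is a squeeze: \<open>\<zeta> a\<close> climbs by at least \<open>p a\<close>,
  then \<open>\<zeta> b\<close> starts no lower and climbs by at least \<open>p b\<close>, while the
  top is \<open>p a + p b\<close>. There is no slack, so all these inequalities are
  equalities.\<close>

lemma word_colorings_pair:
  assumes ab: "(a, b) = (1, 2) \<or> (a, b) = (2, 1)"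
  shows "word_colorings 2 [a, b] p = {stack a p}"
proof -
  have ne: "a \<noteq> b" and mem: "{1..2} = {a, b}" using ab by auto
  have P: "sum p {a, b} = p a + p b" using ne by simp
  have st: "stack a p a = (\<lambda>i\<in>{..p a}. i)" "stack a p b = (\<lambda>i\<in>{..p b}. p a + i)"
    using ne unfolding stack_def mem by auto
  have "\<zeta> = stack a p" if z: "\<zeta> \<in> word_colorings 2 [a, b] p" for \<zeta>
  proof -
    \<comment> \<open>The inequality along edges is a fact about quilts, so the word is completed to
      one.\<close>
    have T: "([a, b], edge_tree a b) \<in> Quilts 2" using edge_quilt[OF ab] .
    have z1: "\<zeta> \<in> (\<Pi>\<^sub>E c\<in>{a, b}. {..p c} \<rightarrow>\<^sub>E {..p a + p b})"
      and sm: "\<And>c. c \<in> {a, b} \<Longrightarrow> strict_mono_on {..p c} (\<zeta> c)"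
      using z unfolding word_colorings_def mem P word_deg_pair[OF ne] Let_def if_not_P[OF not_less0]
        minus_nat.diff_0 mem_Collect_eq by blast+
    have e: "\<zeta> a (p a) \<le> \<zeta> b 0"
      using word_coloring_edge[OF T z, of a b] by (simp add: edge_tree_def)
    have le: "\<zeta> b (p b) \<le> p a + p b"
      using PiE_mem[OF PiE_mem[OF z1, of b], of "p b"] by simp
    have "\<zeta> a i = i" if "i \<le> p a" for i
      using strict_mono_on_atMost_growth[OF sm, of a 0 i] strict_mono_on_atMost_growth[OF sm, of a i "p a"]
        strict_mono_on_atMost_growth[OF sm, of b 0 "p b"] e le that by simp
    moreover have "\<zeta> b i = p a + i" if "i \<le> p b" for i
      using strict_mono_on_atMost_growth[OF sm, of a 0 "p a"] strict_mono_on_atMost_growth[OF sm, of b 0 i]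
        strict_mono_on_atMost_growth[OF sm, of b i "p b"] e le that by simp
    ultimately have eq: "\<zeta> c i = stack a p c i" if "c \<in> {a, b}" for c i
      using that st PiE_arb[OF PiE_mem[OF z1 that], of i] by (cases "i \<le> p c") auto
    have "\<zeta> c = stack a p c" if "c \<notin> {a, b}" for c
      using that PiE_arb[OF z1 that] unfolding stack_def mem by simp
    with eq have "\<zeta> c = stack a p c" for c by (cases "c \<in> {a, b}") blast+
    then show ?thesis by (rule ext)
  qed
  moreover have "stack a p \<in> word_colorings 2 [a, b] p"
  proof -
    define \<pi> where "\<pi> = (\<lambda>c\<in>{a, b}. \<lambda>i\<in>{..p c}. if c = a then 0 else Suc 0)"
    have B0: "block [a, b] p (stack a p) \<pi> 0 = {0..p a}"
      unfolding block_def st by (auto simp: st \<pi>_def)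
    have shift: "(\<lambda>i. p a + i) ` {..p b} = {p a..p a + p b}"
      using image_add_atLeastAtMost[of "p a" 0 "p b"] by (simp add: atLeast0AtMost ac_simps)
    have B1: "block [a, b] p (stack a p) \<pi> (Suc 0) = {p a..p a + p b}"
      unfolding shift[symmetric] block_def using ne by (auto simp: st \<pi>_def)
    have pr: "is_projection 2 [a, b] p (stack a p) \<pi>"
      unfolding is_projection_def mem
    proof (intro conjI)
      show "\<pi> \<in> (\<Pi>\<^sub>E c\<in>{a, b}. {..p c} \<rightarrow>\<^sub>E {..<length [a, b]})"
        unfolding \<pi>_def by auto
      show "\<forall>c\<in>{a, b}. \<pi> c ` {..p c} = {j. j < length [a, b] \<and> [a, b] ! j = c}"
        using ne by (auto simp: \<pi>_def less_Suc_eq image_iff)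
      show "\<forall>j<length [a, b]. \<exists>l u. block [a, b] p (stack a p) \<pi> j = {l..u}"
        using B0 B1 by (auto simp: less_Suc_eq)
      show "\<forall>j. Suc j < length [a, b] \<longrightarrow>
        Max (block [a, b] p (stack a p) \<pi> j) = Min (block [a, b] p (stack a p) \<pi> (Suc j))"
      proof -
        have "Max {0..p a} = p a" "Min {p a..p a + p b} = p a"
          by (auto intro!: Max_eqI Min_eqI)
        then show ?thesis using B0 B1 by (auto simp: less_Suc_eq)
      qed
    qed
    have im: "stack a p a ` {..p a} = {..p a}" "stack a p b ` {..p b} = {p a..p a + p b}"
      unfolding shift[symmetric] by (auto simp: st)
    have PE: "stack a p \<in> (\<Pi>\<^sub>E c\<in>{a, b}. {..p c} \<rightarrow>\<^sub>E {..p a + p b})"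
      unfolding stack_def mem using ne by auto
    have sm: "\<forall>c\<in>{a, b}. strict_mono_on {..p c} (stack a p c)"
      by (auto simp: st intro!: strict_mono_onI)
    have un: "(\<Union>c\<in>{a, b}. stack a p c ` {..p c}) = {..p a + p b}"
      using im by auto
    show ?thesis
      unfolding word_colorings_def mem P word_deg_pair[OF ne] Let_def if_not_P[OF not_less0]
        minus_nat.diff_0 mem_Collect_eq
      using PE sm un pr by blast
  qed
  ultimately show ?thesis by blast
qed

lemma PiE_singleton_image: "(\<Pi>\<^sub>E e\<in>{x}. S e) = (\<lambda>i. \<lambda>e\<in>{x}. i) ` S x"
proof (intro equalityI subsetI)
  fix I assume I: "I \<in> (\<Pi>\<^sub>E e\<in>{x}. S e)"
  have "I = (\<lambda>e\<in>{x}. I x)" using PiE_arb[OF I] by auto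
  then show "I \<in> (\<lambda>i. \<lambda>e\<in>{x}. i) ` S x" using PiE_mem[OF I] by blast
qed (auto simp: PiE_def extensional_def)

lemma tree_colorings_edge_tree:
  "tree_colorings (edge_tree a b) q = (\<lambda>i. \<lambda>e\<in>{(a, b)}. i) ` {1..q a}"
proof -
  have left: "left_of (edge_tree a b) u v \<longleftrightarrow> False" for u v
    by (auto simp: edge_tree_def)
  have e: "edges (edge_tree a b) = {(a, b)}" by (simp add: edge_tree_def)
  show ?thesis
    unfolding tree_colorings_def left e PiE_singleton_image by simp
qed

lemma interposed_pair: "\<not> interposed [a, b] v"
  unfolding interposed_def by auto

lemma root_edge_tree:
  assumes "(a, b) = (1, 2) \<or> (a, b) = (2, 1)" shows "root 2 (edge_tree a b) = a"
proof (rule root_eqI[OF edge_tree_is_tree[OF assms]])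
  have "a \<noteq> b" using assms by auto
  then show "is_root {1..2} (edge_tree a b) a"
    unfolding is_root_def tle_edge_tree[OF \<open>a \<noteq> b\<close>] using assms by auto
qed

lemma children_edge_tree:
  assumes "a \<noteq> b"
  shows "children (edge_tree a b) a = [b]" "children (edge_tree a b) b = []"
  by (rule children_eqI; use assms in \<open>auto simp: edge_tree_def\<close>)+

text \<open>The value \<open>p a\<close> is taken by both \<open>\<zeta> a\<close> and
  \<open>\<zeta> b\<close>, but the letters of \<open>a\<close> stop at \<open>p a - 1\<close>, so a
  position from \<open>p a\<close> on can only carry a letter of \<open>b\<close>.\<close>

lemma vertical_word_pair:
  assumes ab: "(a, b) = (1, 2) \<or> (a, b) = (2, 1)"
  shows "vertical_word 2 [a, b] p (stack a p)
       = map (\<lambda>i. VLetter i a) [0..<p a] @ map (\<lambda>i. VLetter i b) [0..<p b]"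
proof -
  have ne: "a \<noteq> b" and mem: "{1..2} = {a, b}" using ab by auto
  have P: "sum p {a, b} = p a + p b" using ne by simp
  have st: "stack a p a = (\<lambda>i\<in>{..p a}. i)" "stack a p b = (\<lambda>i\<in>{..p b}. p a + i)"
    using ne unfolding stack_def mem by auto
  have the: "(THE l. \<exists>c i. l = VLetter i c \<and> c \<in> {a, b} \<and> i < p c \<and>
      (interposed [a, b] c \<longrightarrow> 1 \<le> i) \<and> stack a p c i = t)
    = (if t < p a then VLetter t a else VLetter (t - p a) b)" if "t < p a + p b" for t
    by (rule the_equality) (use that ne in \<open>auto simp: interposed_pair st\<close>)
  have "[0..<p a + p b] = [0..<p a] @ map (\<lambda>i. p a + i) [0..<p b]"
    using upt_add_eq_append[of 0 "p a" "p b"] map_add_upt[of "p a" "p b"] by (simp add: add.commute)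
  moreover have "vertical_word 2 [a, b] p (stack a p)
      = map (\<lambda>t. if t < p a then VLetter t a else VLetter (t - p a) b) [0..<p a + p b]"
    unfolding vertical_word_def mem P word_deg_pair[OF ne] minus_nat.diff_0
    by (rule map_cong[OF refl], rule the) simp
  ultimately show ?thesis by simp
qed

lemma horizontal_word_pair:
  assumes ab: "(a, b) = (1, 2) \<or> (a, b) = (2, 1)" and i: "1 \<le> i"
  shows "horizontal_word 2 (edge_tree a b) q (\<lambda>e\<in>{(a, b)}. i)
       = map (\<lambda>j. HLetter j a) [1..<i] @ map (\<lambda>j. HLetter j b) [1..<q b] @ map (\<lambda>j. HLetter j a) [i..<q a]"
proof -
  have ne: "a \<noteq> b" using ab by auto
  have w: "corner_word 2 (edge_tree a b) a = [a, b, a]"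
    by (simp add: numeral_2_eq_2 children_edge_tree[OF ne])
  let ?w = "[a, b, a]" and ?I = "\<lambda>e\<in>{(a, b)}. i"
  \<comment> \<open>The \<open>s\<close> equations give the cut points already passed at each of the
    three corners \<open>a b a\<close>; the \<open>e\<close> equations decide whether the vertex has
    a later corner.\<close>
  have s0: "{?I (?w ! 0, ?w ! Suc j) | j. j < 0 \<and> ?w ! j = ?w ! 0} = {}" by simp
  have s1: "{?I (?w ! 1, ?w ! Suc j) | j. j < 1 \<and> ?w ! j = ?w ! 1} = {}" using ne by simp
  have s2: "{?I (?w ! 2, ?w ! Suc j) | j. j < 2 \<and> ?w ! j = ?w ! 2} = {i}"
    using ne by (auto simp: less_Suc_eq numeral_2_eq_2 intro!: exI[of _ 0])
  have e0: "(\<exists>j. 0 < j \<and> j < length ?w \<and> ?w ! j = ?w ! 0) = True"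
    by (rule eqTrueI, rule exI[of _ 2]) simp
  have e1: "(\<exists>j. 1 < j \<and> j < length ?w \<and> ?w ! j = ?w ! 1) = False"
    using ne by (auto simp: less_Suc_eq)
  have e2: "(\<exists>j. 2 < j \<and> j < length ?w \<and> ?w ! j = ?w ! 2) = False" by auto
  have u: "[0..<length ?w] = [0, 1, 2]" by (simp add: upt_rec)
  show ?thesis
    unfolding horizontal_word_def root_edge_tree[OF ab] w Let_def u list.map concat.simps
      s0 s1 s2 e0 e1 e2
    using i by (simp add: max_def)
qed

lemma upt_1_3: "[1..<Suc 2] = [1, 2]" "[1..<Suc 3] = [1, 2, 3]"
  by (simp_all add: upt_rec)

lemma initial_word_2: "initial_word 2 p q =
   map (\<lambda>i. VLetter i 1) [0..<p 1] @ map (\<lambda>i. HLetter i 1) [1..<q 1] @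
   map (\<lambda>i. VLetter i 2) [0..<p 2] @ map (\<lambda>i. HLetter i 2) [1..<q 2]"
  unfolding initial_word_def upt_1_3 by simp

lemma quilt_sign_pair:
  assumes ab: "(a, b) = (1, 2) \<or> (a, b) = (2, 1)" and i: "1 \<le> i" and q: "1 \<le> q 1" "1 \<le> q 2"
  shows "quilt_sign 2 ([a, b], edge_tree a b) p q (stack a p) (\<lambda>e\<in>{(a, b)}. i) =
    permutation_sign
     (map (\<lambda>i. VLetter i 1) [0..<p 1] @ map (\<lambda>i. HLetter i 1) [1..<q 1] @
      map (\<lambda>i. VLetter i 2) [0..<p 2] @ map (\<lambda>i. HLetter i 2) [1..<q 2])
     (map (\<lambda>i. VLetter i a) [0..<p a] @ map (\<lambda>i. VLetter i b) [0..<p b] @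
      map (\<lambda>j. HLetter j a) [1..<i] @ map (\<lambda>j. HLetter j b) [1..<q b] @ map (\<lambda>j. HLetter j a) [i..<q a])"
proof -
  \<comment> \<open>Nothing is interposed, so no extension is applied and the first part of the
    shuffled word is empty.\<close>
  have f: "filter (\<lambda>a'. interposed [a, b] a' \<and> p a' = 0) [1..<Suc 2] = []"
    by (simp add: interposed_pair)
  have f': "filter (interposed [a, b]) (rev (down_order [a, b])) = []"
    by (simp add: interposed_pair)
  define q' where "q' = (\<lambda>a. if q a = 0 then 2 else q a)"
  have "q' 1 = q 1" "q' 2 = q 2" using q by (auto simp: q'_def)
  moreover from this have "q' a = q a" "q' b = q b" using ab by auto
  ultimately show ?thesis
    unfolding quilt_sign_def Let_def fst_conv snd_conv f fold_simps case_prod_conv shuffled_word_def f'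
      vertical_word_pair[OF ab] horizontal_word_pair[OF ab i] initial_word_2 q'_def[symmetric]
    by simp
qed

section \<open>Colorings and sign of the cherry quilt\<close>

lemma word_deg_cherry: "word_deg [1, 2, 3, 2::nat] = 1"
  by (simp add: word_deg_def card_insert_if)

lemma root_cherry_tree: "root 3 cherry_tree = 1"
proof (rule root_eqI[OF cherry_tree_is_tree])
  show "is_root {1..3} cherry_tree 1"
    unfolding is_root_def tle_cherry_tree by auto
qed

lemma left_of_cherry_tree: "left_of cherry_tree u v \<longleftrightarrow> u = 3 \<and> v = 2"
  by (auto simp: cherry_tree_def)

lemma children_cherry_tree:
  "children cherry_tree 1 = [3, 2]" "children cherry_tree 2 = []" "children cherry_tree 3 = []"
  by (rule children_eqI; auto simp: cherry_tree_def)+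

definition cherry_word_coloring :: "nat \<Rightarrow> nat \<Rightarrow> nat" where
  "cherry_word_coloring = (\<lambda>c\<in>{1..3}. \<lambda>i\<in>{..vec [0, 1, 1] c}. i)"

definition cherry_tree_coloring :: "nat \<times> nat \<Rightarrow> nat" where
  "cherry_tree_coloring = (\<lambda>e\<in>edges cherry_tree. if e = (1, 3) then 1 else 2)"

text \<open>The two children occupy distinct inputs in planar order, and a binary root leaves no
  choice.\<close>

lemma tree_colorings_cherry_tree:
  "q 1 = 2 \<Longrightarrow> tree_colorings cherry_tree q = {cherry_tree_coloring}"
proof (intro equalityI subsetI)
  assume q: "q 1 = 2"
  have e: "edges cherry_tree = {(1, 2), (1, 3)}" by (simp add: cherry_tree_def)
  fix I
  show "I \<in> {cherry_tree_coloring}" if I: "I \<in> tree_colorings cherry_tree q"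
  proof -
    have P: "I \<in> (\<Pi>\<^sub>E e\<in>edges cherry_tree. {1..q (fst e)})" and lt: "I (1, 3) < I (1, 2)"
      using I unfolding tree_colorings_def left_of_cherry_tree by (auto simp: e)
    have "I (1, 2) \<in> {1..2}" "I (1, 3) \<in> {1..2}"
      using PiE_mem[OF P, of "(1, 2)"] PiE_mem[OF P, of "(1, 3)"] q by (simp_all add: e)
    with lt have "I (1, 2) = 2" "I (1, 3) = 1" by auto
    then have "I x = cherry_tree_coloring x" for x
      using PiE_arb[OF P, of x] by (cases "x \<in> edges cherry_tree") (auto simp: cherry_tree_coloring_def e)
    then show ?thesis by blast
  qed
  show "I \<in> tree_colorings cherry_tree q" if "I \<in> {cherry_tree_coloring}"
    using that q unfolding tree_colorings_def left_of_cherry_tree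
    by (auto simp: cherry_tree_coloring_def e)
qed

lemma tree_colorings_cherry_tree_arity:
  assumes "I \<in> tree_colorings cherry_tree q" shows "2 \<le> q 1"
proof -
  have e: "edges cherry_tree = {(1, 2), (1, 3)}" by (simp add: cherry_tree_def)
  have P: "I \<in> (\<Pi>\<^sub>E e\<in>edges cherry_tree. {1..q (fst e)})" and lt: "I (1, 3) < I (1, 2)"
    using assms unfolding tree_colorings_def left_of_cherry_tree by (auto simp: e)
  have "I (1, 2) \<in> {1..q 1}" "I (1, 3) \<in> {1..q 1}"
    using PiE_mem[OF P, of "(1, 2)"] PiE_mem[OF P, of "(1, 3)"] by (simp_all add: e)
  with lt show ?thesis by auto
qed

text \<open>A strictly increasing map of \<open>{0, 1}\<close> into itself is the identity, which
  settles vertices 2 and 3; the edge from 1 to 2 then forces the value of vertex 1.\<close>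

lemma word_colorings_cherry:
  "word_colorings 3 [1, 2, 3, 2] (vec [0, 1, 1]) = {cherry_word_coloring}"
proof -
  let ?p = "vec [0, 1, 1]" and ?W = "[1, 2, 3, 2::nat]"
  have P: "sum ?p {1..3} - word_deg ?W = 1" "\<not> sum ?p {1..3} < word_deg ?W"
    unfolding word_deg_cherry by (simp_all add: sum_1_3)
  have "\<zeta> = cherry_word_coloring" if z: "\<zeta> \<in> word_colorings 3 ?W ?p" for \<zeta>
  proof -
    have z1: "\<zeta> \<in> (\<Pi>\<^sub>E c\<in>{1..3}. {..?p c} \<rightarrow>\<^sub>E {..1})"
      and sm: "\<And>c. c \<in> {1..3} \<Longrightarrow> strict_mono_on {..?p c} (\<zeta> c)"
      using z unfolding word_colorings_def P Let_def if_not_P[OF P(2)] mem_Collect_eq by blast+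
    have two: "\<zeta> c 0 = 0 \<and> \<zeta> c 1 = 1" if "c \<in> {2, 3}" for c
    proof -
      have c: "c \<in> {1..3}" "?p c = 1" using that by auto
      have "\<zeta> c 1 \<le> 1" using PiE_mem[OF PiE_mem[OF z1 c(1)], of 1] c(2) by simp
      with strict_mono_on_atMost_growth[OF sm[OF c(1)], of 0 1] c(2) show ?thesis by simp
    qed
    have "\<zeta> 1 0 \<le> \<zeta> 2 0"
      using word_coloring_edge[OF cherry_quilt_quilt[unfolded cherry_quilt_def] z, of 1 2]
      by (simp add: cherry_tree_def)
    with two[of 2] have one: "\<zeta> 1 0 = 0" by simp
    have "\<zeta> c i = cherry_word_coloring c i" if c: "c \<in> {1..3}" for c i
    proof (cases "i \<le> ?p c")
      case True
      have "c = 1 \<or> c \<in> {2, 3}" using c by auto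
      then have "\<zeta> c i = i"
      proof
        assume "c \<in> {2, 3}"
        moreover from this True have "i = 0 \<or> i = 1" by auto
        ultimately show ?thesis using two[of c] by auto
      qed (use True one in simp)
      then show ?thesis using c True by (simp add: cherry_word_coloring_def)
    next
      case False
      then show ?thesis using PiE_arb[OF PiE_mem[OF z1 c], of i] c
        by (simp add: cherry_word_coloring_def)
    qed
    moreover have "\<zeta> c = cherry_word_coloring c" if c: "c \<notin> {1..3}" for c
      using PiE_arb[OF z1 c] c by (auto simp: cherry_word_coloring_def)
    ultimately have "\<zeta> c = cherry_word_coloring c" for c by (cases "c \<in> {1..3}") blast+
    then show ?thesis by (rule ext)
  qed
  moreover have "cherry_word_coloring \<in> word_colorings 3 ?W ?p"
  proof -
    \<comment> \<open>Along \<open>1232\<close> the blocks are \<open>{0}\<close>,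
      \<open>{0}\<close>, \<open>{0, 1}\<close>, \<open>{1}\<close>: vertex 2 is split over its two
      occurrences and 3 bridges them.\<close>
    define \<pi> :: "nat \<Rightarrow> nat \<Rightarrow> nat" where "\<pi> = (\<lambda>c\<in>{1..3}. \<lambda>i\<in>{..?p c}. if c = 1 then 0 else if c = 3 then 2
        else if i = 0 then 1 else 3)"
    have c1: "cherry_word_coloring c = (\<lambda>i\<in>{..?p c}. i)" if "c \<in> {1, 2, 3}" for c
      using that unfolding cherry_word_coloring_def atLeastAtMost_1_3 by auto
    have \<pi>1: "\<pi> 1 = (\<lambda>i\<in>{..0}. 0)" "\<pi> 2 = (\<lambda>i\<in>{..1}. if i = 0 then 1 else 3)" "\<pi> 3 = (\<lambda>i\<in>{..1}. 2)"
      unfolding \<pi>_def by (auto simp: restrict_def)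
    have at: "{..1::nat} = {0, 1}" "{..0::nat} = {0}" by auto
    have B: "block ?W ?p cherry_word_coloring \<pi> 0 = {0..0}"
      "block ?W ?p cherry_word_coloring \<pi> 1 = {0..0}"
      "block ?W ?p cherry_word_coloring \<pi> 2 = {0..1}"
      "block ?W ?p cherry_word_coloring \<pi> 3 = {1..1}"
      unfolding block_def by (auto simp: c1 \<pi>1[simplified] image_iff le_Suc_eq)
    have lt4: "j < length ?W \<longleftrightarrow> j = 0 \<or> j = 1 \<or> j = 2 \<or> j = 3" for j by auto
    have pr: "is_projection 3 ?W ?p cherry_word_coloring \<pi>"
      unfolding is_projection_def
    proof (intro conjI)
      show "\<pi> \<in> (\<Pi>\<^sub>E c\<in>{1..3}. {..?p c} \<rightarrow>\<^sub>E {..<length ?W})"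
        unfolding \<pi>_def by auto
      show "\<forall>c\<in>{1..3}. \<pi> c ` {..?p c} = {j. j < length ?W \<and> ?W ! j = c}"
        unfolding atLeastAtMost_1_3 lt4 by (auto simp: \<pi>1[simplified] image_iff at[simplified])
      show "\<forall>j<length ?W. \<exists>l u. block ?W ?p cherry_word_coloring \<pi> j = {l..u}"
        unfolding lt4 using B by blast
      show "\<forall>j. Suc j < length ?W \<longrightarrow>
        Max (block ?W ?p cherry_word_coloring \<pi> j) = Min (block ?W ?p cherry_word_coloring \<pi> (Suc j))"
      proof (intro allI impI)
        fix j assume "Suc j < length ?W"
        then have "j = 0 \<or> j = 1 \<or> j = 2" by auto
        moreover have "Max {0..0::nat} = 0" "Max {0..1::nat} = 1" "Min {0..0::nat} = 0"
          "Min {0..1::nat} = 0" "Min {1..1::nat} = 1"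
          by (auto intro!: Max_eqI Min_eqI)
        ultimately show "Max (block ?W ?p cherry_word_coloring \<pi> j) = Min (block ?W ?p cherry_word_coloring \<pi> (Suc j))"
          using B by (elim disjE) (simp_all add: numeral_eq_Suc)
      qed
    qed
    have PE: "cherry_word_coloring \<in> (\<Pi>\<^sub>E c\<in>{1..3}. {..?p c} \<rightarrow>\<^sub>E {..1})"
    proof -
      have "?p c \<le> 1" if "c \<in> {1..3}" for c
        using that unfolding atLeastAtMost_1_3 by auto
      then show ?thesis
        unfolding cherry_word_coloring_def restrict_PiE_iff by (meson atMost_iff order_trans)
    qed
    have sm: "\<forall>c\<in>{1..3}. strict_mono_on {..?p c} (cherry_word_coloring c)"
      by (auto simp: cherry_word_coloring_def intro!: strict_mono_onI)
    have un: "(\<Union>c\<in>{1..3}. cherry_word_coloring c ` {..?p c}) = {..1}"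
      unfolding atLeastAtMost_1_3 by (auto simp: c1 at[simplified])
    show ?thesis
      unfolding word_colorings_def P(1) Let_def if_not_P[OF P(2)] mem_Collect_eq
      using PE sm un pr by blast
  qed
  ultimately show ?thesis by blast
qed

text \<open>Two children need two inputs, so vertex 1 has bidegree \<open>(0, 2)\<close>. Vertex 2
  occurs twice, so \<open>\<pi> 2\<close> needs two arguments and the bidegree is
  \<open>(1, 1)\<close>. Then \<open>\<zeta> 2\<close> takes two values, so
  \<open>p' \<ge> 1\<close>, and the count \<open>p 1 + p 2 + p 3 = p' + 1\<close> forces
  \<open>p 3 = 1\<close>.\<close>

lemma cherry_bidegree:
  assumes pq: "(p, q) \<in> good_bidegrees 3 [1, 2, 3, 2] p' q'"
    and z: "\<zeta> \<in> word_colorings 3 [1, 2, 3, 2] p" and I: "I \<in> tree_colorings cherry_tree q"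
  shows "p = vec [0, 1, 1] \<and> q = vec [2, 1, 1] \<and> p' = 1 \<and> q' = 2"
proof -
  have a: "(p a, q a) = (0, 2) \<or> (p a, q a) = (1, 1)" if "a \<in> {1..3}" for a
    using pq that unfolding good_bidegrees_def by auto
  have b: "p \<in> {1..3} \<rightarrow>\<^sub>E UNIV" "q \<in> {1..3} \<rightarrow>\<^sub>E UNIV"
    and s: "p 1 + (p 2 + p 3) = p' + 1" "q 1 + (q 2 + q 3) + 1 = q' + 3"
    using pq unfolding good_bidegrees_def bidegrees_def word_deg_cherry sum_1_3 by auto
  have 1: "p 1 = 0" "q 1 = 2" using a[of 1] tree_colorings_cherry_tree_arity[OF I] by auto
  obtain \<pi> where \<pi>: "is_projection 3 [1, 2, 3, 2] p \<zeta> \<pi>"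
    using z unfolding word_colorings_def by (auto simp: Let_def split: if_splits)
  then have im: "\<pi> 2 ` {..p 2} = {j. j < length [1, 2, 3, 2::nat] \<and> [1, 2, 3, 2] ! j = (2::nat)}"
    unfolding is_projection_def by auto
  have "1 \<in> \<pi> 2 ` {..p 2}" "3 \<in> \<pi> 2 ` {..p 2}" unfolding im by simp_all
  then have "p 2 \<noteq> 0" by (intro notI) auto
  then have 2: "p 2 = 1" "q 2 = 1" using a[of 2] by auto
  have P: "p 1 + (p 2 + p 3) - 1 = p'" using s by simp
  have zr: "\<zeta> \<in> (\<Pi>\<^sub>E c\<in>{1..3}. {..p c} \<rightarrow>\<^sub>E {..p'})" "strict_mono_on {..p 2} (\<zeta> 2)"
    using z unfolding word_colorings_def word_deg_cherry sum_1_3 P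
    by (auto simp: Let_def split: if_splits)
  have "\<zeta> 2 1 \<le> p'" using PiE_mem[OF PiE_mem[OF zr(1)], of 2 1] 2 by simp
  moreover have "\<zeta> 2 0 < \<zeta> 2 1" using strict_mono_onD[OF zr(2), of 0 1] 2 by simp
  ultimately have "p' \<noteq> 0" by simp
  then have 3: "p 3 = 1" "q 3 = 1" using a[of 3] s(1) 1 2 by auto
  have "p' = 1" "q' = 2" using s 1 2 3 by linarith+
  moreover have "p = vec [0, 1, 1]" "q = vec [2, 1, 1]"
    using PiE_vec_3[OF b(1)] PiE_vec_3[OF b(2)] unfolding 1 2 3 .
  ultimately show ?thesis by blast
qed

lemma interposed_cherry: "interposed [1, 2, 3, 2] v \<longleftrightarrow> v = 3"
proof
  let ?W = "[1, 2, 3, 2::nat]"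
  assume "interposed ?W v"
  then obtain j k where jk: "Suc j < k" "k < length ?W" "?W ! Suc j = v" "?W ! k = ?W ! j"
    unfolding interposed_def by blast
  then have "j = 0 \<and> (k = 2 \<or> k = 3) \<or> j = 1 \<and> k = 3" by auto
  with jk(3,4) show "v = 3" by auto
next
  show "v = 3 \<Longrightarrow> interposed [1, 2, 3, 2] v"
    unfolding interposed_def by (intro exI[of _ 1] exI[of _ 3]) simp
qed

lemma vertical_word_cherry:
  "vertical_word 3 [1, 2, 3, 2] (vec [0, 1, 1]) cherry_word_coloring = [VLetter 0 2]"
proof -
  have the: "(THE l. \<exists>c i. l = VLetter i c \<and> c \<in> {1..3} \<and> i < vec [0, 1, 1] c \<and>
      (c = 3 \<longrightarrow> 1 \<le> i) \<and> cherry_word_coloring c i = 0) = VLetter 0 2"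
  proof (rule the_equality)
    show "\<exists>c i. VLetter 0 2 = VLetter i c \<and> c \<in> {1..3} \<and> i < vec [0, 1, 1] c \<and>
      (c = 3 \<longrightarrow> 1 \<le> i) \<and> cherry_word_coloring c i = 0"
      by (intro exI[of _ 2] exI[of _ 0]) (simp add: cherry_word_coloring_def)
  next
    fix l assume "\<exists>c i. l = VLetter i c \<and> c \<in> {1..3} \<and> i < vec [0, 1, 1] c \<and>
      (c = 3 \<longrightarrow> 1 \<le> i) \<and> cherry_word_coloring c i = 0"
    then obtain c i where c: "l = VLetter i c" "c \<in> {1..3}" "i < vec [0, 1, 1] c"
      "c = 3 \<longrightarrow> 1 \<le> i" by blast
    from c(2) have "c = 1 \<or> c = 2 \<or> c = 3" by auto
    then show "l = VLetter 0 2" using c by auto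
  qed
  have u: "[0..<sum (vec [0, 1, 1]) {1..3} - word_deg [1, 2, 3, 2]] = [0]"
    by (simp add: word_deg_cherry[simplified] sum_1_3)
  show ?thesis unfolding vertical_word_def interposed_cherry u list.map the ..
qed

text \<open>At the three corners of 1 in \<open>13121\<close> the letter ranges are
  \<open>[1..<1]\<close>, \<open>[1..<2]\<close> and \<open>[2..<2]\<close>, so the single letter of
  1 sits between the children; 2 and 3 have none.\<close>

lemma horizontal_word_cherry:
  assumes q: "q 1 = 2" "q 2 = 1" "q 3 = 1"
  shows "horizontal_word 3 cherry_tree q cherry_tree_coloring = [HLetter 1 1]"
proof -
  let ?w = "[1, 3, 1, 2, 1::nat]" and ?I = cherry_tree_coloring
  have w: "corner_word 3 cherry_tree 1 = ?w"
    using children_cherry_tree by (simp add: numeral_3_eq_3)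
  have I: "?I (1, 3) = 1" "?I (1, 2) = 2" by (simp_all add: cherry_tree_coloring_def cherry_tree_def)
  \<comment> \<open>Index sets and existential conditions are rewritten as filtered lists, which the
    simplifier can enumerate.\<close>
  have set_eq: "{?I (a, ?w ! Suc j) | j. j < k \<and> ?w ! j = a}
      = (\<lambda>j. ?I (a, ?w ! Suc j)) ` set (filter (\<lambda>j. ?w ! j = a) [0..<k])" for a k
    by auto
  have ex_eq: "(\<exists>j. k < j \<and> j < length ?w \<and> ?w ! j = a) \<longleftrightarrow> filter (\<lambda>j. ?w ! j = a) [Suc k..<5] \<noteq> []"
    for a k
  proof -
    have l: "length ?w = 5" by simp
    show ?thesis unfolding l filter_empty_conv set_upt Ball_def atLeastLessThan_iff Suc_le_eq by blast
  qed
  have u: "[0..<length ?w] = [0, 1, 2, 3, 4]" by (simp add: upt_rec)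
  have iv: "[0..<0] = ([] :: nat list)" "[0..<1] = [0::nat]" "[0..<2] = [0, 1::nat]" "[0..<3] = [0, 1, 2::nat]"
    "[0..<4] = [0, 1, 2, 3::nat]" "[Suc 0..<5] = [1, 2, 3, 4]" "[Suc 1..<5] = [2, 3, 4]"
    "[Suc 2..<5] = [3, 4]" "[Suc 3..<5] = [4]" "[Suc 4..<5] = []"
    by (simp_all add: upt_rec)
  have iv': "[Suc 0..<2] = [1]" by (simp add: upt_rec)
  have n: "?w ! 0 = 1" "?w ! 1 = 3" "?w ! 2 = 1" "?w ! 3 = 2" "?w ! 4 = 1"
    "?w ! Suc 0 = 3" "?w ! Suc 1 = 1" "?w ! Suc 2 = 2" "?w ! Suc 3 = 1"
    by simp_all
  show ?thesis
    unfolding horizontal_word_def root_cherry_tree w Let_def u set_eq ex_eq list.map concat.simps iv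
      filter.simps n
    by (simp add: n[simplified] I[simplified] q[simplified] iv')
qed

text \<open>The letter of the interposed 3 comes first, then that of 2, then that of 1: exactly the
  reverse of the initial word.\<close>

lemma quilt_sign_cherry:
  "quilt_sign 3 cherry_quilt (vec [0, 1, 1]) (vec [2, 1, 1]) cherry_word_coloring cherry_tree_coloring = - 1"
proof -
  let ?W = "[1, 2, 3, 2::nat]" and ?p = "vec [0, 1, 1]"
  have f: "filter (\<lambda>a. interposed ?W a \<and> ?p a = 0) [1..<Suc 3] = []"
    unfolding interposed_cherry upt_1_3 by simp
  have f': "filter (interposed ?W) (rev (down_order ?W)) = [3]"
    unfolding interposed_cherry[abs_def] by (simp add: down_order_def)
  define q' where "q' = (\<lambda>a. if vec [2, 1, 1] a = 0 then 2 else vec [2, 1, 1] a)"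
  have q': "q' 1 = 2" "q' 2 = 1" "q' 3 = 1" by (simp_all add: q'_def)
  have init: "initial_word 3 ?p q' = [HLetter 1 1, VLetter 0 2, VLetter 0 3]"
    using q' unfolding initial_word_def upt_1_3 by (simp add: upt_rec)
  show ?thesis
    unfolding quilt_sign_def cherry_quilt_def Let_def fst_conv snd_conv f fold_simps case_prod_conv
      shuffled_word_def f' vertical_word_cherry q'_def[symmetric] horizontal_word_cherry[OF q'] init
    by (simp add: permutation_sign_swap_3)
qed

section \<open>Colored composites along the small trees\<close>

lemma pull_cong: "(\<And>i. i \<le> p \<Longrightarrow> \<zeta> i = \<xi> i) \<Longrightarrow> pull C p \<zeta> \<phi> = pull C p \<xi> \<phi>"
  unfolding pull_def by simp

lemma child_at_edge_tree:
  assumes "a \<noteq> b"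
  shows "child_at (edge_tree a b) (\<lambda>e\<in>{(a, b)}. i) a j = (if j = i then Some b else None)"
    "child_at (edge_tree a b) (\<lambda>e\<in>{(a, b)}. i) b j = None"
  using assms unfolding child_at_def by (auto simp: edge_tree_def)

lemma input_width_edge_tree:
  assumes "a \<noteq> b"
  shows "input_width (edge_tree a b) (\<lambda>e\<in>{(a, b)}. i) q a j = (if j = i then q b else 1)"
    "input_width (edge_tree a b) (\<lambda>e\<in>{(a, b)}. i) q b j = 1"
proof -
  have "subtree (edge_tree a b) b = {b}" unfolding tle_edge_tree[OF assms] using assms by auto
  then show "input_width (edge_tree a b) (\<lambda>e\<in>{(a, b)}. i) q a j = (if j = i then q b else 1)"
    unfolding input_width_def child_at_edge_tree[OF assms] by simp
  show "input_width (edge_tree a b) (\<lambda>e\<in>{(a, b)}. i) q b j = 1"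
    unfolding input_width_def child_at_edge_tree[OF assms] by simp
qed

text \<open>Both levels of \<open>subtree_action\<close> are unfolded once, uniformly in the
  bidegrees and in \<open>i\<close>, so that each concrete case below is a matter of
  simplification.\<close>

lemma coloring_action_edge_tree:
  assumes ab: "(a, b) = (1, 2) \<or> (a, b) = (2, 1)"
  shows "coloring_action C A 2 (edge_tree a b) (\<lambda>e\<in>{(a, b)}. i) p q (stack a p) f \<phi> as =
    act A (seg C \<phi> 0 0) (f a (pull C (p a) (\<lambda>j. j) \<phi>)
     (map (\<lambda>j. let xs = take (if j = i then q b else 1) (drop (\<Sum>k=1..<j. if k = i then q b else 1) as)
        in case (if j = i then Some b else None) of
             None \<Rightarrow> act A (seg C \<phi> (p a) (length (snd \<phi>))) (hd xs)
           | Some b \<Rightarrow> act A (seg C \<phi> (p a) (p a)) (f b (pull C (p b) (\<lambda>j. p a + j) \<phi>)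
               (map (\<lambda>j. act A (seg C \<phi> (p a + p b) (length (snd \<phi>)))
                  (hd (take 1 (drop (\<Sum>k=1..<j. 1) xs)))) [1..<Suc (q b)])))
       [1..<Suc (q a)]))"
proof -
  have ne: "a \<noteq> b" and mem: "{1..2} = {a, b}" using ab by auto
  have st: "stack a p a = (\<lambda>i\<in>{..p a}. i)" "stack a p b = (\<lambda>i\<in>{..p b}. p a + i)"
    using ne unfolding stack_def mem by auto
  have pl: "pull C (p a) (stack a p a) \<phi> = pull C (p a) (\<lambda>j. j) \<phi>"
    "pull C (p b) (stack a p b) \<phi> = pull C (p b) (\<lambda>j. p a + j) \<phi>"
    unfolding st by (auto intro: pull_cong)
  have st': "stack a p a (p a) = p a" "stack a p b 0 = p a" "stack a p b (p b) = p a + p b"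
    "stack a p a 0 = 0" unfolding st by simp_all
  let ?T = "edge_tree a b" and ?I = "\<lambda>e\<in>{(a, b)}. i"
  have leaf: "subtree_action (Suc 0) C A ?T ?I p q (stack a p) f \<phi> b xs =
      f b (pull C (p b) (\<lambda>j. p a + j) \<phi>)
        (map (\<lambda>j. act A (seg C \<phi> (p a + p b) (length (snd \<phi>)))
                  (hd (take 1 (drop (\<Sum>k=1..<j. 1) xs)))) [1..<Suc (q b)])" for xs
    unfolding subtree_action.simps child_at_edge_tree[OF ne] input_width_edge_tree[OF ne] pl st'
      Let_def option.case ..
  have "subtree_action 2 C A ?T ?I p q (stack a p) f \<phi> a as = f a (pull C (p a) (\<lambda>j. j) \<phi>)
     (map (\<lambda>j. let xs = take (if j = i then q b else 1) (drop (\<Sum>k=1..<j. if k = i then q b else 1) as)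
        in case (if j = i then Some b else None) of
             None \<Rightarrow> act A (seg C \<phi> (p a) (length (snd \<phi>))) (hd xs)
           | Some b' \<Rightarrow> act A (seg C \<phi> (p a) (stack a p b' 0))
               (subtree_action (Suc 0) C A ?T ?I p q (stack a p) f \<phi> b' xs))
       [1..<Suc (q a)])"
    unfolding numeral_2_eq_2 subtree_action.simps(2)[of "Suc 0"] child_at_edge_tree[OF ne]
      input_width_edge_tree[OF ne] pl st' ..
  also have "\<dots> = f a (pull C (p a) (\<lambda>j. j) \<phi>)
     (map (\<lambda>j. let xs = take (if j = i then q b else 1) (drop (\<Sum>k=1..<j. if k = i then q b else 1) as)
        in case (if j = i then Some b else None) of
             None \<Rightarrow> act A (seg C \<phi> (p a) (length (snd \<phi>))) (hd xs)
           | Some b \<Rightarrow> act A (seg C \<phi> (p a) (p a)) (f b (pull C (p b) (\<lambda>j. p a + j) \<phi>)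
               (map (\<lambda>j. act A (seg C \<phi> (p a + p b) (length (snd \<phi>)))
                  (hd (take 1 (drop (\<Sum>k=1..<j. 1) xs)))) [1..<Suc (q b)])))
       [1..<Suc (q a)])"
    by (intro arg_cong[where f="f a (pull C (p a) (\<lambda>j. j) \<phi>)"] map_cong refl)
       (simp only: leaf st' Let_def option.case simp_thms split: if_split)
  finally show ?thesis
    unfolding coloring_action_def root_edge_tree[OF ab] Let_def st' by simp
qed

context algebra_diagram
begin

lemma strings_0: "\<phi> \<in> strings C 0 \<longleftrightarrow> (\<exists>x\<in>Obj C. \<phi> = (x, []))"
  unfolding strings_def by (cases \<phi>) auto

lemma strings_1: "\<phi> \<in> strings C 1 \<longleftrightarrow> (\<exists>\<psi>\<in>Mor C. \<phi> = (Tgt C \<psi>, [\<psi>]))"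
proof
  assume "\<phi> \<in> strings C 1"
  then show "\<exists>\<psi>\<in>Mor C. \<phi> = (Tgt C \<psi>, [\<psi>])"
    unfolding strings_def by (cases \<phi>) (auto simp: length_Suc_conv vtx_def)
qed (auto simp: strings_def vtx_def tgt_obj)

lemma strings_2:
  "\<phi> \<in> strings C 2 \<longleftrightarrow>
    (\<exists>\<psi>\<in>Mor C. \<exists>\<chi>\<in>Mor C. Src C \<psi> = Tgt C \<chi> \<and> \<phi> = (Tgt C \<psi>, [\<psi>, \<chi>]))"
proof
  assume "\<phi> \<in> strings C 2"
  then show "\<exists>\<psi>\<in>Mor C. \<exists>\<chi>\<in>Mor C. Src C \<psi> = Tgt C \<chi> \<and> \<phi> = (Tgt C \<psi>, [\<psi>, \<chi>])"
    unfolding strings_def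
    by (cases \<phi>) (auto simp: length_Suc_conv vtx_def numeral_2_eq_2 All_less_Suc2)
qed (auto simp: strings_def vtx_def tgt_obj less_Suc_eq numeral_2_eq_2)

lemma seg_0: "seg C (x, \<psi>s) 0 0 = Ident C x"
  by (simp add: seg_def vtx_def)

lemma seg_1: "\<psi> \<in> Mor C \<Longrightarrow> seg C (x, \<psi> # \<psi>s) 0 1 = \<psi>"
  "\<psi> \<in> Mor C \<Longrightarrow> seg C (x, \<psi> # \<psi>s) 1 1 = Ident C (Src C \<psi>)"
  by (simp_all add: seg_def vtx_def ident_right)

lemma seg_2: assumes "\<psi> \<in> Mor C" "\<chi> \<in> Mor C"
  shows "seg C (x, [\<psi>, \<chi>]) 1 2 = \<chi>" "seg C (x, [\<psi>, \<chi>]) 2 2 = Ident C (Src C \<chi>)"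
    "seg C (x, [\<psi>, \<chi>]) 0 2 = Comp C \<psi> \<chi>"
  using assms by (simp_all add: seg_def vtx_def ident_right upt_rec numeral_2_eq_2)

lemmas seg_simps = seg_0 seg_1 seg_1[unfolded One_nat_def] seg_2 seg_2[unfolded One_nat_def]

lemma cochain_02:
  "\<lbrakk>f \<in> cochains R C A 0 2; x \<in> Obj C\<rbrakk> \<Longrightarrow> f (x, []) \<in> multilinear R 2 (alg A x) (alg A x)"
  using bspec[of "strings C 0" "\<lambda>\<phi>. f \<phi> \<in> multilinear R 2 (alg A (vtx C \<phi> 0)) (alg A (vtx C \<phi> 0))" "(x, [])"]
  unfolding cochains_def by (simp add: strings_0 vtx_def)

lemma cochain_11:
  "\<lbrakk>f \<in> cochains R C A 1 1; \<psi> \<in> Mor C\<rbrakk>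
    \<Longrightarrow> f (Tgt C \<psi>, [\<psi>]) \<in> multilinear R 1 (alg A (Src C \<psi>)) (alg A (Tgt C \<psi>))"
  using bspec[of "strings C 1" "\<lambda>\<phi>. f \<phi> \<in> multilinear R 1 (alg A (vtx C \<phi> 1)) (alg A (vtx C \<phi> 0))"
      "(Tgt C \<psi>, [\<psi>])"] strings_1[of "(Tgt C \<psi>, [\<psi>])"]
  unfolding cochains_def by (auto simp: vtx_def)

lemma cochain_02_closed:
  "\<lbrakk>f \<in> cochains R C A 0 2; x \<in> Obj C; u \<in> carrier (alg A x); v \<in> carrier (alg A x)\<rbrakk>
    \<Longrightarrow> f (x, []) [u, v] \<in> carrier (alg A x)"
  by (rule multilinear_closed[OF cochain_02]) (auto simp: tuples_def)

lemma cochain_11_closed: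
  "\<lbrakk>f \<in> cochains R C A 1 1; \<psi> \<in> Mor C; u \<in> carrier (alg A (Src C \<psi>))\<rbrakk>
    \<Longrightarrow> f (Tgt C \<psi>, [\<psi>]) [u] \<in> carrier (alg A (Tgt C \<psi>))"
  by (rule multilinear_closed[OF cochain_11]) (auto simp: tuples_def)

lemma upt_simps: "[1..<Suc 1] = [1]" "[1..<2] = [1]" "[1..<Suc 2] = [1, 2]" "{1..<1::nat} = {}" "{1..<2::nat} = {1}"
  by (auto simp: upt_rec)

context
  fixes a b :: nat and p q :: "nat \<Rightarrow> nat" and f :: "nat \<Rightarrow> ('o, 'm, 'a) cochain"
  assumes ab: "(a, b) = (1, 2) \<or> (a, b) = (2, 1)"
    and fa: "f a \<in> cochains R C A (p a) (q a)" and fb: "f b \<in> cochains R C A (p b) (q b)"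
begin

lemma edge_action_02_02:
  assumes "p a = 0" "p b = 0" "q a = 2" "q b = 2"
    and "x \<in> Obj C" "u \<in> carrier (alg A x)" "v \<in> carrier (alg A x)" "w \<in> carrier (alg A x)"
  shows "coloring_action C A 2 (edge_tree a b) (\<lambda>e\<in>{(a, b)}. 1) p q (stack a p) f (x, []) [u, v, w]
      = f a (x, []) [f b (x, []) [u, v], w]"
    "coloring_action C A 2 (edge_tree a b) (\<lambda>e\<in>{(a, b)}. 2) p q (stack a p) f (x, []) [u, v, w]
      = f a (x, []) [u, f b (x, []) [v, w]]"
  using assms fa fb unfolding coloring_action_edge_tree[OF ab]
  by (simp_all add: upt_simps[simplified] seg_simps pull_def vtx_def act_ident cochain_02_closed)

lemma edge_action_02_11:
  assumes "p a = 0" "p b = 1" "q a = 2" "q b = 1"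
    and "\<psi> \<in> Mor C" "u \<in> carrier (alg A (Src C \<psi>))" "v \<in> carrier (alg A (Src C \<psi>))"
  shows "coloring_action C A 2 (edge_tree a b) (\<lambda>e\<in>{(a, b)}. 1) p q (stack a p) f (Tgt C \<psi>, [\<psi>]) [u, v]
      = f a (Tgt C \<psi>, []) [f b (Tgt C \<psi>, [\<psi>]) [u], act A \<psi> v]"
    "coloring_action C A 2 (edge_tree a b) (\<lambda>e\<in>{(a, b)}. 2) p q (stack a p) f (Tgt C \<psi>, [\<psi>]) [u, v]
      = f a (Tgt C \<psi>, []) [act A \<psi> u, f b (Tgt C \<psi>, [\<psi>]) [v]]"
  using assms fa fb unfolding coloring_action_edge_tree[OF ab]
  by (simp_all add: upt_simps[simplified] seg_simps pull_def vtx_def act_ident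
      cochain_02_closed cochain_11_closed[unfolded One_nat_def] act_closed src_obj tgt_obj)

lemma edge_action_11_02:
  assumes "p a = 1" "p b = 0" "q a = 1" "q b = 2"
    and "\<psi> \<in> Mor C" "u \<in> carrier (alg A (Src C \<psi>))" "v \<in> carrier (alg A (Src C \<psi>))"
  shows "coloring_action C A 2 (edge_tree a b) (\<lambda>e\<in>{(a, b)}. 1) p q (stack a p) f (Tgt C \<psi>, [\<psi>]) [u, v]
      = f a (Tgt C \<psi>, [\<psi>]) [f b (Src C \<psi>, []) [u, v]]"
  using assms fa fb unfolding coloring_action_edge_tree[OF ab]
  by (simp add: upt_simps[simplified] seg_simps pull_def vtx_def act_ident
      cochain_02_closed cochain_11_closed[unfolded One_nat_def] act_closed src_obj tgt_obj)

lemma edge_action_11_11: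
  assumes "p a = 1" "p b = 1" "q a = 1" "q b = 1"
    and "\<psi> \<in> Mor C" "\<chi> \<in> Mor C" "Src C \<psi> = Tgt C \<chi>" "u \<in> carrier (alg A (Src C \<chi>))"
  shows "coloring_action C A 2 (edge_tree a b) (\<lambda>e\<in>{(a, b)}. 1) p q (stack a p) f (Tgt C \<psi>, [\<psi>, \<chi>]) [u]
      = f a (Tgt C \<psi>, [\<psi>]) [f b (Tgt C \<chi>, [\<chi>]) [u]]"
  using assms fa fb unfolding coloring_action_edge_tree[OF ab]
  by (simp add: upt_simps[simplified] seg_simps pull_def vtx_def act_ident
      cochain_02_closed cochain_11_closed[unfolded One_nat_def] act_closed src_obj tgt_obj
      numeral_2_eq_2[symmetric])

end

lemma cherry_action:
  assumes f: "f 1 \<in> cochains R C A 0 2" "f 2 \<in> cochains R C A 1 1" "f 3 \<in> cochains R C A 1 1"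
    and "\<psi> \<in> Mor C" "u \<in> carrier (alg A (Src C \<psi>))" "v \<in> carrier (alg A (Src C \<psi>))"
  shows "coloring_action C A 3 cherry_tree cherry_tree_coloring (vec [0, 1, 1]) (vec [2, 1, 1])
      cherry_word_coloring f (Tgt C \<psi>, [\<psi>]) [u, v]
      = f 1 (Tgt C \<psi>, []) [f 3 (Tgt C \<psi>, [\<psi>]) [u], f 2 (Tgt C \<psi>, [\<psi>]) [v]]"
proof -
  let ?T = cherry_tree and ?I = cherry_tree_coloring and ?p = "vec [0, 1, 1]" and ?q = "vec [2, 1, 1]"
  let ?\<zeta> = cherry_word_coloring and ?\<phi> = "(Tgt C \<psi>, [\<psi>])"
  have e: "edges ?T = {(1, 2), (1, 3)}" by (simp add: cherry_tree_def)
  have I: "?I (1, 3) = 1" "?I (1, 2) = 2" by (simp_all add: cherry_tree_coloring_def e)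
  have ch: "child_at ?T ?I 1 1 = Some 3" "child_at ?T ?I 1 2 = Some 2"
  proof -
    have "(1, b) \<in> edges ?T \<and> ?I (1, b) = 1 \<longleftrightarrow> b = 3" "(1, b) \<in> edges ?T \<and> ?I (1, b) = 2 \<longleftrightarrow> b = 2" for b
      using I by (auto simp: e)
    then show "child_at ?T ?I 1 1 = Some 3" "child_at ?T ?I 1 2 = Some 2"
      unfolding child_at_def by simp_all
  qed
  have ch': "child_at ?T ?I 2 j = None" "child_at ?T ?I 3 j = None" for j
    unfolding child_at_def by (auto simp: e)
  have ab: "subtree ?T 2 = {2}" "subtree ?T 3 = {3}"
    unfolding tle_cherry_tree by auto
  have w: "input_width ?T ?I ?q 1 1 = 1" "input_width ?T ?I ?q 1 2 = 1"
    "input_width ?T ?I ?q 2 j = 1" "input_width ?T ?I ?q 3 j = 1" for j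
    unfolding input_width_def ch ch' by (simp_all add: ab)
  have z: "?\<zeta> 1 0 = 0" "?\<zeta> 2 0 = 0" "?\<zeta> 3 0 = 0" "?\<zeta> 2 1 = 1" "?\<zeta> 3 1 = 1"
    by (simp_all add: cherry_word_coloring_def)
  note simps = upt_simps[simplified] seg_simps[simplified] pull_def vtx_def z[simplified] w[simplified] ch[simplified] ch'
  have leaf: "subtree_action (Suc k) C A ?T ?I ?p ?q ?\<zeta> f ?\<phi> c [y] = f c ?\<phi> [y]"
    if "c = 2 \<or> c = 3" "y \<in> carrier (alg A (Src C \<psi>))" for c k y
    using that assms(4) by (elim disjE) (simp_all add: simps act_ident src_obj)
  \<comment> \<open>Only the root level is unfolded; the children are left to \<open>leaf\<close>,
    which holds for any positive depth bound.\<close>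
  have root: "subtree_action (Suc (Suc (Suc 0))) C A ?T ?I ?p ?q ?\<zeta> f ?\<phi> 1 [u, v]
      = f 1 (Tgt C \<psi>, []) [act A (Ident C (Tgt C \<psi>)) (subtree_action (Suc (Suc 0)) C A ?T ?I ?p ?q ?\<zeta> f ?\<phi> 3 [u]),
          act A (Ident C (Tgt C \<psi>)) (subtree_action (Suc (Suc 0)) C A ?T ?I ?p ?q ?\<zeta> f ?\<phi> 2 [v])]"
    by (subst subtree_action.simps(2)) (simp add: simps del: subtree_action.simps)
  have g: "f c (Tgt C \<psi>, [\<psi>]) [y] \<in> carrier (alg A (Tgt C \<psi>))"
    if "c = 2 \<or> c = 3" "y \<in> carrier (alg A (Src C \<psi>))" for c y
    using that f(2,3) assms(4) cochain_11_closed by blast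
  have eq: "subtree_action (Suc (Suc (Suc 0))) C A ?T ?I ?p ?q ?\<zeta> f ?\<phi> 1 [u, v]
      = f 1 (Tgt C \<psi>, []) [f 3 ?\<phi> [u], f 2 ?\<phi> [v]]"
    unfolding root leaf[OF disjI2[OF refl] assms(5)] leaf[OF disjI1[OF refl] assms(6)]
    using g assms(4-6) by (simp add: act_ident tgt_obj)
  show ?thesis
    unfolding coloring_action_def root_cherry_tree Let_def eq[folded numeral_3_eq_3] z seg_0
    using g assms by (simp add: act_ident tgt_obj cochain_02_closed)
qed

end

section \<open>Values of the two-vertex operations\<close>

context abelian_group
begin

lemma finsum_one: "f x \<in> carrier G \<Longrightarrow> finsum G f {x} = f x"
  using finsum_insert[of "{}" x f] by simp

lemma finsum_two:
  "\<lbrakk>f x \<in> carrier G; f y \<in> carrier G; x \<noteq> y\<rbrakk> \<Longrightarrow> finsum G f {x, y} = f x \<oplus> f y"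
  using finsum_insert[of "{y}" x f] finsum_one[of f y] by simp

lemma add_pow_pm1: "x \<in> carrier G \<Longrightarrow> [(1::int)] \<cdot> x = x" "x \<in> carrier G \<Longrightarrow> [(- 1::int)] \<cdot> x = \<ominus> x"
  using add.int_pow_1 add.int_pow_neg[of x 1] by simp_all

end

lemma quilt_B_edge_tree: "quilt_B = ([1, 2], edge_tree 1 2)"
  and quilt_B'_edge_tree: "quilt_B' = ([2, 1], edge_tree 2 1)"
  by (simp_all add: quilt_B_def quilt_B'_def edge_tree_def)

text \<open>In these bidegrees every vertex has exactly one letter, vertical in bidegree
  \<open>(1, 1)\<close> and horizontal in \<open>(0, 2)\<close>. The sign is therefore -1 precisely
  when the two letters are exchanged.\<close>

lemma quilt_sign_B:
  "quilt_sign 2 ([1, 2], edge_tree 1 2) (vec [0, 0]) (vec [2, 2]) (stack 1 (vec [0, 0])) (\<lambda>e\<in>{(1, 2)}. 1) = - 1"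
  "quilt_sign 2 ([1, 2], edge_tree 1 2) (vec [0, 0]) (vec [2, 2]) (stack 1 (vec [0, 0])) (\<lambda>e\<in>{(1, 2)}. 2) = 1"
  "quilt_sign 2 ([1, 2], edge_tree 1 2) (vec [0, 1]) (vec [2, 1]) (stack 1 (vec [0, 1])) (\<lambda>e\<in>{(1, 2)}. 1) = - 1"
  "quilt_sign 2 ([1, 2], edge_tree 1 2) (vec [0, 1]) (vec [2, 1]) (stack 1 (vec [0, 1])) (\<lambda>e\<in>{(1, 2)}. 2) = - 1"
  "quilt_sign 2 ([1, 2], edge_tree 1 2) (vec [1, 0]) (vec [1, 2]) (stack 1 (vec [1, 0])) (\<lambda>e\<in>{(1, 2)}. 1) = 1"
  "quilt_sign 2 ([1, 2], edge_tree 1 2) (vec [1, 1]) (vec [1, 1]) (stack 1 (vec [1, 1])) (\<lambda>e\<in>{(1, 2)}. 1) = 1"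
  by (subst quilt_sign_pair; simp add: upt_rec permutation_sign_refl permutation_sign_swap_2)+

lemma quilt_sign_B':
  "quilt_sign 2 ([2, 1], edge_tree 2 1) (vec [0, 0]) (vec [2, 2]) (stack 2 (vec [0, 0])) (\<lambda>e\<in>{(2, 1)}. 1) = 1"
  "quilt_sign 2 ([2, 1], edge_tree 2 1) (vec [0, 0]) (vec [2, 2]) (stack 2 (vec [0, 0])) (\<lambda>e\<in>{(2, 1)}. 2) = - 1"
  "quilt_sign 2 ([2, 1], edge_tree 2 1) (vec [0, 1]) (vec [2, 1]) (stack 2 (vec [0, 1])) (\<lambda>e\<in>{(2, 1)}. 1) = - 1"
  by (subst quilt_sign_pair; simp add: upt_rec permutation_sign_refl permutation_sign_swap_2)+

lemma good_bidegrees_pair: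
  assumes "a \<noteq> b"
  shows "good_bidegrees 2 [a, b] 0 3 = {(vec [0, 0], vec [2, 2])}"
    "good_bidegrees 2 [a, b] 1 2 = {(vec [0, 1], vec [2, 1]), (vec [1, 0], vec [1, 2])}"
    "good_bidegrees 2 [a, b] 2 1 = {(vec [1, 1], vec [1, 1])}"
    "(p', q') \<notin> {(0, 3), (1, 2), (2, 1)} \<Longrightarrow> good_bidegrees 2 [a, b] p' q' = {}"
proof -
  have ex: "(\<exists>x y. x \<le> 1 \<and> y \<le> 1 \<and> P x y) \<longleftrightarrow> P 0 0 \<or> P 0 1 \<or> P 1 0 \<or> P 1 (1::nat)"
    for P :: "nat \<Rightarrow> nat \<Rightarrow> bool"
    by (auto simp: le_Suc_eq)
  have *: "(p, q) \<in> good_bidegrees 2 [a, b] p' q' \<longleftrightarrow>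
      (p = vec [0, 0] \<and> q = vec [2, 2] \<and> p' = 0 \<and> q' = 3) \<or>
      (p = vec [0, 1] \<and> q = vec [2, 1] \<and> p' = 1 \<and> q' = 2) \<or>
      (p = vec [1, 0] \<and> q = vec [1, 2] \<and> p' = 1 \<and> q' = 2) \<or>
      (p = vec [1, 1] \<and> q = vec [1, 1] \<and> p' = 2 \<and> q' = 1)" for p q p' q'
    unfolding good_bidegrees_2 word_deg_pair[OF assms] ex by auto
  show "good_bidegrees 2 [a, b] 0 3 = {(vec [0, 0], vec [2, 2])}"
    "good_bidegrees 2 [a, b] 1 2 = {(vec [0, 1], vec [2, 1]), (vec [1, 0], vec [1, 2])}"
    "good_bidegrees 2 [a, b] 2 1 = {(vec [1, 1], vec [1, 1])}"
    "(p', q') \<notin> {(0, 3), (1, 2), (2, 1)} \<Longrightarrow> good_bidegrees 2 [a, b] p' q' = {}"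
    by (auto simp: *)
qed

lemma vec_neq: "vec [0, 1] \<noteq> vec [1, 0]"
proof
  assume "vec [0, 1] = vec [1, 0]"
  then have "vec [0, 1] (Suc 0) = vec [1, 0] (Suc 0)" by simp
  then show False by simp
qed

context algebra_diagram
begin

lemma quilt_op_hom_pair:
  fixes a b :: nat and p q :: "nat \<Rightarrow> nat" and f :: "nat \<Rightarrow> ('o, 'm, 'a) cochain"
    and \<phi> :: "('o, 'm) string" and as :: "'a list"
  assumes ab: "(a, b) = (1, 2) \<or> (a, b) = (2, 1)" and M: "abelian_group (alg A (vtx C \<phi> 0))"
  defines "c \<equiv> \<lambda>i. coloring_action C A 2 (edge_tree a b) (\<lambda>e\<in>{(a, b)}. i) p q (stack a p) f \<phi> as"
    and "s \<equiv> \<lambda>i. quilt_sign 2 ([a, b], edge_tree a b) p q (stack a p) (\<lambda>e\<in>{(a, b)}. i)"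
  shows "\<lbrakk>q a = 1; c 1 \<in> carrier (alg A (vtx C \<phi> 0))\<rbrakk> \<Longrightarrow>
      quilt_op_hom C A 2 ([a, b], edge_tree a b) p q f \<phi> as = [s 1] \<cdot>\<^bsub>alg A (vtx C \<phi> 0)\<^esub> c 1"
    "\<lbrakk>q a = 2; c 1 \<in> carrier (alg A (vtx C \<phi> 0)); c 2 \<in> carrier (alg A (vtx C \<phi> 0))\<rbrakk> \<Longrightarrow>
      quilt_op_hom C A 2 ([a, b], edge_tree a b) p q f \<phi> as
      = ([s 1] \<cdot>\<^bsub>alg A (vtx C \<phi> 0)\<^esub> c 1) \<oplus>\<^bsub>alg A (vtx C \<phi> 0)\<^esub> ([s 2] \<cdot>\<^bsub>alg A (vtx C \<phi> 0)\<^esub> c 2)"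
proof -
  interpret M: abelian_group "alg A (vtx C \<phi> 0)" by fact
  let ?I = "\<lambda>i::nat. \<lambda>e\<in>{(a, b)}. i"
  \<comment> \<open>The sum runs over a set of colorings, so its two terms must be indexed by
    distinct functions.\<close>
  have ne: "?I 1 \<noteq> ?I 2"
  proof
    assume "?I 1 = ?I 2"
    then have "?I 1 (a, b) = ?I 2 (a, b)" by (rule fun_cong)
    then show False by simp
  qed
  show "quilt_op_hom C A 2 ([a, b], edge_tree a b) p q f \<phi> as = [s 1] \<cdot>\<^bsub>alg A (vtx C \<phi> 0)\<^esub> c 1"
    if "q a = 1" "c 1 \<in> carrier (alg A (vtx C \<phi> 0))"
  proof -
    have I: "tree_colorings (edge_tree a b) q = {?I 1}"
      unfolding tree_colorings_edge_tree that(1) by simp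
    show ?thesis
      using that(2) unfolding quilt_op_hom_def fst_conv snd_conv word_colorings_pair[OF ab] I c_def s_def
      by (simp add: M.finsum_one M.add.int_pow_closed)
  qed
  show "quilt_op_hom C A 2 ([a, b], edge_tree a b) p q f \<phi> as
      = ([s 1] \<cdot>\<^bsub>alg A (vtx C \<phi> 0)\<^esub> c 1) \<oplus>\<^bsub>alg A (vtx C \<phi> 0)\<^esub> ([s 2] \<cdot>\<^bsub>alg A (vtx C \<phi> 0)\<^esub> c 2)"
    if "q a = 2" "c 1 \<in> carrier (alg A (vtx C \<phi> 0))" "c 2 \<in> carrier (alg A (vtx C \<phi> 0))"
  proof -
    have "{1..2::nat} = {1, 2}" by auto
    then have I: "tree_colorings (edge_tree a b) q = {?I 1, ?I 2}"
      unfolding tree_colorings_edge_tree that(1) by simp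
    have "finsum (alg A (vtx C \<phi> 0)) (\<lambda>I. [quilt_sign 2 ([a, b], edge_tree a b) p q (stack a p) I]
        \<cdot>\<^bsub>alg A (vtx C \<phi> 0)\<^esub> coloring_action C A 2 (edge_tree a b) I p q (stack a p) f \<phi> as) {?I 1, ?I 2}
      = ([s 1] \<cdot>\<^bsub>alg A (vtx C \<phi> 0)\<^esub> c 1) \<oplus>\<^bsub>alg A (vtx C \<phi> 0)\<^esub> ([s 2] \<cdot>\<^bsub>alg A (vtx C \<phi> 0)\<^esub> c 2)"
      unfolding c_def s_def
      by (rule M.finsum_two) (use that ne in \<open>simp_all add: c_def M.add.int_pow_closed\<close>)
    then show ?thesis
      unfolding quilt_op_hom_def fst_conv snd_conv word_colorings_pair[OF ab] I
      using that by (subst M.finsum_one) (simp_all add: M.add.int_pow_closed)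
  qed
qed

lemma degree_oneD:
  assumes "degree_one R C A F"
  shows "F p q \<in> cochains R C A p q" "(p, q) \<notin> {(0, 2), (1, 1)} \<Longrightarrow> vanishes C A p q (F p q)"
  using assms unfolding degree_one_def by auto

context
  fixes a b :: nat and F :: "nat \<Rightarrow> ('o, 'm, 'a) gcochain"
  assumes ab: "(a, b) = (1, 2) \<or> (a, b) = (2, 1)"
    and F: "degree_one R C A (F 1)" "degree_one R C A (F 2)"
begin

private abbreviation (input) "Q \<equiv> ([a, b], edge_tree a b)"
private abbreviation (input) "qhom p q \<equiv> quilt_op_hom C A 2 Q p q (\<lambda>c. F c (p c) (q c))"

private lemma ne: "a \<noteq> b" using ab by auto
private lemma fam: "c \<in> {1..2} \<Longrightarrow> degree_one R C A (F c)"
  using F unfolding atLeastAtMost_1_2 by auto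

private lemma quilt_op_pair_good:
  assumes "\<phi> \<in> strings C p'" "as \<in> tuples (alg A (vtx C \<phi> p')) q'"
  shows "quilt_op C A 2 Q F p' q' \<phi> as
    = (\<Oplus>\<^bsub>alg A (vtx C \<phi> 0)\<^esub>pq\<in>good_bidegrees 2 [a, b] p' q'. qhom (fst pq) (snd pq) \<phi> as)"
  using quilt_op_good[OF edge_quilt[OF ab] fam assms] by simp

lemma quilt_op_pair_03:
  assumes "\<phi> \<in> strings C 0" "as \<in> tuples (alg A (vtx C \<phi> 0)) 3"
  shows "quilt_op C A 2 Q F 0 3 \<phi> as = qhom (vec [0, 0]) (vec [2, 2]) \<phi> as"
proof -
  interpret M: abelian_group "alg A (vtx C \<phi> 0)" using M_abelian vtx_obj[OF assms(1)] by blast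
  have "qhom (vec [0, 0]) (vec [2, 2]) \<phi> as \<in> carrier (alg A (vtx C \<phi> 0))"
    by (rule quilt_op_hom_family[OF edge_quilt[OF ab] fam assms])
       (use good_bidegrees_pair(1)[OF ne] in \<open>auto simp: good_bidegrees_def\<close>)
  then show ?thesis
    unfolding quilt_op_pair_good[OF assms] good_bidegrees_pair[OF ne]
    by (simp add: M.finsum_one)
qed

lemma quilt_op_pair_12:
  assumes "\<phi> \<in> strings C 1" "as \<in> tuples (alg A (vtx C \<phi> 1)) 2"
  shows "quilt_op C A 2 Q F 1 2 \<phi> as = qhom (vec [0, 1]) (vec [2, 1]) \<phi> as \<oplus>\<^bsub>alg A (vtx C \<phi> 0)\<^esub>
    qhom (vec [1, 0]) (vec [1, 2]) \<phi> as"
proof -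
  interpret M: abelian_group "alg A (vtx C \<phi> 0)" using M_abelian vtx_obj[OF assms(1)] by blast
  have "qhom p q \<phi> as \<in> carrier (alg A (vtx C \<phi> 0))" if "(p, q) \<in> good_bidegrees 2 [a, b] 1 2" for p q
    by (rule quilt_op_hom_family[OF edge_quilt[OF ab] fam assms])
       (use that in \<open>auto simp: good_bidegrees_def\<close>)
  then have "qhom (vec [0, 1]) (vec [2, 1]) \<phi> as \<in> carrier (alg A (vtx C \<phi> 0))"
    "qhom (vec [1, 0]) (vec [1, 2]) \<phi> as \<in> carrier (alg A (vtx C \<phi> 0))"
    unfolding good_bidegrees_pair[OF ne] by simp_all
  then show ?thesis
    unfolding quilt_op_pair_good[OF assms] good_bidegrees_pair[OF ne]
    using vec_neq by (subst M.finsum_two) auto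
qed

lemma quilt_op_pair_21:
  assumes "\<phi> \<in> strings C 2" "as \<in> tuples (alg A (vtx C \<phi> 2)) 1"
  shows "quilt_op C A 2 Q F 2 1 \<phi> as = qhom (vec [1, 1]) (vec [1, 1]) \<phi> as"
proof -
  interpret M: abelian_group "alg A (vtx C \<phi> 0)" using M_abelian vtx_obj[OF assms(1)] by blast
  have "qhom (vec [1, 1]) (vec [1, 1]) \<phi> as \<in> carrier (alg A (vtx C \<phi> 0))"
    by (rule quilt_op_hom_family[OF edge_quilt[OF ab] fam assms])
       (use good_bidegrees_pair(3)[OF ne] in \<open>auto simp: good_bidegrees_def\<close>)
  then show ?thesis
    unfolding quilt_op_pair_good[OF assms] good_bidegrees_pair[OF ne]
    by (simp add: M.finsum_one)
qed

lemma quilt_op_pair_other: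
  assumes "\<phi> \<in> strings C p'" "as \<in> tuples (alg A (vtx C \<phi> p')) q'" "(p', q') \<notin> {(0, 3), (1, 2), (2, 1)}"
  shows "quilt_op C A 2 Q F p' q' \<phi> as = \<zero>\<^bsub>alg A (vtx C \<phi> 0)\<^esub>"
proof -
  interpret M: abelian_group "alg A (vtx C \<phi> 0)" using M_abelian vtx_obj[OF assms(1)] by blast
  show ?thesis
    unfolding quilt_op_pair_good[OF assms(1,2)] good_bidegrees_pair(4)[OF ne assms(3)] by simp
qed

end

end

lemma atLeastAtMost_0_1: "{0..1::nat} = {0, 1}" "{0..Suc 0} = {0, 1}" "{0..2::nat} = {0, 1, 2}" "{0..Suc 1} = {0, 1, 2}"
  by auto

lemma tuples_2: "as \<in> tuples M 2 \<longleftrightarrow> (\<exists>u v. as = [u, v] \<and> u \<in> carrier M \<and> v \<in> carrier M)"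
  by (auto simp: tuples_def length_Suc_conv numeral_2_eq_2)

lemma tuples_1: "as \<in> tuples M 1 \<longleftrightarrow> (\<exists>u. as = [u] \<and> u \<in> carrier M)"
  by (auto simp: tuples_def length_Suc_conv)

lemma tuples_3: "as \<in> tuples M 3 \<longleftrightarrow>
    (\<exists>u v w. as = [u, v, w] \<and> u \<in> carrier M \<and> v \<in> carrier M \<and> w \<in> carrier M)"
  by (auto simp: tuples_def length_Suc_conv numeral_3_eq_3)

lemma multilinear_2:
  "h \<in> multilinear R 2 M N \<longleftrightarrow>
    (\<forall>u\<in>carrier M. \<forall>v\<in>carrier M. h [u, v] \<in> carrier N) \<and>
    (\<forall>u\<in>carrier M. \<forall>u'\<in>carrier M. \<forall>v\<in>carrier M.
      h [u \<oplus>\<^bsub>M\<^esub> u', v] = h [u, v] \<oplus>\<^bsub>N\<^esub> h [u', v] \<and> h [v, u \<oplus>\<^bsub>M\<^esub> u'] = h [v, u] \<oplus>\<^bsub>N\<^esub> h [v, u']) \<and>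
    (\<forall>r\<in>carrier R. \<forall>u\<in>carrier M. \<forall>v\<in>carrier M.
      h [r \<odot>\<^bsub>M\<^esub> u, v] = r \<odot>\<^bsub>N\<^esub> h [u, v] \<and> h [v, r \<odot>\<^bsub>M\<^esub> u] = r \<odot>\<^bsub>N\<^esub> h [v, u])"
proof -
  have all: "(\<forall>as\<in>tuples M 2. P as) \<longleftrightarrow> (\<forall>u\<in>carrier M. \<forall>v\<in>carrier M. P [u, v])" for P
    unfolding tuples_2 Ball_def by blast
  have lt: "(\<forall>i<2. P i) \<longleftrightarrow> P 0 \<and> P (1::nat)" for P
    by (auto simp: less_Suc_eq numeral_2_eq_2)
  show ?thesis
    unfolding multilinear_def mem_Collect_eq Pi_iff all lt
    by (simp; blast)
qed

lemma multilinear_1: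
  "h \<in> multilinear R 1 M N \<longleftrightarrow>
    (\<forall>u\<in>carrier M. h [u] \<in> carrier N) \<and>
    (\<forall>u\<in>carrier M. \<forall>u'\<in>carrier M. h [u \<oplus>\<^bsub>M\<^esub> u'] = h [u] \<oplus>\<^bsub>N\<^esub> h [u']) \<and>
    (\<forall>r\<in>carrier R. \<forall>u\<in>carrier M. h [r \<odot>\<^bsub>M\<^esub> u] = r \<odot>\<^bsub>N\<^esub> h [u])"
proof -
  have all: "(\<forall>as\<in>tuples M 1. P as) \<longleftrightarrow> (\<forall>u\<in>carrier M. P [u])" for P
    unfolding tuples_1 Ball_def by blast
  have lt: "(\<forall>i<1. P i) \<longleftrightarrow> P (0::nat)" for P by simp
  show ?thesis
    unfolding multilinear_def mem_Collect_eq Pi_iff all lt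
    by (simp; blast)
qed

context algebra_diagram
begin

lemma mult_carrier:
  "\<lbrakk>x \<in> Obj C; u \<in> carrier (alg A x); v \<in> carrier (alg A x)\<rbrakk> \<Longrightarrow> u \<otimes>\<^bsub>alg A x\<^esub> v \<in> carrier (alg A x)"
  using assoc_algebra.mult_closed[OF alg_algebra] .

text \<open>In bidegree \<open>(0, 2)\<close> the algebra axioms give bilinearity; in every other
  bidegree \<open>mhat\<close> is constantly zero.\<close>

lemma mhat_degree_one: "degree_one R C A (mhat A)"
  unfolding degree_one_def
proof (intro conjI allI impI)
  fix p q
  show "mhat A p q \<in> cochains R C A p q"
    unfolding cochains_def
  proof (intro CollectI ballI)
    fix \<phi> assume \<phi>: "\<phi> \<in> strings C p"
    have v0: "vtx C \<phi> 0 = fst \<phi>" by (simp add: vtx_def)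
    have x: "fst \<phi> \<in> Obj C" using \<phi> unfolding strings_def by simp
    interpret M: module R "alg A (fst \<phi>)" using M_module[OF x] .
    show "mhat A p q \<phi> \<in> multilinear R q (alg A (vtx C \<phi> p)) (alg A (vtx C \<phi> 0))"
    proof (cases "p = 0 \<and> q = 2")
      case True
      interpret assoc_algebra R "alg A (fst \<phi>)" using alg_algebra[OF x] .
      from True show ?thesis
        by (simp add: multilinear_2 v0 mhat_def mult_closed mult_add_left mult_add_right mult_smult_left mult_smult_right)
    next
      case False
      then show ?thesis
        unfolding multilinear_def v0 by (auto simp: mhat_def)
    qed
  qed
next
  fix p q :: nat assume "(p, q) \<notin> {(0, 2), (1, 1)}"
  then show "vanishes C A p q (mhat A p q)"
    unfolding vanishes_def by (auto simp: mhat_def vtx_def)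
qed

lemma mhat_02: "mhat A 0 2 (x, []) [u, v] = u \<otimes>\<^bsub>alg A x\<^esub> v"
  by (simp add: mhat_def)

lemma mhat_vanishes_11: "vanishes C A 1 1 (mhat A 1 1)"
  unfolding vanishes_def by (auto simp: mhat_def vtx_def)

context
  fixes F :: "nat \<Rightarrow> ('o, 'm, 'a) gcochain"
  assumes F: "degree_one R C A (F 1)" "degree_one R C A (F 2)"
begin

private lemma D:
  "F 1 p q \<in> cochains R C A p q" "F (Suc 0) p q \<in> cochains R C A p q" "F 2 p q \<in> cochains R C A p q"
  using degree_oneD(1)[OF F(1)] degree_oneD(1)[OF F(2)] by auto

lemma quilt_op_B_03:
  assumes x: "x \<in> Obj C" "u \<in> carrier (alg A x)" "v \<in> carrier (alg A x)" "w \<in> carrier (alg A x)"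
  shows "quilt_op C A 2 quilt_B F 0 3 (x, []) [u, v, w] =
    \<ominus>\<^bsub>alg A x\<^esub> F 1 0 2 (x, []) [F 2 0 2 (x, []) [u, v], w] \<oplus>\<^bsub>alg A x\<^esub>
    F 1 0 2 (x, []) [u, F 2 0 2 (x, []) [v, w]]"
proof -
  have ab: "(1::nat, 2::nat) = (1, 2) \<or> (1::nat, 2::nat) = (2, 1)" by simp
  have v0: "vtx C (x, []) 0 = x" by (simp add: vtx_def)
  have M: "abelian_group (alg A (vtx C (x, []) 0))" using M_abelian x(1) v0 by simp
  interpret M: abelian_group "alg A x" using M_abelian x(1) .
  let ?f = "\<lambda>c. F c (vec [0, 0] c) (vec [2, 2] c)"
  note act = edge_action_02_02[OF ab, where p="vec [0, 0]" and q="vec [2, 2]" and f="?f", OF _ _ _ _ _ _ x]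
  have "quilt_op C A 2 quilt_B F 0 3 (x, []) [u, v, w]
      = quilt_op_hom C A 2 ([1, 2], edge_tree 1 2) (vec [0, 0]) (vec [2, 2]) ?f (x, []) [u, v, w]"
    unfolding quilt_B_edge_tree
    by (rule quilt_op_pair_03[OF ab F]) (use x in \<open>auto simp: strings_0 tuples_3 v0\<close>)
  also have "\<dots> = \<ominus>\<^bsub>alg A x\<^esub> F 1 0 2 (x, []) [F 2 0 2 (x, []) [u, v], w] \<oplus>\<^bsub>alg A x\<^esub>
    F 1 0 2 (x, []) [u, F 2 0 2 (x, []) [v, w]]"
    using x by (subst quilt_op_hom_pair(2)[OF ab M];
      simp add: act[simplified] D v0 cochain_02_closed quilt_sign_B[simplified] M.add_pow_pm1)
  finally show ?thesis .
qed

lemma quilt_op_B_12: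
  assumes x: "\<psi> \<in> Mor C" "u \<in> carrier (alg A (Src C \<psi>))" "v \<in> carrier (alg A (Src C \<psi>))"
  shows "quilt_op C A 2 quilt_B F 1 2 (Tgt C \<psi>, [\<psi>]) [u, v] =
    \<ominus>\<^bsub>alg A (Tgt C \<psi>)\<^esub> F 1 0 2 (Tgt C \<psi>, []) [F 2 1 1 (Tgt C \<psi>, [\<psi>]) [u], act A \<psi> v] \<oplus>\<^bsub>alg A (Tgt C \<psi>)\<^esub>
    \<ominus>\<^bsub>alg A (Tgt C \<psi>)\<^esub> F 1 0 2 (Tgt C \<psi>, []) [act A \<psi> u, F 2 1 1 (Tgt C \<psi>, [\<psi>]) [v]] \<oplus>\<^bsub>alg A (Tgt C \<psi>)\<^esub>
    F 1 1 1 (Tgt C \<psi>, [\<psi>]) [F 2 0 2 (Src C \<psi>, []) [u, v]]"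
proof -
  have ab: "(1::nat, 2::nat) = (1, 2) \<or> (1::nat, 2::nat) = (2, 1)" by simp
  let ?x = "Tgt C \<psi>" and ?\<phi> = "(Tgt C \<psi>, [\<psi>])"
  have v0: "vtx C ?\<phi> 0 = ?x" "vtx C ?\<phi> (Suc 0) = Src C \<psi>" by (simp_all add: vtx_def)
  have M: "abelian_group (alg A (vtx C ?\<phi> 0))" using M_abelian tgt_obj[OF x(1)] v0 by simp
  interpret M: abelian_group "alg A ?x" using M_abelian tgt_obj[OF x(1)] .
  let ?f = "\<lambda>c. F c (vec [0, 1] c) (vec [2, 1] c)" and ?g = "\<lambda>c. F c (vec [1, 0] c) (vec [1, 2] c)"
  note act1 = edge_action_02_11[OF ab, where p="vec [0, 1]" and q="vec [2, 1]" and f="?f", OF _ _ _ _ _ _ x]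
  note act2 = edge_action_11_02[OF ab, where p="vec [1, 0]" and q="vec [1, 2]" and f="?g", OF _ _ _ _ _ _ x]
  note cl = cochain_02_closed cochain_11_closed[unfolded One_nat_def] act_closed src_obj tgt_obj
  have "quilt_op C A 2 quilt_B F 1 2 ?\<phi> [u, v]
      = quilt_op_hom C A 2 ([1, 2], edge_tree 1 2) (vec [0, 1]) (vec [2, 1]) ?f ?\<phi> [u, v] \<oplus>\<^bsub>alg A (vtx C ?\<phi> 0)\<^esub>
        quilt_op_hom C A 2 ([1, 2], edge_tree 1 2) (vec [1, 0]) (vec [1, 2]) ?g ?\<phi> [u, v]"
    unfolding quilt_B_edge_tree
    by (rule quilt_op_pair_12[OF ab F]) (use x in \<open>auto simp: strings_1[simplified] tuples_2 v0\<close>)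
  also have "quilt_op_hom C A 2 ([1, 2], edge_tree 1 2) (vec [0, 1]) (vec [2, 1]) ?f ?\<phi> [u, v]
    = \<ominus>\<^bsub>alg A ?x\<^esub> F 1 0 2 (?x, []) [F 2 1 1 ?\<phi> [u], act A \<psi> v] \<oplus>\<^bsub>alg A ?x\<^esub>
      \<ominus>\<^bsub>alg A ?x\<^esub> F 1 0 2 (?x, []) [act A \<psi> u, F 2 1 1 ?\<phi> [v]]"
    using x by (subst quilt_op_hom_pair(2)[OF ab M];
      simp add: act1[simplified] D v0 cl quilt_sign_B[simplified] M.add_pow_pm1)
  also have "quilt_op_hom C A 2 ([1, 2], edge_tree 1 2) (vec [1, 0]) (vec [1, 2]) ?g ?\<phi> [u, v]
    = F 1 1 1 ?\<phi> [F 2 0 2 (Src C \<psi>, []) [u, v]]"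
    using x by (subst quilt_op_hom_pair(1)[OF ab M];
      simp add: act2[simplified] D v0 cl quilt_sign_B[simplified] M.add_pow_pm1)
  finally show ?thesis unfolding v0 .
qed

lemma quilt_op_B_21:
  assumes x: "\<psi> \<in> Mor C" "\<chi> \<in> Mor C" "Src C \<psi> = Tgt C \<chi>" "u \<in> carrier (alg A (Src C \<chi>))"
  shows "quilt_op C A 2 quilt_B F 2 1 (Tgt C \<psi>, [\<psi>, \<chi>]) [u] =
    F 1 1 1 (Tgt C \<psi>, [\<psi>]) [F 2 1 1 (Tgt C \<chi>, [\<chi>]) [u]]"
proof -
  have ab: "(1::nat, 2::nat) = (1, 2) \<or> (1::nat, 2::nat) = (2, 1)" by simp
  let ?x = "Tgt C \<psi>" and ?\<phi> = "(Tgt C \<psi>, [\<psi>, \<chi>])"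
  have v0: "vtx C ?\<phi> 0 = ?x" "vtx C ?\<phi> 2 = Src C \<chi>" by (simp_all add: vtx_def numeral_2_eq_2)
  have M: "abelian_group (alg A (vtx C ?\<phi> 0))" using M_abelian tgt_obj[OF x(1)] v0 by simp
  interpret M: abelian_group "alg A ?x" using M_abelian tgt_obj[OF x(1)] .
  let ?f = "\<lambda>c. F c (vec [1, 1] c) (vec [1, 1] c)"
  note act = edge_action_11_11[OF ab, where p="vec [1, 1]" and q="vec [1, 1]" and f="?f", OF _ _ _ _ _ _ x]
  have g1: "F (Suc 0) (Suc 0) (Suc 0) (Tgt C \<psi>, [\<psi>]) [F 2 (Suc 0) (Suc 0) (Tgt C \<chi>, [\<chi>]) [u]] \<in> carrier (alg A ?x)"
    using cochain_11_closed[OF D(1) x(1)] cochain_11_closed[OF D(3) x(2,4)] x(3) by simp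
  have "quilt_op C A 2 quilt_B F 2 1 ?\<phi> [u]
      = quilt_op_hom C A 2 ([1, 2], edge_tree 1 2) (vec [1, 1]) (vec [1, 1]) ?f ?\<phi> [u]"
    unfolding quilt_B_edge_tree
    by (rule quilt_op_pair_21[OF ab F]) (use x in \<open>auto simp: strings_2 tuples_1[simplified] v0\<close>)
  also have "\<dots> = F 1 1 1 (Tgt C \<psi>, [\<psi>]) [F 2 1 1 (Tgt C \<chi>, [\<chi>]) [u]]"
    using x g1 by (subst quilt_op_hom_pair(1)[OF ab M];
      simp add: act[simplified] D v0 quilt_sign_B[simplified] M.add_pow_pm1)
  finally show ?thesis .
qed

lemma quilt_op_B'_03:
  assumes x: "x \<in> Obj C" "u \<in> carrier (alg A x)" "v \<in> carrier (alg A x)" "w \<in> carrier (alg A x)"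
  shows "quilt_op C A 2 quilt_B' F 0 3 (x, []) [u, v, w] =
    F 2 0 2 (x, []) [F 1 0 2 (x, []) [u, v], w] \<oplus>\<^bsub>alg A x\<^esub>
    \<ominus>\<^bsub>alg A x\<^esub> F 2 0 2 (x, []) [u, F 1 0 2 (x, []) [v, w]]"
proof -
  have ab: "(2::nat, 1::nat) = (1, 2) \<or> (2::nat, 1::nat) = (2, 1)" by simp
  have v0: "vtx C (x, []) 0 = x" by (simp add: vtx_def)
  have M: "abelian_group (alg A (vtx C (x, []) 0))" using M_abelian x(1) v0 by simp
  interpret M: abelian_group "alg A x" using M_abelian x(1) .
  let ?f = "\<lambda>c. F c (vec [0, 0] c) (vec [2, 2] c)"
  note act = edge_action_02_02[OF ab, where p="vec [0, 0]" and q="vec [2, 2]" and f="?f", OF _ _ _ _ _ _ x]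
  have "quilt_op C A 2 quilt_B' F 0 3 (x, []) [u, v, w]
      = quilt_op_hom C A 2 ([2, 1], edge_tree 2 1) (vec [0, 0]) (vec [2, 2]) ?f (x, []) [u, v, w]"
    unfolding quilt_B'_edge_tree
    by (rule quilt_op_pair_03[OF ab F]) (use x in \<open>auto simp: strings_0 tuples_3 v0\<close>)
  also have "\<dots> = F 2 0 2 (x, []) [F 1 0 2 (x, []) [u, v], w] \<oplus>\<^bsub>alg A x\<^esub>
    \<ominus>\<^bsub>alg A x\<^esub> F 2 0 2 (x, []) [u, F 1 0 2 (x, []) [v, w]]"
    using x by (subst quilt_op_hom_pair(2)[OF ab M];
      simp add: act[simplified] D v0 cochain_02_closed quilt_sign_B'[simplified] M.add_pow_pm1)
  finally show ?thesis .
qed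

text \<open>\<open>B'\<close> is applied with \<open>mhat A\<close> as first argument, for which
  \<open>van\<close> holds. It removes the choice of bidegrees that would put a
  \<open>(1, 1)\<close> component of the first argument under a root of bidegree
  \<open>(0, 2)\<close>.\<close>

lemma quilt_op_B'_12:
  assumes x: "\<psi> \<in> Mor C" "u \<in> carrier (alg A (Src C \<psi>))" "v \<in> carrier (alg A (Src C \<psi>))"
    and van: "vanishes C A 1 1 (F 1 1 1)"
  shows "quilt_op C A 2 quilt_B' F 1 2 (Tgt C \<psi>, [\<psi>]) [u, v] =
    \<ominus>\<^bsub>alg A (Tgt C \<psi>)\<^esub> F 2 1 1 (Tgt C \<psi>, [\<psi>]) [F 1 0 2 (Src C \<psi>, []) [u, v]]"
proof -
  have ab: "(2::nat, 1::nat) = (1, 2) \<or> (2::nat, 1::nat) = (2, 1)" by simp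
  let ?x = "Tgt C \<psi>" and ?\<phi> = "(Tgt C \<psi>, [\<psi>])"
  have v0: "vtx C ?\<phi> 0 = ?x" "vtx C ?\<phi> (Suc 0) = Src C \<psi>" by (simp_all add: vtx_def)
  have M: "abelian_group (alg A (vtx C ?\<phi> 0))" using M_abelian tgt_obj[OF x(1)] v0 by simp
  interpret M: abelian_group "alg A ?x" using M_abelian tgt_obj[OF x(1)] .
  let ?f = "\<lambda>c. F c (vec [0, 1] c) (vec [2, 1] c)" and ?g = "\<lambda>c. F c (vec [1, 0] c) (vec [1, 2] c)"
  note act1 = edge_action_11_02[OF ab, where p="vec [0, 1]" and q="vec [2, 1]" and f="?f", OF _ _ _ _ _ _ x(1-3)]
  note cl = cochain_02_closed cochain_11_closed[unfolded One_nat_def] act_closed src_obj tgt_obj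
  have s: "?\<phi> \<in> strings C 1" "[u, v] \<in> tuples (alg A (vtx C ?\<phi> 1)) 2"
    using x by (auto simp: strings_1[simplified] tuples_2 v0)
  have "quilt_op C A 2 quilt_B' F 1 2 ?\<phi> [u, v]
      = quilt_op_hom C A 2 ([2, 1], edge_tree 2 1) (vec [0, 1]) (vec [2, 1]) ?f ?\<phi> [u, v] \<oplus>\<^bsub>alg A (vtx C ?\<phi> 0)\<^esub>
        quilt_op_hom C A 2 ([2, 1], edge_tree 2 1) (vec [1, 0]) (vec [1, 2]) ?g ?\<phi> [u, v]"
    unfolding quilt_B'_edge_tree by (rule quilt_op_pair_12[OF ab F s])
  also have "quilt_op_hom C A 2 ([2, 1], edge_tree 2 1) (vec [0, 1]) (vec [2, 1]) ?f ?\<phi> [u, v]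
    = \<ominus>\<^bsub>alg A ?x\<^esub> F 2 1 1 ?\<phi> [F 1 0 2 (Src C \<psi>, []) [u, v]]"
    using x by (subst quilt_op_hom_pair(1)[OF ab M];
      simp add: act1[simplified] D v0 cl quilt_sign_B'[simplified] M.add_pow_pm1)
  also have "quilt_op_hom C A 2 ([2, 1], edge_tree 2 1) (vec [1, 0]) (vec [1, 2]) ?g ?\<phi> [u, v]
    = \<zero>\<^bsub>alg A (vtx C ?\<phi> 0)\<^esub>"
  proof (rule quilt_op_hom(2)[OF edge_quilt[OF ab] _ _ s, of _ _ _ 1])
    show "(vec [1, 0], vec [1, 2]) \<in> bidegrees 2 (fst ([2, 1], edge_tree 2 1)) 1 2"
      using good_bidegrees_pair(2)[of 2 1] by (auto simp: good_bidegrees_def)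
    show "vanishes C A (vec [1, 0] 1) (vec [1, 2] 1) (F 1 (vec [1, 0] 1) (vec [1, 2] 1))"
      using van by simp
    show "F c (vec [1, 0] c) (vec [1, 2] c) \<in> cochains R C A (vec [1, 0] c) (vec [1, 2] c)"
      if "c \<in> {1..2}" for c
      using that D unfolding atLeastAtMost_1_2 by auto
  qed simp
  finally show ?thesis
    unfolding v0 using x D by (simp add: cl)
qed

lemma quilt_op_B'_21:
  assumes s: "\<phi> \<in> strings C 2" "as \<in> tuples (alg A (vtx C \<phi> 2)) 1"
    and van: "vanishes C A 1 1 (F 1 1 1)"
  shows "quilt_op C A 2 quilt_B' F 2 1 \<phi> as = \<zero>\<^bsub>alg A (vtx C \<phi> 0)\<^esub>"
proof -
  have ab: "(2::nat, 1::nat) = (1, 2) \<or> (2::nat, 1::nat) = (2, 1)" by simp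
  have "quilt_op_hom C A 2 ([2, 1], edge_tree 2 1) (vec [1, 1]) (vec [1, 1])
      (\<lambda>c. F c (vec [1, 1] c) (vec [1, 1] c)) \<phi> as = \<zero>\<^bsub>alg A (vtx C \<phi> 0)\<^esub>"
  proof (rule quilt_op_hom(2)[OF edge_quilt[OF ab] _ _ s, of _ _ _ 1])
    show "(vec [1, 1], vec [1, 1]) \<in> bidegrees 2 (fst ([2, 1], edge_tree 2 1)) 2 1"
      using good_bidegrees_pair(3)[of 2 1] by (auto simp: good_bidegrees_def)
    show "vanishes C A (vec [1, 1] 1) (vec [1, 1] 1) (F 1 (vec [1, 1] 1) (vec [1, 1] 1))"
      using van by simp
    show "F c (vec [1, 1] c) (vec [1, 1] c) \<in> cochains R C A (vec [1, 1] c) (vec [1, 1] c)"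
      if "c \<in> {1..2}" for c
      using that D unfolding atLeastAtMost_1_2 by auto
  qed simp
  then show ?thesis
    unfolding quilt_B'_edge_tree quilt_op_pair_21[OF ab F s] .
qed

end

end

section \<open>The Maurer--Cartan equation in components\<close>

text \<open>The Maurer-Cartan expression with the sum over \<open>n\<close> cut off after 3;
  \<open>maurer_cartan_iff\<close> justifies the cut.\<close>

definition mc_term ::
  "('o, 'm) category \<Rightarrow> ('o, 'm, 'k, 'a) diagram \<Rightarrow> ('o, 'm, 'a) gcochain \<Rightarrow> ('o, 'm, 'a) gcochain" where
  "mc_term C A F p q \<phi> as = delta C A F p q \<phi> as \<oplus>\<^bsub>alg A (vtx C \<phi> 0)\<^esub>
     (P_op C A 2 (\<lambda>_. F) p q \<phi> as \<oplus>\<^bsub>alg A (vtx C \<phi> 0)\<^esub> P_op C A 3 (\<lambda>_. F) p q \<phi> as)"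

context algebra_diagram
begin

context
  fixes F :: "nat \<Rightarrow> ('o, 'm, 'a) gcochain"
  assumes F: "\<And>c. c \<in> {1..3} \<Longrightarrow> degree_one R C A (F c)"
begin

private lemma cherry_zero:
  assumes "(p, q) \<in> good_bidegrees 3 [1, 2, 3, 2] p' q'"
    and "p \<noteq> vec [0, 1, 1] \<or> q \<noteq> vec [2, 1, 1] \<or> p' \<noteq> 1 \<or> q' \<noteq> 2" and "\<phi> \<in> strings C p'"
  shows "quilt_op_hom C A 3 cherry_quilt p q f \<phi> as = \<zero>\<^bsub>alg A (vtx C \<phi> 0)\<^esub>"
proof -
  interpret M: abelian_group "alg A (vtx C \<phi> 0)" using M_abelian vtx_obj[OF assms(3)] by blast
  have "word_colorings 3 [1, 2, 3, 2] p = {} \<or> tree_colorings cherry_tree q = {}"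
    using cherry_bidegree[OF assms(1)] assms(2) by blast
  then show ?thesis
    unfolding quilt_op_hom_def cherry_quilt_def fst_conv snd_conv
    by (elim disjE) (simp_all add: M.add.finprod_one_eqI)
qed

lemma quilt_op_cherry_other:
  assumes s: "\<phi> \<in> strings C p'" "as \<in> tuples (alg A (vtx C \<phi> p')) q'" and "(p', q') \<noteq> (1, 2)"
  shows "quilt_op C A 3 cherry_quilt F p' q' \<phi> as = \<zero>\<^bsub>alg A (vtx C \<phi> 0)\<^esub>"
proof -
  interpret M: abelian_group "alg A (vtx C \<phi> 0)" using M_abelian vtx_obj[OF s(1)] by blast
  have eq: "quilt_op C A 3 cherry_quilt F p' q' \<phi> as = (\<Oplus>\<^bsub>alg A (vtx C \<phi> 0)\<^esub>pq\<in>good_bidegrees 3 (fst cherry_quilt) p' q'.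
        quilt_op_hom C A 3 cherry_quilt (fst pq) (snd pq) (\<lambda>a. F a (fst pq a) (snd pq a)) \<phi> as)"
    by (rule quilt_op_good[OF cherry_quilt_quilt F s])
  show ?thesis unfolding eq
  proof (rule M.add.finprod_one_eqI)
    fix pq assume "pq \<in> good_bidegrees 3 (fst cherry_quilt) p' q'"
    then have "(fst pq, snd pq) \<in> good_bidegrees 3 [1, 2, 3, 2] p' q'" by (simp add: cherry_quilt_def)
    then show "quilt_op_hom C A 3 cherry_quilt (fst pq) (snd pq) (\<lambda>a. F a (fst pq a) (snd pq a)) \<phi> as
        = \<zero>\<^bsub>alg A (vtx C \<phi> 0)\<^esub>"
      using assms(3) by (intro cherry_zero[OF _ _ s(1)]) auto
  qed
qed

text \<open>Vertex 3 occupies the first input of the root, so \<open>F 3\<close> receives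
  \<open>u\<close>. Up to sign, \<open>mhat A\<close> at the root yields the product of
  \<open>g u\<close> and \<open>g v\<close>, and \<open>F\<close> at the root yields
  \<open>f\<close> applied to them: the part of multiplicativity that is quadratic in
  \<open>g\<close>.\<close>

lemma quilt_op_cherry_12:
  assumes x: "\<psi> \<in> Mor C" "u \<in> carrier (alg A (Src C \<psi>))" "v \<in> carrier (alg A (Src C \<psi>))"
  shows "quilt_op C A 3 cherry_quilt F 1 2 (Tgt C \<psi>, [\<psi>]) [u, v] =
    \<ominus>\<^bsub>alg A (Tgt C \<psi>)\<^esub> F 1 0 2 (Tgt C \<psi>, []) [F 3 1 1 (Tgt C \<psi>, [\<psi>]) [u], F 2 1 1 (Tgt C \<psi>, [\<psi>]) [v]]"
proof -
  let ?x = "Tgt C \<psi>" and ?\<phi> = "(Tgt C \<psi>, [\<psi>])" and ?p = "vec [0, 1, 1]" and ?q = "vec [2, 1, 1]"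
  have v0: "vtx C ?\<phi> 0 = ?x" "vtx C ?\<phi> (Suc 0) = Src C \<psi>" by (simp_all add: vtx_def)
  interpret M: abelian_group "alg A ?x" using M_abelian tgt_obj[OF x(1)] .
  have D: "F c p q \<in> cochains R C A p q" if "c \<in> {1..3}" for c p q
    using degree_oneD(1)[OF F[OF that]] .
  have D: "F (Suc 0) p q \<in> cochains R C A p q" "F 2 p q \<in> cochains R C A p q" "F 3 p q \<in> cochains R C A p q" for p q
    using D[of 1] D[of 2] D[of 3] by simp_all
  have s: "?\<phi> \<in> strings C 1" "[u, v] \<in> tuples (alg A (vtx C ?\<phi> 1)) 2"
    using x by (auto simp: strings_1[simplified] tuples_2 v0)
  let ?h = "\<lambda>pq. quilt_op_hom C A 3 cherry_quilt (fst pq) (snd pq) (\<lambda>a. F a (fst pq a) (snd pq a)) ?\<phi> [u, v]"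
  let ?g = "good_bidegrees 3 (fst cherry_quilt) 1 2"
  have val: "F (Suc 0) 0 2 (?x, []) [F 3 (Suc 0) (Suc 0) ?\<phi> [u], F 2 (Suc 0) (Suc 0) ?\<phi> [v]] \<in> carrier (alg A ?x)"
    using x D by (simp add: cochain_02_closed cochain_11_closed[unfolded One_nat_def] tgt_obj)
  have act: "coloring_action C A 3 cherry_tree cherry_tree_coloring ?p ?q cherry_word_coloring
      (\<lambda>a. F a (?p a) (?q a)) ?\<phi> [u, v] = F 1 0 2 (?x, []) [F 3 1 1 ?\<phi> [u], F 2 1 1 ?\<phi> [v]]"
    by (subst cherry_action[OF _ _ _ x]) (use D in simp_all)
  have hp: "?h (?p, ?q) = \<ominus>\<^bsub>alg A ?x\<^esub> F 1 0 2 (?x, []) [F 3 1 1 ?\<phi> [u], F 2 1 1 ?\<phi> [v]]"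
    unfolding quilt_op_hom_def fst_conv snd_conv
    using val act quilt_sign_cherry
    by (simp add: cherry_quilt_def word_colorings_cherry[simplified] tree_colorings_cherry_tree v0
        M.finsum_one M.add_pow_pm1)
  have g: "(?p, ?q) \<in> ?g"
    unfolding good_bidegrees_def bidegrees_def cherry_quilt_def fst_conv word_deg_cherry sum_1_3 atLeastAtMost_1_3
    using vec_PiE(2)[of 0 1 1] vec_PiE(2)[of 2 1 1] by (simp add: atLeastAtMost_1_3)
  have eq: "quilt_op C A 3 cherry_quilt F 1 2 ?\<phi> [u, v] = finsum (alg A (vtx C ?\<phi> 0)) ?h ?g"
    by (rule quilt_op_good[OF cherry_quilt_quilt F s])
  \<comment> \<open>Among the good bidegrees only this one admits colorings.\<close>
  have "finsum (alg A ?x) ?h {(?p, ?q)} = finsum (alg A ?x) ?h ?g"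
  proof (rule M.add.finprod_mono_neutral_cong_left)
    show "finite ?g"
      by (rule finite_subset[OF _ finite_bidegrees]) (auto simp: good_bidegrees_def)
    show "{(?p, ?q)} \<subseteq> ?g" using g by simp
    have z: "?h pq = \<zero>\<^bsub>alg A ?x\<^esub>" if "pq \<in> ?g - {(?p, ?q)}" for pq
    proof -
      have "(fst pq, snd pq) \<in> good_bidegrees 3 [1, 2, 3, 2] 1 2"
        using that by (simp add: cherry_quilt_def)
      moreover have "fst pq \<noteq> ?p \<or> snd pq \<noteq> ?q" using that by (cases pq) auto
      ultimately show ?thesis using cherry_zero[OF _ _ s(1)] unfolding v0 by blast
    qed
    show "?h pq = \<zero>\<^bsub>alg A ?x\<^esub>" if "pq \<in> ?g - {(?p, ?q)}" for pq using z[OF that] .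
    show "?h \<in> ?g \<rightarrow> carrier (alg A ?x)"
    proof
      fix pq assume "pq \<in> ?g"
      then show "?h pq \<in> carrier (alg A ?x)"
        using z[of pq] hp val by (cases "pq = (?p, ?q)") auto
    qed
  qed simp
  then show ?thesis
    unfolding eq v0 using hp val by (simp add: M.finsum_one)
qed

end

section \<open>The simplicial differential in low bidegrees\<close>

lemma face_strings:
  assumes \<phi>: "\<phi> \<in> strings C (Suc p)" and i: "i \<le> Suc p"
  shows "pull C p (face i) \<phi> \<in> strings C p"
    "vtx C (pull C p (face i) \<phi>) 0 = vtx C \<phi> (face i 0)"
    "vtx C (pull C p (face i) \<phi>) p = vtx C \<phi> (face i p)"
  using pull_strings[OF \<phi>, of p "face i"] vtx_pull[OF \<phi>, of 0 p "face i"] vtx_pull[OF \<phi>, of p p "face i"]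
  by (simp_all add: face_def)

text \<open>The vanishing of \<open>F p q\<close> is pointwise, so every face must first be shown to
  be a valid string with valid arguments; the outer \<open>act\<close> then preserves zero.\<close>

lemma delta_S_zero:
  assumes \<phi>: "\<phi> \<in> strings C p'" and as: "as \<in> tuples (alg A (vtx C \<phi> p')) q"
    and van: "\<And>p. p' = Suc p \<Longrightarrow> vanishes C A p q (F p q)"
  shows "delta_S C A F p' q \<phi> as = \<zero>\<^bsub>alg A (vtx C \<phi> 0)\<^esub>"
proof (cases p')
  case 0
  then show ?thesis by (simp add: delta_S_def)
next
  case (Suc p)
  interpret M: abelian_group "alg A (vtx C \<phi> 0)" using M_abelian vtx_obj[OF \<phi>] by blast
  have z: "act A (seg C \<phi> 0 (face i 0)) (F p q (pull C p (face i) \<phi>) (map (act A (seg C \<phi> (face i p) (Suc p))) as))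
      = \<zero>\<^bsub>alg A (vtx C \<phi> 0)\<^esub>" if i: "i \<in> {0..Suc p}" for i
  proof -
    have \<phi>': "\<phi> \<in> strings C (Suc p)" using \<phi> Suc by simp
    have ip: "i \<le> Suc p" using i by simp
    have f: "face i 0 \<le> Suc p" "face i p \<le> Suc p" by (auto simp: face_def)
    note fs = face_strings[OF \<phi>' ip]
    have "map (act A (seg C \<phi> (face i p) (Suc p))) as \<in> tuples (alg A (vtx C \<phi> (face i p))) q"
      using as seg_act_closed[OF \<phi>' f(2) order_refl] Suc unfolding tuples_def by auto
    then have "F p q (pull C p (face i) \<phi>) (map (act A (seg C \<phi> (face i p) (Suc p))) as)
        = \<zero>\<^bsub>alg A (vtx C \<phi> (face i 0))\<^esub>"
      using van[OF Suc] fs unfolding vanishes_def by metis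
    then show ?thesis using seg_act_zero[OF \<phi>' _ f(1)] by simp
  qed
  show ?thesis
    unfolding delta_S_def Suc nat.case
    by (rule M.add.finprod_one_eqI) (simp add: z M.add.int_pow_one)
qed

lemma delta_S_12:
  assumes F: "F 0 2 \<in> cochains R C A 0 2" and x: "\<psi> \<in> Mor C" "u \<in> carrier (alg A (Src C \<psi>))" "v \<in> carrier (alg A (Src C \<psi>))"
  shows "delta_S C A F 1 2 (Tgt C \<psi>, [\<psi>]) [u, v] =
    act A \<psi> (F 0 2 (Src C \<psi>, []) [u, v]) \<oplus>\<^bsub>alg A (Tgt C \<psi>)\<^esub>
    \<ominus>\<^bsub>alg A (Tgt C \<psi>)\<^esub> F 0 2 (Tgt C \<psi>, []) [act A \<psi> u, act A \<psi> v]"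
proof -
  let ?\<phi> = "(Tgt C \<psi>, [\<psi>])"
  have v0: "vtx C ?\<phi> 0 = Tgt C \<psi>" by (simp add: vtx_def)
  interpret M: abelian_group "alg A (Tgt C \<psi>)" using M_abelian tgt_obj[OF x(1)] .
  \<comment> \<open>Omitting index 0 leaves the source of \<open>\<psi>\<close>, and the value is
    transported by \<open>\<psi>\<close>; omitting index 1 leaves the target, and the arguments are
    transported instead.\<close>
  have 0: "act A (seg C ?\<phi> 0 (face 0 0)) (F 0 2 (pull C 0 (face 0) ?\<phi>) (map (act A (seg C ?\<phi> (face 0 0) (Suc 0))) [u, v]))
      = act A \<psi> (F 0 2 (Src C \<psi>, []) [u, v])"
    using x by (simp add: face_def seg_simps pull_def vtx_def act_ident src_obj)
  have 1: "act A (seg C ?\<phi> 0 (face 1 0)) (F 0 2 (pull C 0 (face 1) ?\<phi>) (map (act A (seg C ?\<phi> (face 1 0) (Suc 0))) [u, v]))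
      = F 0 2 (Tgt C \<psi>, []) [act A \<psi> u, act A \<psi> v]"
    using x F by (simp add: face_def seg_simps pull_def vtx_def act_ident tgt_obj act_closed cochain_02_closed)
  have cl: "act A \<psi> (F 0 2 (Src C \<psi>, []) [u, v]) \<in> carrier (alg A (Tgt C \<psi>))"
    "F 0 2 (Tgt C \<psi>, []) [act A \<psi> u, act A \<psi> v] \<in> carrier (alg A (Tgt C \<psi>))"
    using x F by (simp_all add: act_closed cochain_02_closed src_obj tgt_obj)
  show ?thesis
    unfolding delta_S_def One_nat_def nat.case v0 atLeastAtMost_0_1
    by (subst M.finsum_two) (use 0 1 cl in \<open>simp_all add: M.add_pow_pm1\<close>)
qed

lemma delta_S_21:
  assumes F: "F 1 1 \<in> cochains R C A 1 1"
    and x: "\<psi> \<in> Mor C" "\<chi> \<in> Mor C" "Src C \<psi> = Tgt C \<chi>" "u \<in> carrier (alg A (Src C \<chi>))"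
  shows "delta_S C A F 2 1 (Tgt C \<psi>, [\<psi>, \<chi>]) [u] =
    act A \<psi> (F 1 1 (Tgt C \<chi>, [\<chi>]) [u]) \<oplus>\<^bsub>alg A (Tgt C \<psi>)\<^esub>
    (\<ominus>\<^bsub>alg A (Tgt C \<psi>)\<^esub> F 1 1 (Tgt C \<psi>, [Comp C \<psi> \<chi>]) [u] \<oplus>\<^bsub>alg A (Tgt C \<psi>)\<^esub>
     F 1 1 (Tgt C \<psi>, [\<psi>]) [act A \<chi> u])"
proof -
  let ?\<phi> = "(Tgt C \<psi>, [\<psi>, \<chi>])"
  have v0: "vtx C ?\<phi> 0 = Tgt C \<psi>" by (simp add: vtx_def)
  interpret M: abelian_group "alg A (Tgt C \<psi>)" using M_abelian tgt_obj[OF x(1)] .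
  have c: "Comp C \<psi> \<chi> \<in> Mor C" "Src C (Comp C \<psi> \<chi>) = Src C \<chi>" "Tgt C (Comp C \<psi> \<chi>) = Tgt C \<psi>"
    using x by (simp_all add: comp_mor comp_src comp_tgt)
  let ?t = "\<lambda>i. act A (seg C ?\<phi> 0 (face i 0)) (F 1 1 (pull C 1 (face i) ?\<phi>) (map (act A (seg C ?\<phi> (face i 1) 2)) [u]))"
  have cl: "act A \<psi> (F 1 1 (Tgt C \<chi>, [\<chi>]) [u]) \<in> carrier (alg A (Tgt C \<psi>))"
    "F 1 1 (Tgt C \<psi>, [Comp C \<psi> \<chi>]) [u] \<in> carrier (alg A (Tgt C \<psi>))"
    "F 1 1 (Tgt C \<psi>, [\<psi>]) [act A \<chi> u] \<in> carrier (alg A (Tgt C \<psi>))"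
    using act_closed[OF x(1)] cochain_11_closed[OF F x(2,4)] cochain_11_closed[OF F c(1)] x c
      cochain_11_closed[OF F x(1), of "act A \<chi> u"] act_closed[OF x(2,4)] by simp_all
  have t: "?t 0 = act A \<psi> (F 1 1 (Tgt C \<chi>, [\<chi>]) [u])" "?t 1 = F 1 1 (Tgt C \<psi>, [Comp C \<psi> \<chi>]) [u]"
    "?t 2 = F 1 1 (Tgt C \<psi>, [\<psi>]) [act A \<chi> u]"
    using x cl by (simp_all add: face_def seg_simps pull_def vtx_def act_ident src_obj tgt_obj numeral_2_eq_2[symmetric])
  have "delta_S C A F 2 1 ?\<phi> [u] = (\<Oplus>\<^bsub>alg A (Tgt C \<psi>)\<^esub>i\<in>{0, 1, 2}. [((- 1) ^ i :: int)] \<cdot>\<^bsub>alg A (Tgt C \<psi>)\<^esub> ?t i)"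
    unfolding delta_S_def v0 atLeastAtMost_0_1(3)[symmetric] by (simp add: numeral_2_eq_2)
  also have "\<dots> = ([((- 1) ^ 0 :: int)] \<cdot>\<^bsub>alg A (Tgt C \<psi>)\<^esub> ?t 0) \<oplus>\<^bsub>alg A (Tgt C \<psi>)\<^esub>
      (([((- 1) ^ 1 :: int)] \<cdot>\<^bsub>alg A (Tgt C \<psi>)\<^esub> ?t 1) \<oplus>\<^bsub>alg A (Tgt C \<psi>)\<^esub> ([((- 1) ^ 2 :: int)] \<cdot>\<^bsub>alg A (Tgt C \<psi>)\<^esub> ?t 2))"
    by (subst M.finsum_insert, simp, simp, use t cl in \<open>auto intro!: M.add.int_pow_closed\<close>)
  also have "\<dots> = act A \<psi> (F 1 1 (Tgt C \<chi>, [\<chi>]) [u]) \<oplus>\<^bsub>alg A (Tgt C \<psi>)\<^esub>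
    (\<ominus>\<^bsub>alg A (Tgt C \<psi>)\<^esub> F 1 1 (Tgt C \<psi>, [Comp C \<psi> \<chi>]) [u] \<oplus>\<^bsub>alg A (Tgt C \<psi>)\<^esub>
     F 1 1 (Tgt C \<psi>, [\<psi>]) [act A \<chi> u])"
    unfolding t using cl by (simp add: M.add_pow_pm1)
  finally show ?thesis .
qed

end

section \<open>Comparison with the axioms of the deformed diagram\<close>

lemma (in abelian_group) eq_iff_by_difference:
  assumes "x \<in> carrier G" "y \<in> carrier G" "d = y \<ominus> x" shows "d = \<zero> \<longleftrightarrow> x = y"
proof
  assume "d = \<zero>"
  have "y = (y \<ominus> x) \<oplus> x" using assms(1,2) by (simp add: minus_eq a_assoc l_neg)
  then show "x = y" using \<open>d = \<zero>\<close> assms by simp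
qed (use assms in \<open>simp add: minus_eq r_neg\<close>)

text \<open>Serves as a simplification rule: after sorting by commutativity, an element and its
  negative can end up with one term between them, out of reach of \<open>r_neg1\<close> and
  \<open>r_neg2\<close>.\<close>

lemma (in abelian_group) cancel_across:
  "\<lbrakk>x \<in> carrier G; y \<in> carrier G; z \<in> carrier G\<rbrakk> \<Longrightarrow> x \<oplus> (y \<oplus> (\<ominus> x \<oplus> z)) = y \<oplus> z"
  by (subst a_lcomm) (simp_all add: r_neg2)

text \<open>The axioms of a module speak only of the carrier, addition, zero and scalar action, so
  they transfer unchanged to a new product.\<close>

lemma module_mult_update:
  assumes "module R M" shows "module R (M\<lparr>mult := h\<rparr>)"
proof -
  interpret module R M by fact
  have "abelian_group M" by unfold_locales
  then have "abelian_group (M\<lparr>mult := h\<rparr>)"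
    by (simp add: abelian_group_def abelian_group_axioms_def abelian_monoid_def)
  moreover have "cring R" by unfold_locales
  ultimately show ?thesis
    by (intro module.intro module_axioms.intro)
       (simp_all add: smult_l_distr smult_r_distr smult_assoc1)
qed

context algebra_diagram
begin

definition deformed_mult :: "('o, 'm, 'a) gcochain \<Rightarrow> 'o \<Rightarrow> 'a \<Rightarrow> 'a \<Rightarrow> 'a" where
  "deformed_mult F x a b = a \<otimes>\<^bsub>alg A x\<^esub> b \<oplus>\<^bsub>alg A x\<^esub> F 0 2 (x, []) [a, b]"

definition deformed_act :: "('o, 'm, 'a) gcochain \<Rightarrow> 'm \<Rightarrow> 'a \<Rightarrow> 'a" where
  "deformed_act F \<psi> a = act A \<psi> a \<oplus>\<^bsub>alg A (Tgt C \<psi>)\<^esub> F 1 1 (Tgt C \<psi>, [\<psi>]) [a]"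

lemma deformed_diagram_simps:
  "alg (deformed_diagram C A (F 0 2) (F 1 1)) x = (alg A x)\<lparr>mult := deformed_mult F x\<rparr>"
  "act (deformed_diagram C A (F 0 2) (F 1 1)) \<psi> = deformed_act F \<psi>"
  by (simp_all add: deformed_diagram_def deformed_mult_def[abs_def] deformed_act_def[abs_def])

context
  fixes F :: "('o, 'm, 'a) gcochain"
  assumes F: "degree_one R C A F"
begin

text \<open>The argument family of \<open>delta_H\<close> and of the second summand of
  \<open>P_op\<close>.\<close>

private abbreviation (input) "mF \<equiv> \<lambda>c::nat. if c = 1 then mhat A else F"

private lemma mF: "degree_one R C A (mF c)"
  using F mhat_degree_one by simp

private lemma DF: "F p q \<in> cochains R C A p q" "mhat A p q \<in> cochains R C A p q"
  using degree_oneD(1) F mhat_degree_one by auto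

context
  fixes \<phi> p q as
  assumes s: "\<phi> \<in> strings C p" "as \<in> tuples (alg A (vtx C \<phi> p)) q"
begin

interpretation M: abelian_group "alg A (vtx C \<phi> 0)" using M_abelian vtx_obj[OF s(1)] by blast

text \<open>The prefactor is 1: the exponent \<open>1 + n * (n - 1) div 2\<close> is 2 for
  \<open>n = 2\<close>, and it is 4 for \<open>n = 3\<close> in \<open>P0_op_3\<close>.\<close>

private lemma P0_op_2:
  assumes "\<And>c. degree_one R C A (G c)"
  shows "P0_op C A 2 G p q \<phi> as = quilt_op C A 2 quilt_B G p q \<phi> as"
proof -
  have "quilt_op C A 2 quilt_B G p q \<phi> as \<in> carrier (alg A (vtx C \<phi> 0))"
    unfolding quilt_B_edge_tree by (rule quilt_op_closed[OF edge_quilt assms s]) simp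
  then show ?thesis
    unfolding P0_op_def P0_quilts_2 by (simp add: M.finsum_one M.add_pow_pm1)
qed

private lemma P0_op_3:
  assumes "\<And>c. degree_one R C A (G c)"
  shows "P0_op C A 3 G p q \<phi> as = quilt_op C A 3 cherry_quilt G p q \<phi> as"
proof -
  have "quilt_op C A 3 cherry_quilt G p q \<phi> as \<in> carrier (alg A (vtx C \<phi> 0))"
    by (rule quilt_op_closed[OF cherry_quilt_quilt assms s])
  then show ?thesis
    unfolding P0_op_def P0_quilts_3 by (simp add: M.finsum_one M.add_pow_pm1)
qed

private lemma P_op_2:
  "P_op C A 2 (\<lambda>_. F) p q \<phi> as = quilt_op C A 2 quilt_B (\<lambda>_. F) p q \<phi> as \<oplus>\<^bsub>alg A (vtx C \<phi> 0)\<^esub>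
     quilt_op C A 3 cherry_quilt mF p q \<phi> as"
proof -
  have "Suc 2 = 3" by simp
  then show ?thesis unfolding P_op_def using P0_op_2[OF F] P0_op_3[OF mF] by simp
qed

private lemma P_op_3: "P_op C A 3 (\<lambda>_. F) p q \<phi> as = quilt_op C A 3 cherry_quilt (\<lambda>_. F) p q \<phi> as"
proof -
  have "P0_op C A (Suc 3) mF p q \<phi> as = \<zero>\<^bsub>alg A (vtx C \<phi> 0)\<^esub>"
    by (rule P0_op_arity_ge_4[OF _ mF s]) simp
  moreover have "quilt_op C A 3 cherry_quilt (\<lambda>_. F) p q \<phi> as \<in> carrier (alg A (vtx C \<phi> 0))"
    by (rule quilt_op_closed[OF cherry_quilt_quilt F s])
  ultimately show ?thesis unfolding P_op_def P0_op_3[OF F] by simp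
qed

lemma P_op_arity_ge_4:
  assumes "4 \<le> n" shows "P_op C A n (\<lambda>_. F) p q \<phi> as = \<zero>\<^bsub>alg A (vtx C \<phi> 0)\<^esub>"
  unfolding P_op_def using P0_op_arity_ge_4[OF _ F s, of n] P0_op_arity_ge_4[OF _ mF s, of "Suc n"] assms
  by simp

lemma P_op_closed: "n \<in> {2, 3} \<Longrightarrow> P_op C A n (\<lambda>_. F) p q \<phi> as \<in> carrier (alg A (vtx C \<phi> 0))"
  using quilt_op_closed[OF cherry_quilt_quilt _ s, of "\<lambda>_. F"] quilt_op_closed[OF cherry_quilt_quilt _ s, of mF]
    quilt_op_closed[OF edge_quilt[of 1 2] _ s, of "\<lambda>_. F"] F mF P_op_2 P_op_3
  unfolding quilt_B_edge_tree by auto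

lemma mc_term_expand:
  "mc_term C A F p q \<phi> as =
    (delta_S C A F p q \<phi> as \<oplus>\<^bsub>alg A (vtx C \<phi> 0)\<^esub>
      (quilt_op C A 2 quilt_B mF p q \<phi> as \<ominus>\<^bsub>alg A (vtx C \<phi> 0)\<^esub> quilt_op C A 2 quilt_B' mF p q \<phi> as))
    \<oplus>\<^bsub>alg A (vtx C \<phi> 0)\<^esub>
    ((quilt_op C A 2 quilt_B (\<lambda>_. F) p q \<phi> as \<oplus>\<^bsub>alg A (vtx C \<phi> 0)\<^esub> quilt_op C A 3 cherry_quilt mF p q \<phi> as)
      \<oplus>\<^bsub>alg A (vtx C \<phi> 0)\<^esub> quilt_op C A 3 cherry_quilt (\<lambda>_. F) p q \<phi> as)"
  unfolding mc_term_def P_op_2 P_op_3 delta_def delta_H_def ..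

lemma mc_term_other:
  assumes "(p, q) \<notin> {(0, 3), (1, 2), (2, 1)}"
  shows "mc_term C A F p q \<phi> as = \<zero>\<^bsub>alg A (vtx C \<phi> 0)\<^esub>"
proof -
  have "delta_S C A F p q \<phi> as = \<zero>\<^bsub>alg A (vtx C \<phi> 0)\<^esub>"
    by (rule delta_S_zero[OF s], rule degree_oneD(2)[OF F]) (use assms in auto)
  moreover have "quilt_op C A 3 cherry_quilt G p q \<phi> as = \<zero>\<^bsub>alg A (vtx C \<phi> 0)\<^esub>"
    if "\<And>c. degree_one R C A (G c)" for G
    using quilt_op_cherry_other[OF that s] assms by simp
  moreover have "quilt_op C A 2 quilt_B G p q \<phi> as = \<zero>\<^bsub>alg A (vtx C \<phi> 0)\<^esub>"
    "quilt_op C A 2 quilt_B' G p q \<phi> as = \<zero>\<^bsub>alg A (vtx C \<phi> 0)\<^esub>"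
    if "\<And>c. degree_one R C A (G c)" for G
    unfolding quilt_B_edge_tree quilt_B'_edge_tree
    by (rule quilt_op_pair_other[OF _ that that s assms]; simp)+
  ultimately show ?thesis
    unfolding mc_term_expand using F mF by (simp add: M.minus_eq)
qed

end

text \<open>The index set in \<open>maurer_cartan\<close> depends on \<open>F\<close> and may be
  smaller than \<open>{2, 3}\<close>; the missing indices contribute zero, so the sum may be taken
  over both.\<close>

lemma maurer_cartan_iff:
  "maurer_cartan C A F \<longleftrightarrow> (\<forall>p q. vanishes C A p q (mc_term C A F p q))"
proof -
  define S where "S = {n. 2 \<le> n \<and> (\<exists>p q. \<not> vanishes C A p q (P_op C A n (\<lambda>_. F) p q))}"
  have S: "S \<subseteq> {2, 3}"
  proof
    fix n assume n: "n \<in> S"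
    have "\<not> 4 \<le> n"
    proof
      assume "4 \<le> n"
      then have "vanishes C A p q (P_op C A n (\<lambda>_. F) p q)" for p q
        unfolding vanishes_def using P_op_arity_ge_4 by blast
      with n show False unfolding S_def by blast
    qed
    moreover have "2 \<le> n" using n unfolding S_def by blast
    ultimately show "n \<in> {2, 3}" by auto
  qed
  have fin: "finite S" using S finite_subset by blast
  have eq: "delta C A F p q \<phi> as \<oplus>\<^bsub>alg A (vtx C \<phi> 0)\<^esub>
      (\<Oplus>\<^bsub>alg A (vtx C \<phi> 0)\<^esub>n\<in>S. P_op C A n (\<lambda>_. F) p q \<phi> as) = mc_term C A F p q \<phi> as"
    if s: "\<phi> \<in> strings C p" "as \<in> tuples (alg A (vtx C \<phi> p)) q" for p q \<phi> as
  proof -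
    interpret M: abelian_group "alg A (vtx C \<phi> 0)" using M_abelian vtx_obj[OF s(1)] by blast
    have "(\<Oplus>\<^bsub>alg A (vtx C \<phi> 0)\<^esub>n\<in>S. P_op C A n (\<lambda>_. F) p q \<phi> as)
        = (\<Oplus>\<^bsub>alg A (vtx C \<phi> 0)\<^esub>n\<in>{2, 3}. P_op C A n (\<lambda>_. F) p q \<phi> as)"
    proof (rule M.add.finprod_mono_neutral_cong_left)
      show "P_op C A n (\<lambda>_. F) p q \<phi> as = \<zero>\<^bsub>alg A (vtx C \<phi> 0)\<^esub>" if "n \<in> {2, 3} - S" for n
      proof -
        have "vanishes C A p q (P_op C A n (\<lambda>_. F) p q)"
          using that unfolding S_def by auto
        then show ?thesis using s unfolding vanishes_def by blast
      qed
      show "(\<lambda>n. P_op C A n (\<lambda>_. F) p q \<phi> as) \<in> {2, 3} \<rightarrow> carrier (alg A (vtx C \<phi> 0))"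
        using P_op_closed[OF s] by blast
    qed (use S in simp_all)
    also have "\<dots> = P_op C A 2 (\<lambda>_. F) p q \<phi> as \<oplus>\<^bsub>alg A (vtx C \<phi> 0)\<^esub> P_op C A 3 (\<lambda>_. F) p q \<phi> as"
      by (rule M.finsum_two) (use P_op_closed[OF s] in auto)
    finally show ?thesis unfolding mc_term_def by simp
  qed
  show ?thesis
    unfolding maurer_cartan_def S_def[symmetric] Let_def
    using fin eq by (auto simp: vanishes_def)
qed

private lemma F02_closed:
  "\<lbrakk>x \<in> Obj C; a \<in> carrier (alg A x); b \<in> carrier (alg A x)\<rbrakk> \<Longrightarrow> F 0 2 (x, []) [a, b] \<in> carrier (alg A x)"
  using cochain_02_closed[OF DF(1)] .

private lemma F11_closed:
  "\<lbrakk>\<psi> \<in> Mor C; a \<in> carrier (alg A (Src C \<psi>))\<rbrakk> \<Longrightarrow> F 1 1 (Tgt C \<psi>, [\<psi>]) [a] \<in> carrier (alg A (Tgt C \<psi>))"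
  using cochain_11_closed[OF DF(1)] .

private lemma F02_add:
  assumes "x \<in> Obj C" "a \<in> carrier (alg A x)" "a' \<in> carrier (alg A x)" "b \<in> carrier (alg A x)"
  shows "F 0 2 (x, []) [a \<oplus>\<^bsub>alg A x\<^esub> a', b] = F 0 2 (x, []) [a, b] \<oplus>\<^bsub>alg A x\<^esub> F 0 2 (x, []) [a', b]"
    "F 0 2 (x, []) [b, a \<oplus>\<^bsub>alg A x\<^esub> a'] = F 0 2 (x, []) [b, a] \<oplus>\<^bsub>alg A x\<^esub> F 0 2 (x, []) [b, a']"
  using cochain_02[OF DF(1) assms(1)] assms(2-) unfolding multilinear_2 by blast+

private lemma F02_smult:
  assumes "x \<in> Obj C" "r \<in> carrier R" "a \<in> carrier (alg A x)" "b \<in> carrier (alg A x)"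
  shows "F 0 2 (x, []) [r \<odot>\<^bsub>alg A x\<^esub> a, b] = r \<odot>\<^bsub>alg A x\<^esub> F 0 2 (x, []) [a, b]"
    "F 0 2 (x, []) [b, r \<odot>\<^bsub>alg A x\<^esub> a] = r \<odot>\<^bsub>alg A x\<^esub> F 0 2 (x, []) [b, a]"
  using cochain_02[OF DF(1) assms(1)] assms(2-) unfolding multilinear_2 by blast+

private lemma F11_linear:
  assumes "\<psi> \<in> Mor C"
  shows "\<lbrakk>a \<in> carrier (alg A (Src C \<psi>)); b \<in> carrier (alg A (Src C \<psi>))\<rbrakk> \<Longrightarrow>
      F 1 1 (Tgt C \<psi>, [\<psi>]) [a \<oplus>\<^bsub>alg A (Src C \<psi>)\<^esub> b]
      = F 1 1 (Tgt C \<psi>, [\<psi>]) [a] \<oplus>\<^bsub>alg A (Tgt C \<psi>)\<^esub> F 1 1 (Tgt C \<psi>, [\<psi>]) [b]"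
    "\<lbrakk>r \<in> carrier R; a \<in> carrier (alg A (Src C \<psi>))\<rbrakk> \<Longrightarrow>
      F 1 1 (Tgt C \<psi>, [\<psi>]) [r \<odot>\<^bsub>alg A (Src C \<psi>)\<^esub> a] = r \<odot>\<^bsub>alg A (Tgt C \<psi>)\<^esub> F 1 1 (Tgt C \<psi>, [\<psi>]) [a]"
  using cochain_11[OF DF(1) assms] unfolding multilinear_1 by blast+

lemma deformed_mult_closed:
  "\<lbrakk>x \<in> Obj C; a \<in> carrier (alg A x); b \<in> carrier (alg A x)\<rbrakk> \<Longrightarrow> deformed_mult F x a b \<in> carrier (alg A x)"
  unfolding deformed_mult_def using M_abelian[of x] mult_carrier F02_closed
  by (simp add: abelian_groupE(1))

lemma deformed_act_closed:
  "\<lbrakk>\<psi> \<in> Mor C; a \<in> carrier (alg A (Src C \<psi>))\<rbrakk> \<Longrightarrow> deformed_act F \<psi> a \<in> carrier (alg A (Tgt C \<psi>))"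
  unfolding deformed_act_def using M_abelian[OF tgt_obj, of \<psi>] act_closed F11_closed
  by (simp add: abelian_groupE(1))

text \<open>\<open>delta_H\<close> supplies the terms linear in \<open>f\<close>, and
  \<open>B\<close> on \<open>(F, F)\<close> those with \<open>f\<close> nested in \<open>f\<close>.
  The associator of the original product, which completes the difference, is zero by
  \<open>mult_assoc\<close>.\<close>

lemma mc_term_03_iff:
  assumes x: "x \<in> Obj C" "u \<in> carrier (alg A x)" "v \<in> carrier (alg A x)" "w \<in> carrier (alg A x)"
  shows "mc_term C A F 0 3 (x, []) [u, v, w] = \<zero>\<^bsub>alg A x\<^esub> \<longleftrightarrow>
    deformed_mult F x (deformed_mult F x u v) w = deformed_mult F x u (deformed_mult F x v w)"
proof -
  interpret assoc_algebra R "alg A x" using alg_algebra[OF x(1)] .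
  have v0: "vtx C (x, []) 0 = x" by (simp add: vtx_def)
  have s: "(x, []) \<in> strings C 0" "[u, v, w] \<in> tuples (alg A (vtx C (x, []) 0)) 3"
    using x by (auto simp: strings_0 tuples_3 v0)
  have cl: "F 0 2 (x, []) [a, b] \<in> carrier (alg A x)" "a \<otimes>\<^bsub>alg A x\<^esub> b \<in> carrier (alg A x)"
    if "a \<in> carrier (alg A x)" "b \<in> carrier (alg A x)" for a b
    using that x(1) F02_closed mult_closed by auto
  have z: "delta_S C A F 0 3 (x, []) [u, v, w] = \<zero>\<^bsub>alg A x\<^esub>"
    "quilt_op C A 3 cherry_quilt mF 0 3 (x, []) [u, v, w] = \<zero>\<^bsub>alg A x\<^esub>"
    "quilt_op C A 3 cherry_quilt (\<lambda>_. F) 0 3 (x, []) [u, v, w] = \<zero>\<^bsub>alg A x\<^esub>"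
    using delta_S_zero[OF s, of F] quilt_op_cherry_other[OF mF s] quilt_op_cherry_other[OF F s]
    unfolding v0 by simp_all
  note vals = z quilt_op_B_03[where F=mF, OF mF mF x] quilt_op_B'_03[where F=mF, OF mF mF x]
    quilt_op_B_03[where F="\<lambda>_. F", OF F F x]
  have "mc_term C A F 0 3 (x, []) [u, v, w] = 
      deformed_mult F x u (deformed_mult F x v w) \<ominus>\<^bsub>alg A x\<^esub> deformed_mult F x (deformed_mult F x u v) w"
    unfolding mc_term_expand[OF s] v0 deformed_mult_def vals
    using x by (simp add: mhat_02 cl F02_add mult_add_left mult_add_right mult_assoc
        M.minus_eq M.minus_add M.a_ac M.r_neg1 M.r_neg2)
  then show ?thesis
    by (rule M.eq_iff_by_difference[rotated 2]) (use deformed_mult_closed x in auto)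
qed

text \<open>\<open>delta_S\<close> compares \<open>f\<close> at the two ends of
  \<open>\<psi>\<close>, \<open>delta_H\<close> gives the terms linear in \<open>g\<close>, and
  \<open>B\<close> on \<open>(F, F)\<close> those containing \<open>f\<close> and \<open>g\<close>
  once each. The cherry quilt gives the terms with two values of \<open>g\<close>, combined by the
  original product and by \<open>f\<close>.\<close>

lemma mc_term_12_iff:
  assumes x: "\<psi> \<in> Mor C" "u \<in> carrier (alg A (Src C \<psi>))" "v \<in> carrier (alg A (Src C \<psi>))"
  shows "mc_term C A F 1 2 (Tgt C \<psi>, [\<psi>]) [u, v] = \<zero>\<^bsub>alg A (Tgt C \<psi>)\<^esub> \<longleftrightarrow>
    deformed_act F \<psi> (deformed_mult F (Src C \<psi>) u v)
    = deformed_mult F (Tgt C \<psi>) (deformed_act F \<psi> u) (deformed_act F \<psi> v)"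
proof -
  let ?\<phi> = "(Tgt C \<psi>, [\<psi>])"
  interpret assoc_algebra R "alg A (Tgt C \<psi>)" using alg_algebra[OF tgt_obj[OF x(1)]] .
  have v0: "vtx C ?\<phi> 0 = Tgt C \<psi>" "vtx C ?\<phi> (Suc 0) = Src C \<psi>" by (simp_all add: vtx_def)
  have s: "?\<phi> \<in> strings C 1" "[u, v] \<in> tuples (alg A (vtx C ?\<phi> 1)) 2"
    using x by (auto simp: strings_1[simplified] tuples_2 v0)
  have obj: "Src C \<psi> \<in> Obj C" "Tgt C \<psi> \<in> Obj C" using x src_obj tgt_obj by auto
  have van: "vanishes C A 1 1 (mF 1 1 1)" using mhat_vanishes_11 by simp
  have m11: "mhat A 1 1 (Tgt C \<psi>, [\<psi>]) as = \<zero>\<^bsub>alg A (Tgt C \<psi>)\<^esub>" for as by (simp add: mhat_def)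
  have eqs: "(mF 1) = mhat A" "(mF 2) = F" "(mF 3) = F" by simp_all
  note vals = delta_S_12[where F=F, OF DF(1) x] quilt_op_B_12[where F=mF, OF mF mF x] quilt_op_B'_12[where F=mF, OF mF mF x van]
    quilt_op_B_12[where F="\<lambda>_. F", OF F F x] quilt_op_cherry_12[where F=mF, OF mF x] quilt_op_cherry_12[where F="\<lambda>_. F", OF F x]
  have cl: "act A \<psi> u \<in> carrier (alg A (Tgt C \<psi>))" "act A \<psi> v \<in> carrier (alg A (Tgt C \<psi>))"
    "F 1 1 ?\<phi> [u] \<in> carrier (alg A (Tgt C \<psi>))" "F 1 1 ?\<phi> [v] \<in> carrier (alg A (Tgt C \<psi>))"
    "u \<otimes>\<^bsub>alg A (Src C \<psi>)\<^esub> v \<in> carrier (alg A (Src C \<psi>))" "F 0 2 (Src C \<psi>, []) [u, v] \<in> carrier (alg A (Src C \<psi>))"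
    using x obj act_closed F11_closed mult_carrier F02_closed by auto
  have cl2: "act A \<psi> (F 0 2 (Src C \<psi>, []) [u, v]) \<in> carrier (alg A (Tgt C \<psi>))"
    "F 1 1 ?\<phi> [u \<otimes>\<^bsub>alg A (Src C \<psi>)\<^esub> v] \<in> carrier (alg A (Tgt C \<psi>))"
    "F 1 1 ?\<phi> [F 0 2 (Src C \<psi>, []) [u, v]] \<in> carrier (alg A (Tgt C \<psi>))"
    using act_closed[OF x(1)] F11_closed[OF x(1)] cl by auto
  have "mc_term C A F 1 2 ?\<phi> [u, v] = deformed_act F \<psi> (deformed_mult F (Src C \<psi>) u v)
      \<ominus>\<^bsub>alg A (Tgt C \<psi>)\<^esub> deformed_mult F (Tgt C \<psi>) (deformed_act F \<psi> u) (deformed_act F \<psi> v)"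
    unfolding mc_term_expand[OF s] v0 vals eqs mhat_02 m11 deformed_act_def deformed_mult_def
      act_add[OF x(1) cl(5,6)] act_mult[OF x] F11_linear(1)[OF x(1) cl(5,6)]
    using cl cl2 obj
    by (simp add: F02_closed F02_add mult_closed mult_add_left mult_add_right M.cancel_across
        M.minus_eq M.minus_add M.a_ac M.r_neg1 M.r_neg2)
  then have "mc_term C A F 1 2 ?\<phi> [u, v] = \<zero>\<^bsub>alg A (Tgt C \<psi>)\<^esub> \<longleftrightarrow>
    deformed_mult F (Tgt C \<psi>) (deformed_act F \<psi> u) (deformed_act F \<psi> v)
    = deformed_act F \<psi> (deformed_mult F (Src C \<psi>) u v)"
    by (rule M.eq_iff_by_difference[rotated 2])
       (use x obj deformed_mult_closed deformed_act_closed in auto)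
  then show ?thesis by (simp only: eq_commute)
qed

text \<open>\<open>delta_S\<close> supplies the terms linear in \<open>g\<close>, and
  \<open>B\<close> on \<open>(F, F)\<close> the composite of two values of \<open>g\<close>; the
  part without \<open>g\<close> cancels by functoriality of \<open>A\<close>.\<close>

lemma mc_term_21_iff:
  assumes x: "\<psi> \<in> Mor C" "\<chi> \<in> Mor C" "Src C \<psi> = Tgt C \<chi>" "u \<in> carrier (alg A (Src C \<chi>))"
  shows "mc_term C A F 2 1 (Tgt C \<psi>, [\<psi>, \<chi>]) [u] = \<zero>\<^bsub>alg A (Tgt C \<psi>)\<^esub> \<longleftrightarrow>
    deformed_act F (Comp C \<psi> \<chi>) u = deformed_act F \<psi> (deformed_act F \<chi> u)"
proof -
  let ?\<phi> = "(Tgt C \<psi>, [\<psi>, \<chi>])"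
  interpret M: abelian_group "alg A (Tgt C \<psi>)" using M_abelian[OF tgt_obj[OF x(1)]] .
  have v0: "vtx C ?\<phi> 0 = Tgt C \<psi>" "vtx C ?\<phi> 2 = Src C \<chi>" by (simp_all add: vtx_def numeral_2_eq_2)
  have s: "?\<phi> \<in> strings C 2" "[u] \<in> tuples (alg A (vtx C ?\<phi> 2)) 1"
    using x by (auto simp: strings_2 tuples_1[simplified] v0)
  have c: "Comp C \<psi> \<chi> \<in> Mor C" "Src C (Comp C \<psi> \<chi>) = Src C \<chi>" "Tgt C (Comp C \<psi> \<chi>) = Tgt C \<psi>"
    using x by (simp_all add: comp_mor comp_src comp_tgt)
  have van: "vanishes C A 1 1 (mF 1 1 1)" using mhat_vanishes_11 by simp
  \<comment> \<open>The \<open>(1, 1)\<close> component of the multiplication is zero, which removes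
    \<open>B\<close> on \<open>(mhat A, F)\<close>.\<close>
  have m11: "mhat A 1 1 (Tgt C \<psi>, [\<psi>]) as = \<zero>\<^bsub>alg A (Tgt C \<psi>)\<^esub>" for as by (simp add: mhat_def)
  have eqs: "(mF 1) = mhat A" "(mF 2) = F" by simp_all
  have z: "quilt_op C A 3 cherry_quilt mF 2 1 ?\<phi> [u] = \<zero>\<^bsub>alg A (Tgt C \<psi>)\<^esub>"
    "quilt_op C A 3 cherry_quilt (\<lambda>_. F) 2 1 ?\<phi> [u] = \<zero>\<^bsub>alg A (Tgt C \<psi>)\<^esub>"
    "quilt_op C A 2 quilt_B' mF 2 1 ?\<phi> [u] = \<zero>\<^bsub>alg A (Tgt C \<psi>)\<^esub>"
    using quilt_op_cherry_other[where F=mF, OF mF s] quilt_op_cherry_other[where F="\<lambda>_. F", OF F s]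
      quilt_op_B'_21[where F=mF, OF mF mF s van] unfolding v0 by simp_all
  note vals = z delta_S_21[where F=F, OF DF(1) x] quilt_op_B_21[where F=mF, OF mF mF x] quilt_op_B_21[where F="\<lambda>_. F", OF F F x]
  have cl: "act A \<chi> u \<in> carrier (alg A (Src C \<psi>))" "F 1 1 (Tgt C \<chi>, [\<chi>]) [u] \<in> carrier (alg A (Src C \<psi>))"
    unfolding x(3) using x act_closed F11_closed by auto
  have cl2: "act A \<psi> (act A \<chi> u) \<in> carrier (alg A (Tgt C \<psi>))"
    "act A \<psi> (F 1 1 (Tgt C \<chi>, [\<chi>]) [u]) \<in> carrier (alg A (Tgt C \<psi>))"
    "F 1 1 (Tgt C \<psi>, [\<psi>]) [act A \<chi> u] \<in> carrier (alg A (Tgt C \<psi>))"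
    "F 1 1 (Tgt C \<psi>, [\<psi>]) [F 1 1 (Tgt C \<chi>, [\<chi>]) [u]] \<in> carrier (alg A (Tgt C \<psi>))"
    "F 1 1 (Tgt C \<psi>, [Comp C \<psi> \<chi>]) [u] \<in> carrier (alg A (Tgt C \<psi>))"
    using act_closed[OF x(1)] F11_closed[OF x(1)] F11_closed[OF c(1)] cl x c by simp_all
  have ac: "act A (Comp C \<psi> \<chi>) u = act A \<psi> (act A \<chi> u)" using act_comp x by simp
  have h: "deformed_act F \<chi> u = act A \<chi> u \<oplus>\<^bsub>alg A (Src C \<psi>)\<^esub> F 1 1 (Tgt C \<chi>, [\<chi>]) [u]"
    unfolding deformed_act_def x(3) ..
  have "mc_term C A F 2 1 ?\<phi> [u] = deformed_act F \<psi> (deformed_act F \<chi> u)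
      \<ominus>\<^bsub>alg A (Tgt C \<psi>)\<^esub> deformed_act F (Comp C \<psi> \<chi>) u"
    unfolding mc_term_expand[OF s] v0 vals eqs m11 h
    unfolding deformed_act_def c ac act_add[OF x(1) cl] F11_linear(1)[OF x(1) cl]
    using cl2 by (simp add: M.minus_eq M.minus_add M.a_ac M.r_neg1 M.r_neg2)
  then show ?thesis
    by (rule M.eq_iff_by_difference[rotated 2])
       (use x c deformed_act_closed[OF c(1)] deformed_act_closed[OF x(2,4)] deformed_act_closed[OF x(1)] in auto)
qed

lemma mc_term_vanishes_iff:
  "(\<forall>p q. vanishes C A p q (mc_term C A F p q)) \<longleftrightarrow>
    (\<forall>x\<in>Obj C. \<forall>u\<in>carrier (alg A x). \<forall>v\<in>carrier (alg A x). \<forall>w\<in>carrier (alg A x).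
      deformed_mult F x (deformed_mult F x u v) w = deformed_mult F x u (deformed_mult F x v w)) \<and>
    (\<forall>\<psi>\<in>Mor C. \<forall>u\<in>carrier (alg A (Src C \<psi>)). \<forall>v\<in>carrier (alg A (Src C \<psi>)).
      deformed_act F \<psi> (deformed_mult F (Src C \<psi>) u v)
      = deformed_mult F (Tgt C \<psi>) (deformed_act F \<psi> u) (deformed_act F \<psi> v)) \<and>
    (\<forall>\<psi>\<in>Mor C. \<forall>\<chi>\<in>Mor C. Src C \<psi> = Tgt C \<chi> \<longrightarrow> (\<forall>u\<in>carrier (alg A (Src C \<chi>)).
      deformed_act F (Comp C \<psi> \<chi>) u = deformed_act F \<psi> (deformed_act F \<chi> u)))"
  (is "?L \<longleftrightarrow> ?assoc \<and> ?hom \<and> ?comp")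
proof -
  have "vanishes C A 0 3 (mc_term C A F 0 3) \<longleftrightarrow> ?assoc"
  proof -
    have "vanishes C A 0 3 (mc_term C A F 0 3) \<longleftrightarrow> (\<forall>x\<in>Obj C. \<forall>u\<in>carrier (alg A x).
        \<forall>v\<in>carrier (alg A x). \<forall>w\<in>carrier (alg A x). mc_term C A F 0 3 (x, []) [u, v, w] = \<zero>\<^bsub>alg A x\<^esub>)"
      unfolding vanishes_def Ball_def strings_0 tuples_3 by (auto simp: vtx_def)
    then show ?thesis using mc_term_03_iff by simp
  qed
  moreover have "vanishes C A 1 2 (mc_term C A F 1 2) \<longleftrightarrow> ?hom"
  proof -
    have "vanishes C A 1 2 (mc_term C A F 1 2) \<longleftrightarrow> (\<forall>\<psi>\<in>Mor C. \<forall>u\<in>carrier (alg A (Src C \<psi>)).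
        \<forall>v\<in>carrier (alg A (Src C \<psi>)). mc_term C A F 1 2 (Tgt C \<psi>, [\<psi>]) [u, v] = \<zero>\<^bsub>alg A (Tgt C \<psi>)\<^esub>)"
      unfolding vanishes_def Ball_def strings_1 tuples_2 by (auto simp: vtx_def)
    then show ?thesis using mc_term_12_iff by simp
  qed
  moreover have "vanishes C A 2 1 (mc_term C A F 2 1) \<longleftrightarrow> ?comp"
  proof -
    have "vanishes C A 2 1 (mc_term C A F 2 1) \<longleftrightarrow> (\<forall>\<psi>\<in>Mor C. \<forall>\<chi>\<in>Mor C. Src C \<psi> = Tgt C \<chi> \<longrightarrow>
        (\<forall>u\<in>carrier (alg A (Src C \<chi>)). mc_term C A F 2 1 (Tgt C \<psi>, [\<psi>, \<chi>]) [u] = \<zero>\<^bsub>alg A (Tgt C \<psi>)\<^esub>))"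
      unfolding vanishes_def Ball_def strings_2 tuples_1 by (auto simp: vtx_def numeral_2_eq_2)
    then show ?thesis using mc_term_21_iff by simp
  qed
  moreover have "?L \<longleftrightarrow> vanishes C A 0 3 (mc_term C A F 0 3) \<and> vanishes C A 1 2 (mc_term C A F 1 2) \<and>
      vanishes C A 2 1 (mc_term C A F 2 1)" (is "_ \<longleftrightarrow> ?R")
  proof
    assume R: ?R
    have "vanishes C A p q (mc_term C A F p q)" for p q
    proof (cases "(p, q) \<in> {(0, 3), (1, 2), (2, 1)}")
      case False
      then show ?thesis using mc_term_other unfolding vanishes_def by blast
    qed (use R in auto)
    then show ?L by blast
  qed blast
  ultimately show ?thesis by blast
qed

text \<open>Closure, bilinearity of the products and linearity of the maps follow from the
  multilinearity of the components of \<open>F\<close>, so only the four families of equations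
  remain.\<close>

lemma deformed_diagram_iff:
  "diagram_of_algebras R C (deformed_diagram C A (F 0 2) (F 1 1)) \<longleftrightarrow>
    (\<forall>x\<in>Obj C. \<forall>u\<in>carrier (alg A x). \<forall>v\<in>carrier (alg A x). \<forall>w\<in>carrier (alg A x).
      deformed_mult F x (deformed_mult F x u v) w = deformed_mult F x u (deformed_mult F x v w)) \<and>
    (\<forall>\<psi>\<in>Mor C. \<forall>u\<in>carrier (alg A (Src C \<psi>)). \<forall>v\<in>carrier (alg A (Src C \<psi>)).
      deformed_act F \<psi> (deformed_mult F (Src C \<psi>) u v)
      = deformed_mult F (Tgt C \<psi>) (deformed_act F \<psi> u) (deformed_act F \<psi> v)) \<and>
    (\<forall>x\<in>Obj C. \<forall>u\<in>carrier (alg A x). deformed_act F (Ident C x) u = u) \<and>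
    (\<forall>\<psi>\<in>Mor C. \<forall>\<chi>\<in>Mor C. Src C \<psi> = Tgt C \<chi> \<longrightarrow> (\<forall>u\<in>carrier (alg A (Src C \<chi>)).
      deformed_act F (Comp C \<psi> \<chi>) u = deformed_act F \<psi> (deformed_act F \<chi> u)))"
  (is "?L \<longleftrightarrow> ?assoc \<and> ?hom \<and> ?ident \<and> ?comp")
proof
  assume L: ?L
  interpret D: diagram_of_algebras R C "deformed_diagram C A (F 0 2) (F 1 1)" by (rule L)
  have ?assoc
    using assoc_algebra.mult_assoc[OF D.alg_algebra] unfolding deformed_diagram_simps by simp
  moreover have ?hom
    using D.act_hom unfolding deformed_diagram_simps algebra_hom_def by simp
  moreover have ?ident
    using D.act_ident unfolding deformed_diagram_simps by simp
  moreover have ?comp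
    using D.act_comp unfolding deformed_diagram_simps by simp
  ultimately show "?assoc \<and> ?hom \<and> ?ident \<and> ?comp" by blast
next
  assume *: "?assoc \<and> ?hom \<and> ?ident \<and> ?comp"
  show ?L
  proof (rule diagram_of_algebras.intro, unfold deformed_diagram_simps)
    fix x assume x: "x \<in> Obj C"
    interpret assoc_algebra R "alg A x" using alg_algebra[OF x] .
    have cl: "F 0 2 (x, []) [a, b] \<in> carrier (alg A x)" "a \<otimes>\<^bsub>alg A x\<^esub> b \<in> carrier (alg A x)"
      if "a \<in> carrier (alg A x)" "b \<in> carrier (alg A x)" for a b
      using that x F02_closed mult_closed by auto
    have "deformed_mult F x (a \<oplus>\<^bsub>alg A x\<^esub> b) c = deformed_mult F x a c \<oplus>\<^bsub>alg A x\<^esub> deformed_mult F x b c"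
      "deformed_mult F x c (a \<oplus>\<^bsub>alg A x\<^esub> b) = deformed_mult F x c a \<oplus>\<^bsub>alg A x\<^esub> deformed_mult F x c b"
      if "a \<in> carrier (alg A x)" "b \<in> carrier (alg A x)" "c \<in> carrier (alg A x)" for a b c
      using that x by (simp_all add: deformed_mult_def cl F02_add mult_add_left mult_add_right M.a_ac)
    moreover have "deformed_mult F x (r \<odot>\<^bsub>alg A x\<^esub> a) b = r \<odot>\<^bsub>alg A x\<^esub> deformed_mult F x a b"
      "deformed_mult F x a (r \<odot>\<^bsub>alg A x\<^esub> b) = r \<odot>\<^bsub>alg A x\<^esub> deformed_mult F x a b"
      if "r \<in> carrier R" "a \<in> carrier (alg A x)" "b \<in> carrier (alg A x)" for r a b
      using that x
      by (simp_all add: deformed_mult_def cl F02_smult mult_smult_left mult_smult_right smult_r_distr)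
    moreover have "deformed_mult F x (deformed_mult F x a b) c = deformed_mult F x a (deformed_mult F x b c)"
      if "a \<in> carrier (alg A x)" "b \<in> carrier (alg A x)" "c \<in> carrier (alg A x)" for a b c
      using that x * by blast
    ultimately show "assoc_algebra R ((alg A x)\<lparr>mult := deformed_mult F x\<rparr>)"
      using deformed_mult_closed[OF x]
      by (intro assoc_algebra.intro assoc_algebra_axioms.intro module_mult_update[OF M_module[OF x]]) simp_all
  next
    fix \<psi> assume \<psi>: "\<psi> \<in> Mor C"
    have obj: "Src C \<psi> \<in> Obj C" "Tgt C \<psi> \<in> Obj C" using \<psi> src_obj tgt_obj by auto
    interpret N: module R "alg A (Tgt C \<psi>)" using M_module[OF obj(2)] .
    have sm: "act A \<psi> (r \<odot>\<^bsub>alg A (Src C \<psi>)\<^esub> a) = r \<odot>\<^bsub>alg A (Tgt C \<psi>)\<^esub> act A \<psi> a"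
      if "r \<in> carrier R" "a \<in> carrier (alg A (Src C \<psi>))" for r a
      using act_hom[OF \<psi>] that unfolding algebra_hom_def by blast
    have cl: "act A \<psi> a \<in> carrier (alg A (Tgt C \<psi>))" "F 1 1 (Tgt C \<psi>, [\<psi>]) [a] \<in> carrier (alg A (Tgt C \<psi>))"
      if "a \<in> carrier (alg A (Src C \<psi>))" for a
      using that \<psi> act_closed F11_closed by auto
    have "deformed_act F \<psi> (a \<oplus>\<^bsub>alg A (Src C \<psi>)\<^esub> b) = deformed_act F \<psi> a \<oplus>\<^bsub>alg A (Tgt C \<psi>)\<^esub> deformed_act F \<psi> b"
      if "a \<in> carrier (alg A (Src C \<psi>))" "b \<in> carrier (alg A (Src C \<psi>))" for a b
      unfolding deformed_act_def act_add[OF \<psi> that] F11_linear(1)[OF \<psi> that]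
      using cl[OF that(1)] cl[OF that(2)] by (simp add: N.a_ac)
    moreover have "deformed_act F \<psi> (r \<odot>\<^bsub>alg A (Src C \<psi>)\<^esub> a) = r \<odot>\<^bsub>alg A (Tgt C \<psi>)\<^esub> deformed_act F \<psi> a"
      if "r \<in> carrier R" "a \<in> carrier (alg A (Src C \<psi>))" for r a
      unfolding deformed_act_def sm[OF that] F11_linear(2)[OF \<psi> that]
      using cl[OF that(2)] that(1) by (simp add: N.smult_r_distr)
    ultimately show "deformed_act F \<psi> \<in> algebra_hom R ((alg A (Src C \<psi>))\<lparr>mult := deformed_mult F (Src C \<psi>)\<rparr>)
        ((alg A (Tgt C \<psi>))\<lparr>mult := deformed_mult F (Tgt C \<psi>)\<rparr>)"
      unfolding algebra_hom_def using * \<psi> by (simp add: deformed_act_closed)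
  next
    fix x a assume "x \<in> Obj C" "a \<in> carrier ((alg A x)\<lparr>mult := deformed_mult F x\<rparr>)"
    then show "deformed_act F (Ident C x) a = a" using * by simp
  next
    fix \<psi> \<chi> a assume "\<psi> \<in> Mor C" "\<chi> \<in> Mor C" "Src C \<psi> = Tgt C \<chi>"
      "a \<in> carrier ((alg A (Src C \<chi>))\<lparr>mult := deformed_mult F (Src C \<chi>)\<rparr>)"
    moreover from this have "a \<in> carrier (alg A (Src C \<chi>))" by simp
    ultimately show "deformed_act F (Comp C \<psi> \<chi>) a = deformed_act F \<psi> (deformed_act F \<chi> a)"
      using * by blast
  qed
qed

text \<open>Beyond \<open>degree_one\<close>, reducedness restricts only the component in bidegree
  \<open>(1, 1)\<close>, on identity morphisms: a string of length 0 contains no morphism, and the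
  components in all other bidegrees vanish.\<close>

lemma reduced_iff_preserves_identities:
  "F \<in> reduced_asimplicial R C A \<longleftrightarrow>
    (\<forall>x\<in>Obj C. \<forall>u\<in>carrier (alg A x). deformed_act F (Ident C x) u = u)"
proof -
  have ident: "deformed_act F (Ident C x) u = u \<longleftrightarrow> F 1 1 (x, [Ident C x]) [u] = \<zero>\<^bsub>alg A x\<^esub>"
    if x: "x \<in> Obj C" and u: "u \<in> carrier (alg A x)" for x u
  proof -
    interpret M: abelian_group "alg A x" using M_abelian[OF x] .
    have "F 1 1 (x, [Ident C x]) [u] \<in> carrier (alg A x)"
      using F11_closed[OF ident_mor[OF x]] x u by (simp add: ident_src ident_tgt)
    then show ?thesis
      unfolding deformed_act_def ident_tgt[OF x] act_ident[OF x u]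
      using u by (metis M.add.l_cancel_one M.r_zero)
  qed
  show ?thesis
  proof
    assume red: "F \<in> reduced_asimplicial R C A"
    have "F 1 1 (x, [Ident C x]) [u] = \<zero>\<^bsub>alg A x\<^esub>" if x: "x \<in> Obj C" "u \<in> carrier (alg A x)" for x u
    proof -
      let ?\<phi> = "(x, [Ident C x])"
      have "?\<phi> \<in> strings C 1"
        unfolding strings_1 using x(1) ident_mor ident_tgt by force
      moreover have "[u] \<in> tuples (alg A (vtx C ?\<phi> 1)) 1"
        unfolding tuples_1 using x by (simp add: vtx_def ident_src)
      moreover have "set (snd ?\<phi>) \<inter> Ident C ` Obj C \<noteq> {}" using x(1) by simp
      ultimately have "F 1 1 ?\<phi> [u] = \<zero>\<^bsub>alg A (vtx C ?\<phi> 0)\<^esub>"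
        using red unfolding reduced_asimplicial_def by blast
      then show ?thesis by (simp add: vtx_def)
    qed
    then show "\<forall>x\<in>Obj C. \<forall>u\<in>carrier (alg A x). deformed_act F (Ident C x) u = u"
      using ident by blast
  next
    assume id: "\<forall>x\<in>Obj C. \<forall>u\<in>carrier (alg A x). deformed_act F (Ident C x) u = u"
    have van: "vanishes C A p q (F p q)" if "(p, q) \<notin> {(0, 2), (1, 1)}" for p q
      using degree_oneD(2)[OF F that] .
    have "finite {(p, q). \<not> vanishes C A p q (F p q)}"
      by (rule finite_subset[of _ "{(0, 2), (1, 1)}"]) (use van in auto)
    moreover have "F p q \<phi> as = \<zero>\<^bsub>alg A (vtx C \<phi> 0)\<^esub>"
      if \<phi>: "\<phi> \<in> strings C p" "set (snd \<phi>) \<inter> Ident C ` Obj C \<noteq> {}"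
        and as: "as \<in> tuples (alg A (vtx C \<phi> p)) q" for p q \<phi> as
    proof (cases "(p, q) = (1, 1)")
      case True
      with \<phi>(1) obtain \<psi> where \<psi>: "\<phi> = (Tgt C \<psi>, [\<psi>])" using strings_1 by blast
      with \<phi>(2) obtain x where x: "x \<in> Obj C" "\<psi> = Ident C x" by auto
      have v: "vtx C \<phi> 1 = x" "vtx C \<phi> 0 = x" "\<phi> = (x, [Ident C x])"
        using x \<psi> by (simp_all add: vtx_def ident_src ident_tgt)
      have "as \<in> tuples (alg A (vtx C \<phi> 1)) 1" using as True by simp
      then obtain u where u: "as = [u]" "u \<in> carrier (alg A x)" unfolding v(1) tuples_1 by blast
      have "F 1 1 (x, [Ident C x]) [u] = \<zero>\<^bsub>alg A x\<^esub>" using id ident x(1) u(2) by blast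
      then show ?thesis using True unfolding v(2) unfolding v(3) u(1) by simp
    next
      case False
      have "(p, q) \<noteq> (0, 2)"
      proof
        assume "(p, q) = (0, 2)"
        then have "\<phi> \<in> strings C 0" using \<phi>(1) by simp
        with \<phi>(2) show False unfolding strings_0 by auto
      qed
      with False van have "vanishes C A p q (F p q)" by blast
      then show ?thesis using \<phi>(1) as unfolding vanishes_def by blast
    qed
    moreover have "vanishes C A p 0 (F p 0)" for p by (rule van) simp
    ultimately show "F \<in> reduced_asimplicial R C A"
      unfolding reduced_asimplicial_def using DF(1) by blast
  qed
qed

end

end

theorem theorem7p18:
  fixes R :: "('k, 'r) ring_scheme"
    and C :: "('o, 'm) category"
    and A :: "('o, 'm, 'k, 'a) diagram"
  assumes "field R"
    and "small_category C"
    and "diagram_of_algebras R C A"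
  shows "{F \<in> reduced_asimplicial R C A. shifted_degree C A 1 F \<and> maurer_cartan C A F}
       = {F. deformation R C A F}"
proof -
  interpret algebra_diagram R C A
    using assms(2,3) by (rule algebra_diagram.intro)
  have deg: "degree_one R C A F" if "F \<in> reduced_asimplicial R C A" "shifted_degree C A 1 F" for F
    unfolding degree_one_def
  proof (intro conjI allI impI)
    show "F p q \<in> cochains R C A p q" for p q
      using that(1) unfolding reduced_asimplicial_def by blast
    show "vanishes C A p q (F p q)" if pq: "(p, q) \<notin> {(0, 2), (1, 1)}" for p q
    proof (cases "int p + int q - 1 = 1")
      case True
      \<comment> \<open>Here \<open>p + q = 2\<close>, so outside the two allowed bidegrees only
        \<open>(2, 0)\<close> is left, and the asimplicial subcomplex has nothing in it.\<close>
      with pq have "q = 0" by auto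
      then show ?thesis using \<open>F \<in> reduced_asimplicial R C A\<close> unfolding reduced_asimplicial_def by blast
    next
      case False
      then show ?thesis using \<open>shifted_degree C A 1 F\<close> unfolding shifted_degree_def by blast
    qed
  qed
  have shift: "shifted_degree C A 1 F" if "degree_one R C A F" for F
    unfolding shifted_degree_def
  proof (intro allI impI)
    fix p q assume "int p + int q - 1 \<noteq> 1"
    then show "vanishes C A p q (F p q)" by (intro degree_oneD(2)[OF that]) auto
  qed
  have iff: "F \<in> reduced_asimplicial R C A \<and> maurer_cartan C A F \<longleftrightarrow>
      diagram_of_algebras R C (deformed_diagram C A (F 0 2) (F 1 1))" if "degree_one R C A F" for F
    unfolding maurer_cartan_iff[OF that] mc_term_vanishes_iff[OF that]
      reduced_iff_preserves_identities[OF that] deformed_diagram_iff[OF that] by blast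
  have "deformation R C A F \<longleftrightarrow>
      degree_one R C A F \<and> diagram_of_algebras R C (deformed_diagram C A (F 0 2) (F 1 1))" for F
    unfolding deformation_def degree_one_def by blast
  then show ?thesis using deg shift iff by blast
qed

end
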